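(* Let $r_0>0$ be such that $\Omega^{r_0}$ is nonempty and let $0<r<r_0/3$. There exist a universal constant $\alpha\in(0,1)$ and constants $\mathbf{c}=\mathbf{c}(n)\ge 1$ and $\mathbf{c}_1=\mathbf{c}_1(n,r_0)>0$ (none of them depending on $r$) such that for all $x_0\in\Omega^{3r}$, all $V\in L^\infty(\Omega)$ and all $u\in H^2(\Omega)$ satisfying $(-\Delta+V)u=0$ in $\Omega$, $$\|u\|_{L^2(B(x_0,2r))}\le \mathbf{c}\,e^{\mathbf{c}_1\kappa_V}\,\|u\|_{L^2(B(x_0,r))}^{\alpha}\,\|u\|_{L^2(B(x_0,3r))}^{1-\alpha},$$ where $\kappa_V:=\|V\|_{L^\infty(\Omega)}$.
   Context: $n\ge 3$ is an integer and $\Omega\subset\mathbb{R}^n$ is a bounded Lipschitz domain. For $r>0$, $\Omega^r:=\{x\in\Omega:\ \mathrm{dist}(x,\mathbb{R}^n\setminus\Omega)>r\}$. $B(x_0,r)$ is the open ball of center $x_0$ and radius $r$. A constant written $C=C(a,b,\dots)$ depends only on $a,b,\dots$; a universal constant depends on none of the data. *)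

theory Defs
  imports "HOL-Probability.Essential_Supremum"
begin

text \<open>
  The dimension \<open>n\<close> has to be quantified inside a formula (there are constants that must not depend on
  it), so \<open>n\<close>-dimensional Euclidean space is not a type but the carrier
  \<open>{..<n} \<rightarrow>\<^sub>E UNIV\<close>. This is both the topspace of the library's product topology and the space of the
  library's product measure. Scalar functions are total functions on \<^typ>\<open>nat \<Rightarrow> real\<close>; only their
  values on the relevant part of the carrier matter.
\<close>

definition Rn :: "nat \<Rightarrow> (nat \<Rightarrow> real) set" where
  "Rn n = ({..<n} \<rightarrow>\<^sub>E UNIV)"

definition Rn_top :: "nat \<Rightarrow> (nat \<Rightarrow> real) topology" where
  "Rn_top n = product_topology (\<lambda>_. euclideanreal) {..<n}"

definition Rn_dist :: "nat \<Rightarrow> (nat \<Rightarrow> real) \<Rightarrow> (nat \<Rightarrow> real) \<Rightarrow> real" where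
  "Rn_dist n x y = L2_set (\<lambda>i. x i - y i) {..<n}"

definition Rn_ball :: "nat \<Rightarrow> (nat \<Rightarrow> real) \<Rightarrow> real \<Rightarrow> (nat \<Rightarrow> real) set" where
  "Rn_ball n x r = {y \<in> Rn n. Rn_dist n x y < r}"

text \<open>Lebesgue measure (on all Lebesgue measurable sets), restricted to \<open>A\<close>.\<close>

definition leb_on :: "nat \<Rightarrow> (nat \<Rightarrow> real) set \<Rightarrow> (nat \<Rightarrow> real) measure" where
  "leb_on n A = restrict_space (completion (Pi\<^sub>M {..<n} (\<lambda>_. lborel))) A"


section \<open>Domains\<close>

text \<open>
  The boundary is locally a Lipschitz graph: near each boundary point, and after a rigid motion \<open>T\<close>,
  the set lies strictly above the graph of a Lipschitz function \<open>\<gamma>\<close> of the first \<open>n - 1\<close> coordinates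
  (meaningful for \<open>n \<ge> 3\<close>).
\<close>

definition lipschitz_boundary :: "nat \<Rightarrow> (nat \<Rightarrow> real) set \<Rightarrow> bool" where
  "lipschitz_boundary n \<Omega> \<longleftrightarrow>
     (\<forall>p \<in> (Rn_top n) frontier_of \<Omega>. \<exists>\<rho> T \<gamma> L.
        \<rho> > 0 \<and>
        bij_betw T (Rn n) (Rn n) \<and> (\<forall>x\<in>Rn n. \<forall>y\<in>Rn n. Rn_dist n (T x) (T y) = Rn_dist n x y) \<and>
        (\<forall>x\<in>Rn (n - 1). \<forall>y\<in>Rn (n - 1). \<bar>\<gamma> x - \<gamma> y\<bar> \<le> L * Rn_dist (n - 1) x y) \<and>
        \<Omega> \<inter> Rn_ball n p \<rho> = {x \<in> Rn_ball n p \<rho>. T x (n - 1) > \<gamma> (restrict (T x) {..<n - 1})})"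

definition bounded_lipschitz_domain :: "nat \<Rightarrow> (nat \<Rightarrow> real) set \<Rightarrow> bool" where
  "bounded_lipschitz_domain n \<Omega> \<longleftrightarrow>
     \<Omega> \<noteq> {} \<and> openin (Rn_top n) \<Omega> \<and> connectedin (Rn_top n) \<Omega> \<and>
     (\<exists>M. \<forall>x\<in>\<Omega>. L2_set x {..<n} \<le> M) \<and> lipschitz_boundary n \<Omega>"

text \<open>The set \<open>\<Omega>\<^sup>r\<close>. The infimum is over a nonempty set, since \<open>\<Omega>\<close> will be bounded.\<close>

definition inner_part :: "nat \<Rightarrow> (nat \<Rightarrow> real) set \<Rightarrow> real \<Rightarrow> (nat \<Rightarrow> real) set" where
  "inner_part n \<Omega> r = {x \<in> \<Omega>. (INF y \<in> Rn n - \<Omega>. Rn_dist n x y) > r}"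


section \<open>Function spaces\<close>

definition L2_space :: "nat \<Rightarrow> (nat \<Rightarrow> real) set \<Rightarrow> ((nat \<Rightarrow> real) \<Rightarrow> complex) set" where
  "L2_space n A = {f \<in> borel_measurable (leb_on n A). integrable (leb_on n A) (\<lambda>x. (cmod (f x))\<^sup>2)}"

definition L2_norm :: "nat \<Rightarrow> (nat \<Rightarrow> real) set \<Rightarrow> ((nat \<Rightarrow> real) \<Rightarrow> complex) \<Rightarrow> real" where
  "L2_norm n A f = sqrt (\<integral>x. (cmod (f x))\<^sup>2 \<partial>leb_on n A)"

definition Linf_space :: "nat \<Rightarrow> (nat \<Rightarrow> real) set \<Rightarrow> ((nat \<Rightarrow> real) \<Rightarrow> complex) set" where
  "Linf_space n A = {f \<in> borel_measurable (leb_on n A). esssup (leb_on n A) (\<lambda>x. ennreal (cmod (f x))) < \<infinity>}"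

definition Linf_norm :: "nat \<Rightarrow> (nat \<Rightarrow> real) set \<Rightarrow> ((nat \<Rightarrow> real) \<Rightarrow> complex) \<Rightarrow> real" where
  "Linf_norm n A f = enn2real (esssup (leb_on n A) (\<lambda>x. ennreal (cmod (f x))))"

primrec partials :: "nat list \<Rightarrow> ((nat \<Rightarrow> real) \<Rightarrow> real) \<Rightarrow> (nat \<Rightarrow> real) \<Rightarrow> real" where
  "partials [] \<phi> = \<phi>"
| "partials (i # is) \<phi> = (\<lambda>x. deriv (\<lambda>t. partials is \<phi> (x(i := t))) (x i))"

definition smooth :: "nat \<Rightarrow> ((nat \<Rightarrow> real) \<Rightarrow> real) \<Rightarrow> bool" where
  "smooth n \<phi> \<longleftrightarrow>
     (\<forall>is \<in> lists {..<n}.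
        continuous_map (Rn_top n) euclideanreal (partials is \<phi>) \<and>
        (\<forall>i<n. \<forall>x\<in>Rn n. (\<lambda>t. partials is \<phi> (x(i := t))) differentiable (at (x i))))"

text \<open>
  Smooth functions with compact support in \<open>\<Omega>\<close>. Real-valued ones suffice to test complex-valued
  functions, by linearity.
\<close>

definition test_functions :: "nat \<Rightarrow> (nat \<Rightarrow> real) set \<Rightarrow> ((nat \<Rightarrow> real) \<Rightarrow> real) set" where
  "test_functions n \<Omega> =
     {\<phi>. smooth n \<phi> \<and> (\<exists>K. compactin (Rn_top n) K \<and> K \<subseteq> \<Omega> \<and> (\<forall>x\<in>Rn n - K. \<phi> x = 0))}"

definition has_weak_deriv ::
  "nat \<Rightarrow> (nat \<Rightarrow> real) set \<Rightarrow> nat list \<Rightarrow> ((nat \<Rightarrow> real) \<Rightarrow> complex) \<Rightarrow> ((nat \<Rightarrow> real) \<Rightarrow> complex) \<Rightarrow> bool" where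
  "has_weak_deriv n \<Omega> is u g \<longleftrightarrow>
     (\<forall>\<phi> \<in> test_functions n \<Omega>.
        (\<integral>x. u x * of_real (partials is \<phi> x) \<partial>leb_on n \<Omega>)
        = (-1) ^ length is * (\<integral>x. g x * of_real (\<phi> x) \<partial>leb_on n \<Omega>))"

definition Sobolev_H :: "nat \<Rightarrow> nat \<Rightarrow> (nat \<Rightarrow> real) set \<Rightarrow> ((nat \<Rightarrow> real) \<Rightarrow> complex) set" where
  "Sobolev_H k n \<Omega> =
     {u \<in> L2_space n \<Omega>. \<forall>is \<in> lists {..<n}. length is \<le> k \<longrightarrow> (\<exists>g \<in> L2_space n \<Omega>. has_weak_deriv n \<Omega> is u g)}"

text \<open>
  \<open>(-\<Delta> + V) u = 0\<close> almost everywhere, for \<open>u\<close> in \<open>H\<^sup>2\<close>: here \<open>D i\<close> is the weak second derivative of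
  \<open>u\<close> in direction \<open>i\<close>, which is unique up to null sets.
\<close>

definition schrodinger_solution ::
  "nat \<Rightarrow> (nat \<Rightarrow> real) set \<Rightarrow> ((nat \<Rightarrow> real) \<Rightarrow> complex) \<Rightarrow> ((nat \<Rightarrow> real) \<Rightarrow> complex) \<Rightarrow> bool" where
  "schrodinger_solution n \<Omega> V u \<longleftrightarrow>
     (\<exists>D. (\<forall>i<n. D i \<in> L2_space n \<Omega> \<and> has_weak_deriv n \<Omega> [i, i] u (D i)) \<and>
          (AE x in leb_on n \<Omega>. - (\<Sum>i<n. D i x) + V x * u x = 0))"

end

theory Submission
  imports Defs
begin

text \<open>
  The proof is a Carleman estimate. With \<open>X = (x - x\<^sub>0) / r\<close>, \<open>S = |X|\<^sup>2\<close> and \<open>t = ln |X|\<close>, the weight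
  \<open>\<phi> = t\<^sup>2/2 - 5 t\<close> is decreasing on the ball of radius 3 and convex in \<open>t\<close>. Conjugating \<open>|X|\<^sup>2 \<Delta>\<close> by
  \<open>e\<^sup>\<tau>\<^sup>\<phi>\<close> gives a symmetric plus an antisymmetric operator for the measure \<open>|X|\<^sup>-\<^sup>2 dx\<close>; twice their product is
  a divergence plus \<open>4 \<tau>\<^sup>3 \<phi>'\<^sup>2 \<phi>'' z\<^sup>2 / S\<close> plus a square, because \<open>t\<close> linearizes the radial scaling
  and no lower-order term involving \<open>n\<close> survives. Hence the weight, and with it \<open>\<alpha>\<close>, is universal.
  Applied to a cutoff of the mollified real and imaginary parts of \<open>u\<close>, with the gradient in the cutoff zones
  removed by a Caccioppoli identity, and after letting the mollification parameter tend to 0, this gives for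
  all \<open>\<tau> \<ge> 4 (1 + r\<^sup>2 \<kappa>)\<close>
  \<open>\<parallel>u\<parallel>\<^sup>2(2r) \<le> C(n) (e\<^sup>2\<^sup>\<tau>\<^sup>P \<parallel>u\<parallel>\<^sup>2(r) + e\<^sup>-\<^sup>2\<^sup>\<tau>\<^sup>Q \<parallel>u\<parallel>\<^sup>2(3r))\<close>,
  since the potential term is absorbed by the factor \<open>\<tau>\<^sup>3\<close>. Optimizing \<open>\<tau>\<close> yields \<open>\<alpha> = Q / (P + Q)\<close>.
\<close>

section \<open>A smooth step function\<close>

text \<open>The coordinates X make the weight, the cutoffs and their derivatives independent of r
  and x0. The potential then enters only through r^2 kappa, at most r0^2 kappa, which is why c1
  depends on r0. In terms of S the cutoff rises on [1/4, 3/4] and falls on [6, 8]: it avoids the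
  singularity of ln |X| at the center and is 1 on the shell between the radii r and 2r. Since the
  weight decreases, inner errors cost at most its value at S = 1/4 and outer errors at most its
  value at S = 6; division by its value at S = 4 gives P and Q. The divergence identity is pointwise
  and needs classical second derivatives, whereas u is only in H^2; hence the mollification. As V is
  merely bounded, the mollified equation is not a Schrodinger equation again. It is kept in the form
  "Laplacian of the mollified u = mollified weak Laplacian", and |V u| \<le> kappa |u| is used only
  after the limit. A complex V mixes real and imaginary parts, so their two estimates are added
  before that bound is applied.\<close>

fun Ck :: "nat \<Rightarrow> (real \<Rightarrow> real) \<Rightarrow> bool" where
  "Ck 0 f = True"
| "Ck (Suc k) f = (\<exists>f'. (\<forall>x. (f has_real_derivative f' x) (at x)) \<and> Ck k f')"

lemma Ck_Suc_imp: "Ck (Suc k) f \<Longrightarrow> Ck k f"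
proof (induction k arbitrary: f)
  case (Suc k)
  then show ?case by (metis Ck.simps(2))
qed simp

lemma Ck_add: "Ck k f \<Longrightarrow> Ck k g \<Longrightarrow> Ck k (\<lambda>x. f x + g x)"
proof (induction k arbitrary: f g)
  case (Suc k)
  then obtain f' g' where "\<forall>x. (f has_real_derivative f' x) (at x)" "Ck k f'"
    "\<forall>x. (g has_real_derivative g' x) (at x)" "Ck k g'" by auto
  with Suc.IH show ?case
    by (auto intro!: exI[of _ "\<lambda>x. f' x + g' x"] derivative_eq_intros)
qed simp

lemma Ck_uminus: "Ck k f \<Longrightarrow> Ck k (\<lambda>x. - f x)"
proof (induction k arbitrary: f)
  case (Suc k)
  then obtain f' where "\<forall>x. (f has_real_derivative f' x) (at x)" "Ck k f'" by auto
  with Suc.IH show ?case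
    by (auto intro!: exI[of _ "\<lambda>x. - f' x"] derivative_eq_intros)
qed simp

lemma Ck_mult: "Ck k f \<Longrightarrow> Ck k g \<Longrightarrow> Ck k (\<lambda>x. f x * g x)"
proof (induction k arbitrary: f g)
  case (Suc k)
  then obtain f' g' where fg: "\<forall>x. (f has_real_derivative f' x) (at x)" "Ck k f'"
    "\<forall>x. (g has_real_derivative g' x) (at x)" "Ck k g'" by auto
  have "Ck k (\<lambda>x. f' x * g x + g' x * f x)"
    using Suc fg Ck_Suc_imp by (intro Ck_add Suc.IH) auto
  with fg show ?case
    by (auto intro!: exI[of _ "\<lambda>x. f' x * g x + g' x * f x"] derivative_eq_intros)
qed simp

lemma Ck_inverse: "Ck k f \<Longrightarrow> (\<And>x. f x \<noteq> 0) \<Longrightarrow> Ck k (\<lambda>x. inverse (f x))"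
proof (induction k)
  case (Suc k)
  then obtain f' where f: "\<forall>x. (f has_real_derivative f' x) (at x)" "Ck k f'" by auto
  have "Ck k (\<lambda>x. inverse (f x))" using Suc Ck_Suc_imp by auto
  then have "Ck k (\<lambda>x. - (inverse (f x) * f' x * inverse (f x)))"
    using f by (intro Ck_uminus Ck_mult) auto
  with f Suc.prems(2) show ?case
    by (auto intro!: exI[of _ "\<lambda>x. - (inverse (f x) * f' x * inverse (f x))"] derivative_eq_intros)
qed simp

lemma Ck_reflect: "Ck k f \<Longrightarrow> Ck k (\<lambda>x. f (1 - x))"
proof (induction k arbitrary: f)
  case (Suc k)
  then obtain f' where f: "\<forall>x. (f has_real_derivative f' x) (at x)" "Ck k f'" by auto
  have "((\<lambda>x. f (1 - x)) has_real_derivative - f' (1 - x)) (at x)" for x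
  proof -
    have "((-) 1 has_real_derivative - 1) (at x)" by (auto intro!: derivative_eq_intros)
    from DERIV_chain2[OF f(1)[rule_format] this] show ?thesis by simp
  qed
  with f Suc.IH show ?case
    by (auto intro!: exI[of _ "\<lambda>x. - f' (1 - x)"] Ck_uminus)
qed simp

text \<open>Polynomials in 1/x times exp(-1/x), extended by 0: a class that contains the standard
  flat function (\<open>p = 1\<close>) and is closed under differentiation, so a single derivative
  formula yields all orders.\<close>

definition exp_tail :: "real poly \<Rightarrow> real \<Rightarrow> real" where
  "exp_tail p x = (if x > 0 then poly p (1 / x) * exp (- (1 / x)) else 0)"

lemma poly_times_exp_tendsto_0: "((\<lambda>x. poly p x * exp (- x)) \<longlongrightarrow> 0) at_top" for p :: "real poly"
proof (induction p)
  case (pCons a p)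
  have "((\<lambda>x. \<Sum>i\<le>degree (pCons a p). coeff (pCons a p) i * (x ^ i / exp x)) \<longlongrightarrow> (\<Sum>i\<le>degree (pCons a p). coeff (pCons a p) i * 0)) at_top"
    by (intro tendsto_intros tendsto_power_div_exp_0)
  moreover have "(\<lambda>x. \<Sum>i\<le>degree (pCons a p). coeff (pCons a p) i * (x ^ i / exp x)) = (\<lambda>x. poly (pCons a p) x * exp (- x))"
    by (simp only: poly_altdef sum_distrib_right exp_minus divide_inverse mult.assoc)
  ultimately show ?case by simp
qed simp

text \<open>For x > 0 the chain rule brings down 1/x^2 from the exponential and -1/x^2 from
  \<open>p\<close>, whence X^2 (p - p'). Only the point 0 needs a limit.\<close>

lemma exp_tail_has_derivative:
  "(exp_tail p has_real_derivative exp_tail ([:0, 0, 1:] * (p - pderiv p)) x) (at x)"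
proof (cases "x = 0")
  case True
  have "((\<lambda>h. exp_tail p h / h) \<longlongrightarrow> 0) (at_right 0)"
  proof -
    \<comment> \<open>The difference quotient at 0 stays in the class: division by h multiplies the
      polynomial in 1/h by its variable, which is \<open>pCons 0 p\<close>.\<close>
    have "((\<lambda>x. poly (pCons 0 p) (inverse x) * exp (- inverse x)) \<longlongrightarrow> 0) (at_right 0)"
      by (rule filterlim_compose[OF poly_times_exp_tendsto_0 filterlim_inverse_at_top_right])
    moreover have "eventually (\<lambda>h. poly (pCons 0 p) (inverse h) * exp (- inverse h) = exp_tail p h / h) (at_right 0)"
      unfolding eventually_at_right_field by (intro exI[of _ 1]) (simp add: exp_tail_def divide_inverse mult_ac)
    ultimately show ?thesis by (rule Lim_transform_eventually)
  qed
  moreover have "((\<lambda>h. exp_tail p h / h) \<longlongrightarrow> 0) (at_left 0)"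
  proof (rule tendsto_eventually)
    show "eventually (\<lambda>h. exp_tail p h / h = 0) (at_left 0)"
      unfolding eventually_at_left_field by (intro exI[of _ "-1"]) (auto simp: exp_tail_def)
  qed
  ultimately have "((\<lambda>h. exp_tail p h / h) \<longlongrightarrow> 0) (at 0)"
    by (rule filterlim_split_at[rotated])
  with True show ?thesis by (simp add: DERIV_def exp_tail_def)
next
  case False
  show ?thesis
  proof (cases "x > 0")
    case True
    have 1: "((\<lambda>x. 1 / x) has_real_derivative - (1 / x\<^sup>2)) (at x)"
      using True by (auto intro!: derivative_eq_intros simp: power2_eq_square)
    have 2: "((\<lambda>x. poly p (1 / x)) has_real_derivative poly (pderiv p) (1 / x) * - (1 / x\<^sup>2)) (at x)"
      by (rule DERIV_chain2[OF poly_DERIV 1])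
    have 3: "((\<lambda>x. exp (- (1 / x))) has_real_derivative exp (- (1 / x)) * (1 / x\<^sup>2)) (at x)"
      by (rule DERIV_chain2[OF DERIV_exp]) (use DERIV_minus[OF 1] in simp)
    have "((\<lambda>x. poly p (1 / x) * exp (- (1 / x))) has_real_derivative exp_tail ([:0, 0, 1:] * (p - pderiv p)) x) (at x)"
      by (rule DERIV_cong[OF DERIV_mult[OF 2 3]])
         (use True in \<open>simp add: exp_tail_def power2_eq_square divide_inverse algebra_simps\<close>)
    then show ?thesis
      by (rule has_field_derivative_transform_within_open[of _ _ _ "{0<..}"])
         (use True in \<open>auto simp: exp_tail_def\<close>)
  next
    case F: False
    have "((\<lambda>x. 0) has_real_derivative exp_tail ([:0, 0, 1:] * (p - pderiv p)) x) (at x)"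
      using F by (simp add: exp_tail_def)
    then show ?thesis
      by (rule has_field_derivative_transform_within_open[of _ _ _ "{..<0}"])
         (use F False in \<open>auto simp: exp_tail_def\<close>)
  qed
qed

lemma Ck_exp_tail: "Ck k (exp_tail p)"
proof (induction k arbitrary: p)
  case (Suc k)
  then show ?case
    using exp_tail_has_derivative by (auto intro!: exI[of _ "exp_tail ([:0, 0, 1:] * (p - pderiv p))"])
qed simp

text \<open>For each \<open>k\<close> the predicate \<open>Ck k\<close> has its own chain of
  witnesses; uniqueness of derivatives identifies all of them with the iterates of
  \<open>deriv\<close>.\<close>

lemma Ck_all_imp_derivative_family:
  assumes "\<And>k. Ck k f"
  shows "\<exists>F. F 0 = f \<and> (\<forall>k x. (F k has_real_derivative F (Suc k) x) (at x))"
proof -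
  define F where "F k = (deriv ^^ k) f" for k
  have all: "\<forall>j. Ck j (F k)" for k
  proof (induction k)
    case (Suc k)
    show ?case
    proof
      fix j
      from Suc obtain f' where "\<forall>x. (F k has_real_derivative f' x) (at x)" "Ck j f'"
        by (meson Ck.simps(2))
      moreover then have "f' = F (Suc k)"
        unfolding F_def using DERIV_imp_deriv[of "(deriv ^^ k) f"] by (intro ext) (metis comp_apply funpow.simps(2))
      ultimately show "Ck j (F (Suc k))" by simp
    qed
  qed (use assms in \<open>simp add: F_def\<close>)
  have "(F k has_real_derivative F (Suc k) x) (at x)" for k x
  proof -
    from all[of k] have "Ck (Suc 0) (F k)" by blast
    then obtain f' where "\<forall>x. (F k has_real_derivative f' x) (at x)" by auto
    then show ?thesis by (metis DERIV_imp_deriv F_def comp_apply funpow.simps(2))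
  qed
  then show ?thesis by (intro exI[of _ F]) (auto simp: F_def)
qed

text \<open>The classical quotient g(x) / (g(x) + g(1 - x)) with g(x) = exp(-1/x) for x > 0; the
  first argument counts derivatives. Monotonicity is recorded because the first derivative later
  serves as the mollifying density.\<close>

lemma exists_smooth_step:
  "\<exists>smooth_step :: nat \<Rightarrow> real \<Rightarrow> real.
     (\<forall>k x. (smooth_step k has_real_derivative smooth_step (Suc k) x) (at x)) \<and>
     (\<forall>k. \<forall>x\<le>0. smooth_step k x = 0) \<and> (\<forall>x\<ge>1. smooth_step 0 x = 1) \<and> (\<forall>k. \<forall>x\<ge>1. smooth_step (Suc k) x = 0) \<and>
     (\<forall>x. 0 \<le> smooth_step 0 x) \<and> (\<forall>x. smooth_step 0 x \<le> 1) \<and> (\<forall>x. 0 \<le> smooth_step 1 x)"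
proof -
  define g where "g = exp_tail 1"
  have g0: "g x \<ge> 0" "x > 0 \<Longrightarrow> g x > 0" "x \<le> 0 \<Longrightarrow> g x = 0" for x
    by (auto simp: g_def exp_tail_def)
  define g' where "g' = exp_tail [:0,0,1:]"
  have gd: "(g has_real_derivative g' x) (at x)" for x
    using exp_tail_has_derivative[of 1 x] by (simp add: g_def g'_def)
  have g'0: "g' x \<ge> 0" for x by (auto simp: g'_def exp_tail_def)
  have pos: "g x + g (1 - x) > 0" for x
    using g0[of x] g0[of "1 - x"] by (cases "x > 0") auto
  define f where "f x = g x * inverse (g x + g (1 - x))" for x
  have "Ck k f" for k
    unfolding f_def using pos Ck_exp_tail[of k 1]
    by (intro Ck_mult Ck_inverse Ck_add Ck_reflect) (auto simp: g_def less_imp_neq[THEN not_sym])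
  from Ck_all_imp_derivative_family[OF this] obtain F where
    F: "F 0 = f" "\<And>k x. (F k has_real_derivative F (Suc k) x) (at x)" by blast
  have f0: "0 \<le> f x" "f x \<le> 1" for x
    using pos[of x] g0(1)[of x] g0(1)[of "1 - x"] by (auto simp: f_def field_simps)
  have left: "F k x = 0" if "x < 0" for k x
    using that
  proof (induction k arbitrary: x)
    case 0 then show ?case by (simp add: F f_def g0)
  next
    case (Suc k)
    have "eventually (\<lambda>y. F k y = 0) (nhds x)"
      using Suc by (intro eventually_nhds_in_open[of "{..<0}" x, THEN eventually_mono]) auto
    then have "(F k has_real_derivative 0) (at x)" by (subst DERIV_cong_ev) auto
    with F(2) show ?case by (metis DERIV_unique)
  qed
  have right: "F k x = (if k = 0 then 1 else 0)" if "x > 1" for k x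
    using that
  proof (induction k arbitrary: x)
    case 0 then show ?case using g0(2)[of x] by (simp add: F f_def g0(3)[of "1 - x"])
  next
    case (Suc k)
    have "eventually (\<lambda>y. F k y = (if k = 0 then 1 else 0)) (nhds x)"
      using Suc by (intro eventually_nhds_in_open[of "{1<..}" x, THEN eventually_mono]) auto
    then have "(F k has_real_derivative 0) (at x)" by (subst DERIV_cong_ev) auto
    with F(2) show ?case by (metis DERIV_unique nat.distinct(1))
  qed
  have cont: "isCont (F k) x" for k x using F(2) DERIV_isCont by blast
  \<comment> \<open>At the end points 0 and 1 the function is constant on one side only, so the
    values of the derivatives there come from one-sided limits.\<close>
  have l0: "F k 0 = 0" for k
  proof -
    have "(F k \<longlongrightarrow> F k 0) (at_left 0)" using cont[where x=0 and k=k] by (simp add: isCont_def filterlim_at_split)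
    moreover have "(F k \<longlongrightarrow> 0) (at_left 0)"
      using left by (intro tendsto_eventually) (auto simp: eventually_at_left_field intro!: exI[of _ "-1"])
    ultimately show ?thesis by (rule tendsto_unique[rotated]) simp
  qed
  have r1: "F k 1 = (if k = 0 then 1 else 0)" for k
  proof -
    have "(F k \<longlongrightarrow> F k 1) (at_right 1)" using cont[where x=1 and k=k] by (simp add: isCont_def filterlim_at_split)
    moreover have "(F k \<longlongrightarrow> (if k = 0 then 1 else 0)) (at_right 1)"
      using right by (intro tendsto_eventually) (auto simp: eventually_at_right_field intro!: exI[of _ "2"])
    ultimately show ?thesis by (rule tendsto_unique[rotated]) simp
  qed
  have mono: "F 1 x \<ge> 0" for x
  proof -
    have "(f has_real_derivative (g' x * g (1 - x) + g x * g' (1 - x)) / (g x + g (1 - x))^2) (at x)"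
    proof -
      have r: "((\<lambda>x. g (1 - x)) has_real_derivative - g' (1 - x)) (at x)"
      proof -
        have "((-) 1 has_real_derivative - 1) (at x)" by (auto intro!: derivative_eq_intros)
        from DERIV_chain2[OF gd this] show ?thesis by simp
      qed
      show ?thesis unfolding f_def
        using pos[of x] by (auto intro!: derivative_eq_intros gd r simp: field_simps power2_eq_square)
    qed
    then have "F 1 x = (g' x * g (1 - x) + g x * g' (1 - x)) / (g x + g (1 - x))^2"
      using F(2)[of 0 x] F(1) by (metis DERIV_unique One_nat_def)
    then show ?thesis using g0(1) g'0 by simp
  qed
  have left': "F k x = 0" if "x \<le> 0" for k x
    using that left l0 by (cases "x = 0") auto
  have right': "F k x = (if k = 0 then 1 else 0)" if "x \<ge> 1" for k x
    using that right r1 by (cases "x = 1") auto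
  have "F 0 x = 1" "F (Suc k) x = 0" if "x \<ge> 1" for k x
    using right'[OF that, of 0] right'[OF that, of "Suc k"] by auto
  then show ?thesis
    using left' mono by (intro exI[of _ F] conjI allI impI) (simp_all add: F f0)
qed

definition smooth_step :: "nat \<Rightarrow> real \<Rightarrow> real" where
  "smooth_step = (SOME smooth_step.
     (\<forall>k x. (smooth_step k has_real_derivative smooth_step (Suc k) x) (at x)) \<and>
     (\<forall>k. \<forall>x\<le>0. smooth_step k x = 0) \<and> (\<forall>x\<ge>1. smooth_step 0 x = 1) \<and> (\<forall>k. \<forall>x\<ge>1. smooth_step (Suc k) x = 0) \<and>
     (\<forall>x. 0 \<le> smooth_step 0 x) \<and> (\<forall>x. smooth_step 0 x \<le> 1) \<and> (\<forall>x. 0 \<le> smooth_step 1 x))"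

lemma smooth_step_deriv: "(smooth_step k has_real_derivative smooth_step (Suc k) x) (at x)"
  and smooth_step_le_0: "x \<le> 0 \<Longrightarrow> smooth_step k x = 0"
  and smooth_step_ge_1: "x \<ge> 1 \<Longrightarrow> smooth_step 0 x = 1"
  and smooth_step_Suc_ge_1: "x \<ge> 1 \<Longrightarrow> smooth_step (Suc k) x = 0"
  and smooth_step_nonneg: "0 \<le> smooth_step 0 x"
  and smooth_step_le_one: "smooth_step 0 x \<le> 1"
  and smooth_step_mono: "0 \<le> smooth_step (Suc 0) x"
  using someI_ex[OF exists_smooth_step, folded smooth_step_def] by auto

lemma continuous_on_smooth_step: "continuous_on A (smooth_step k)"
  using smooth_step_deriv by (meson DERIV_isCont continuous_at_imp_continuous_on)

lemma smooth_step_bounded: "\<exists>C. \<forall>x. \<bar>smooth_step k x\<bar> \<le> C"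
proof -
  have "bounded (smooth_step k ` {0..1})"
    by (intro compact_imp_bounded compact_continuous_image continuous_on_smooth_step) auto
  then obtain C where C: "\<forall>x\<in>{0..1}. \<bar>smooth_step k x\<bar> \<le> C"
    by (auto simp: bounded_iff)
  have "\<bar>smooth_step k x\<bar> \<le> max C 1" for x
  proof (cases "0 \<le> x \<and> x \<le> 1")
    case True then show ?thesis using C by (simp add: le_max_iff_disj)
  next
    case False then show ?thesis
      using smooth_step_le_0[of x k] smooth_step_ge_1[of x] smooth_step_Suc_ge_1[of x "k - 1"] by (cases k) (auto simp: not_le)
  qed
  then show ?thesis by blast
qed

section \<open>Calculus in scaled coordinates\<close>

abbreviation Leb :: "nat \<Rightarrow> (nat \<Rightarrow> real) measure" where
  "Leb n \<equiv> Pi\<^sub>M {..<n} (\<lambda>_. lborel)"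

interpretation lborel_product: product_sigma_finite "\<lambda>_::nat. lborel :: real measure" ..

text \<open>Fubini with the \<open>i\<close>-th variable innermost: on every line the fundamental
  theorem of calculus leaves two boundary values, both 0.\<close>

lemma integral_partial_derivative_eq_0:
  fixes F G :: "(nat \<Rightarrow> real) \<Rightarrow> real"
  assumes i: "i < n" and G: "integrable (Leb n) G"
    and deriv: "\<And>x. ((\<lambda>t. F (x(i := t))) has_real_derivative G x) (at (x i))"
    and zero: "\<And>x. \<bar>x i\<bar> \<ge> M \<Longrightarrow> F x = 0" "\<And>x. \<bar>x i\<bar> \<ge> M \<Longrightarrow> G x = 0"
  shows "(\<integral>x. G x \<partial>Leb n) = 0"
proof -
  have ins: "insert i ({..<n} - {i}) = {..<n}" using i by auto
  have "(\<integral>y. G (x(i := y)) \<partial>lborel) = 0" for x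
  proof (cases "integrable lborel (\<lambda>y. G (x(i := y)))")
    case True
    define N where "N = \<bar>M\<bar>"
    have "((\<lambda>y. G (x(i := y))) has_integral (F (x(i := N)) - F (x(i := -N)))) {-N..N}"
    proof (rule fundamental_theorem_of_calculus)
      fix t assume "t \<in> {-N..N}"
      have "((\<lambda>y. F (x(i := y))) has_real_derivative G (x(i := t))) (at t)"
        using deriv[of "x(i := t)"] by simp
      then show "((\<lambda>y. F (x(i := y))) has_vector_derivative G (x(i := t))) (at t within {-N..N})"
        by (simp add: has_real_derivative_iff_has_vector_derivative has_vector_derivative_at_within)
    qed (simp add: N_def)
    then have "((\<lambda>y. G (x(i := y))) has_integral 0) {-N..N}"
      using zero(1) by (simp add: N_def)
    then have "((\<lambda>y. G (x(i := y))) has_integral 0) UNIV"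
      by (rule has_integral_on_superset) (auto intro!: zero(2) simp: N_def)
    then show ?thesis
      using has_integral_integral_lborel[OF True] has_integral_unique by blast
  \<comment> \<open>Where the slice is not integrable its Bochner integral is 0 by default, so no
    exceptional null set has to be tracked.\<close>
  qed (simp add: not_integrable_integral_eq)
  then show ?thesis
    using lborel_product.product_integral_insert[of "{..<n} - {i}" i G] G
    by (simp only: ins) simp
qed

locale scaled_coordinates =
  fixes n :: nat and a :: "nat \<Rightarrow> real" and r :: real
  assumes r_pos: "r > 0"
begin

definition X :: "nat \<Rightarrow> (nat \<Rightarrow> real) \<Rightarrow> real" where
  "X i x = (x i - a i) / r"

definition S :: "(nat \<Rightarrow> real) \<Rightarrow> real" where
  "S x = (\<Sum>i<n. (X i x)\<^sup>2)"

text \<open>The number \<open>d\<close> is the derivative with respect to \<open>X i\<close>, that is \<open>r\<close> times the one with respect to \<open>x i\<close>.\<close>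

definition pd :: "nat \<Rightarrow> ((nat \<Rightarrow> real) \<Rightarrow> real) \<Rightarrow> (nat \<Rightarrow> real) \<Rightarrow> real \<Rightarrow> bool" where
  "pd i F x d \<longleftrightarrow> ((\<lambda>t. F (x(i := t))) has_real_derivative d / r) (at (x i))"

text \<open>\<open>S\<close> is a squared radius: the bounds mean 1/2 \<le> |X| \<le> 3, that is
  distances from r/2 to 3r.\<close>

definition annulus :: "(nat \<Rightarrow> real) set" where
  "annulus = {x. 1 / 4 \<le> S x \<and> S x \<le> 9}"

text \<open>
  Integrands are only ever controlled on the annulus: they carry factors \<open>ln S\<close> and \<open>1 / S\<close>, singular at 0, and
  functions that vanish outside it.
\<close>

definition tame :: "((nat \<Rightarrow> real) \<Rightarrow> real) \<Rightarrow> bool" where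
  "tame F \<longleftrightarrow> F \<in> borel_measurable (Leb n) \<and> (\<exists>C. \<forall>x\<in>annulus. \<bar>F x\<bar> \<le> C)"

lemma S_nonneg [simp]: "S x \<ge> 0"
  by (simp add: S_def sum_nonneg)

lemma pd_cong: "pd i F x d \<Longrightarrow> d = d' \<Longrightarrow> pd i F x d'" by simp

lemma pd_const: "pd i (\<lambda>_. c) x 0" by (simp add: pd_def)

lemma pd_add: "pd i F x d \<Longrightarrow> pd i G x e \<Longrightarrow> pd i (\<lambda>x. F x + G x) x (d + e)"
  unfolding pd_def by (auto dest: DERIV_add simp: add_divide_distrib)

lemma pd_diff: "pd i F x d \<Longrightarrow> pd i G x e \<Longrightarrow> pd i (\<lambda>x. F x - G x) x (d - e)"
  unfolding pd_def by (auto dest: DERIV_diff simp: diff_divide_distrib)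

lemma pd_mult: "pd i F x d \<Longrightarrow> pd i G x e \<Longrightarrow> pd i (\<lambda>x. F x * G x) x (d * G x + e * F x)"
  unfolding pd_def by (auto dest: DERIV_mult simp: add_divide_distrib)

lemma pd_sum: "(\<And>j. j \<in> A \<Longrightarrow> pd i (F j) x (d j)) \<Longrightarrow> pd i (\<lambda>x. \<Sum>j\<in>A. F j x) x (\<Sum>j\<in>A. d j)"
  unfolding pd_def sum_divide_distrib by (rule DERIV_sum)

lemma pd_chain: "(m has_real_derivative m') (at (F x)) \<Longrightarrow> pd i F x d \<Longrightarrow> pd i (\<lambda>x. m (F x)) x (m' * d)"
  unfolding pd_def using DERIV_chain2[of m m' "\<lambda>t. F (x(i := t))" "x i" "d / r" UNIV] by simp

lemma pd_X: "pd i (X j) x (if i = j then 1 else 0)"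
  unfolding pd_def X_def using r_pos by (auto intro!: derivative_eq_intros)

lemma pd_S: "i < n \<Longrightarrow> pd i S x (2 * X i x)"
proof -
  assume i: "i < n"
  have "pd i (\<lambda>x. \<Sum>j<n. X j x * X j x) x (\<Sum>j<n. (if i = j then 1 else 0) * X j x + (if i = j then 1 else 0) * X j x)"
    by (intro pd_sum pd_mult pd_X)
  also have "(\<lambda>x. \<Sum>j<n. X j x * X j x) = S"
    by (simp add: S_def fun_eq_iff power2_eq_square)
  also have "(\<Sum>j<n. (if i = j then 1 else 0) * X j x + (if i = j then 1 else 0) * X j x) = 2 * X i x"
    using i by (simp add: sum.distrib if_distrib[of "\<lambda>c. c * _"] sum_distrib_left[symmetric] cong: if_cong)
  finally show ?thesis .
qed

text \<open>Takes care of the center, where factors such as \<open>ln (S x)\<close> and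
  \<open>1 / S x\<close> are not differentiable but the products containing them vanish on a whole
  neighborhood.\<close>

lemma pd_zero_near:
  assumes "i < n" "S x < c" "\<And>y. S y < c \<Longrightarrow> F y = 0"
  shows "pd i F x 0"
proof -
  have "isCont (\<lambda>t. S (x(i := t))) (x i)"
    using pd_S[OF assms(1)] DERIV_isCont unfolding pd_def by blast
  then have "eventually (\<lambda>t. S (x(i := t)) < c) (nhds (x i))"
    using order_tendstoD(2)[of "\<lambda>t. S (x(i := t))" "S x" "at (x i)"] assms(2)
    by (simp add: isCont_def eventually_nhds_conv_at)
  then have "eventually (\<lambda>t. F (x(i := t)) = 0) (nhds (x i))"
    by (rule eventually_mono) (rule assms)
  then have "((\<lambda>t. F (x(i := t))) has_real_derivative 0) (at (x i))"
    by (subst DERIV_cong_ev) auto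
  then show ?thesis by (simp add: pd_def)
qed

lemma X_measurable [measurable]: "i < n \<Longrightarrow> X i \<in> borel_measurable (Leb n)"
  unfolding X_def by measurable

lemma S_measurable [measurable]: "S \<in> borel_measurable (Leb n)"
  unfolding S_def by measurable

lemma X_bound: "i < n \<Longrightarrow> \<bar>X i x\<bar> \<le> sqrt (S x)"
  unfolding S_def by (rule order_trans[OF _ real_sqrt_le_mono[OF member_le_sum[of i "{..<n}" "\<lambda>i. (X i x)\<^sup>2"]]]) auto

lemma tame_const: "tame (\<lambda>_. c)" by (auto simp: tame_def)

lemma tame_add: "tame F \<Longrightarrow> tame G \<Longrightarrow> tame (\<lambda>x. F x + G x)"
  unfolding tame_def
proof safe
  fix C D assume "\<forall>x\<in>annulus. \<bar>F x\<bar> \<le> C" "\<forall>x\<in>annulus. \<bar>G x\<bar> \<le> D"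
  then show "\<exists>C. \<forall>x\<in>annulus. \<bar>F x + G x\<bar> \<le> C" by (intro exI[of _ "C + D"]) fastforce
qed simp

lemma tame_mult: "tame F \<Longrightarrow> tame G \<Longrightarrow> tame (\<lambda>x. F x * G x)"
  unfolding tame_def
proof safe
  fix C D assume "\<forall>x\<in>annulus. \<bar>F x\<bar> \<le> C" "\<forall>x\<in>annulus. \<bar>G x\<bar> \<le> D"
  then show "\<exists>C. \<forall>x\<in>annulus. \<bar>F x * G x\<bar> \<le> C"
    by (intro exI[of _ "C * D"]) (auto simp: abs_mult intro!: mult_mono' )
qed simp

lemma tame_power: "tame F \<Longrightarrow> tame (\<lambda>x. F x ^ k)"
  by (induction k) (auto intro: tame_const tame_mult)

lemma tame_uminus: "tame F \<Longrightarrow> tame (\<lambda>x. - F x)"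
  using tame_mult[OF tame_const[of "-1"]] by simp

lemma tame_diff: "tame F \<Longrightarrow> tame G \<Longrightarrow> tame (\<lambda>x. F x - G x)"
  using tame_add[OF _ tame_uminus, of F G] by simp

lemma tame_sum: "(\<And>j. j \<in> A \<Longrightarrow> tame (F j)) \<Longrightarrow> tame (\<lambda>x. \<Sum>j\<in>A. F j x)"
  by (induction A rule: infinite_finite_induct) (auto intro: tame_const tame_add)

lemma tame_X: "i < n \<Longrightarrow> tame (X i)"
  unfolding tame_def
proof (intro conjI exI[of _ 3] ballI)
  fix x assume "i < n" "x \<in> annulus"
  then have "\<bar>X i x\<bar> \<le> sqrt 9" using X_bound[of i x] real_sqrt_le_mono[of "S x" 9] by (auto simp: annulus_def simp del: real_sqrt_le_iff)
  then show "\<bar>X i x\<bar> \<le> 3" by simp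
qed measurable

lemma tame_radial:
  assumes "m \<in> borel_measurable borel" "continuous_on {1/4..9} m"
  shows "tame (\<lambda>x. m (S x))"
proof -
  have "bounded (m ` {1/4..9})"
    by (intro compact_imp_bounded compact_continuous_image assms) auto
  then obtain C where "\<forall>x\<in>{1/4..9}. \<bar>m x\<bar> \<le> C"
    by (auto simp: bounded_iff)
  with assms(1) show ?thesis by (auto simp: tame_def annulus_def intro!: exI[of _ C])
qed

lemma tame_S: "tame S" using tame_radial[of "\<lambda>x. x"] by (simp add: continuous_on_id)

lemma tame_divide_S: "tame F \<Longrightarrow> tame (\<lambda>x. F x / S x)"
  unfolding divide_inverse by (intro tame_mult tame_radial) (auto intro!: continuous_intros)

lemma tame_divide_S_power: "tame F \<Longrightarrow> tame (\<lambda>x. F x / S x ^ k)"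
  unfolding divide_inverse by (intro tame_mult tame_radial) (auto intro!: continuous_intros)

lemma tame_radial_bounded:
  assumes "m \<in> borel_measurable borel" "\<And>s. \<bar>m s\<bar> \<le> C"
  shows "tame (\<lambda>x. m (S x))"
  using assms by (auto simp: tame_def)

lemmas tame_intros = tame_const tame_add tame_mult tame_power tame_uminus tame_diff tame_sum tame_X tame_S tame_divide_S tame_divide_S_power

lemma tame_measurable: "tame F \<Longrightarrow> F \<in> borel_measurable (Leb n)"
  by (simp add: tame_def)

definition box :: "(nat \<Rightarrow> real) set" where
  "box = Pi\<^sub>E {..<n} (\<lambda>i. {a i - 3 * r..a i + 3 * r})"

lemma box_sets: "box \<in> sets (Leb n)" "emeasure (Leb n) box < \<infinity>"
proof -
  show "box \<in> sets (Leb n)" unfolding box_def by (intro sets_PiM_I_finite) auto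
  show "emeasure (Leb n) box < \<infinity>"
    unfolding box_def using r_pos
    by (subst lborel_product.emeasure_PiM) (auto simp: power_less_top_ennreal)
qed

lemma S_le_9_box: "S x \<le> 9 \<Longrightarrow> x \<in> space (Leb n) \<Longrightarrow> x \<in> box"
proof -
  assume *: "S x \<le> 9" "x \<in> space (Leb n)"
  have "a i - 3 * r \<le> x i \<and> x i \<le> a i + 3 * r" if "i < n" for i
  proof -
    have "\<bar>X i x\<bar> \<le> sqrt 9" using X_bound[OF that, of x] real_sqrt_le_mono[OF *(1)] by linarith
    then have "\<bar>x i - a i\<bar> \<le> 3 * r" using r_pos by (simp add: X_def field_simps)
    then show ?thesis by linarith
  qed
  with *(2) show ?thesis by (auto simp: box_def space_PiM PiE_iff)
qed

text \<open>Inside the carrier the annulus lies in \<open>box\<close>, which has finite measure, and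
  there the function is bounded.\<close>

lemma tame_integrable:
  assumes "tame F" "\<And>x. x \<notin> annulus \<Longrightarrow> F x = 0"
  shows "integrable (Leb n) F"
proof -
  from assms(1) obtain C where C: "\<forall>x\<in>annulus. \<bar>F x\<bar> \<le> C" by (auto simp: tame_def)
  have "\<bar>F x\<bar> \<le> max C 0" for x using C assms(2)[of x] by (cases "x \<in> annulus") auto
  moreover have "F x = 0" if "x \<notin> box" "x \<in> space (Leb n)" for x
    using that assms(2)[of x] S_le_9_box[of x] by (auto simp: annulus_def)
  ultimately show ?thesis
    using box_sets tame_measurable[OF assms(1)]
    by (intro integrableI_bounded_set[of box _ _ "max C 0"]) auto
qed

text \<open>Divergence theorem without boundary term. In direction \<open>i\<close> the field
  vanishes for |x_i| \<ge> |a_i| + 4r, so each partial derivative integrates to 0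
  separately.\<close>

lemma integral_divergence_eq_0:
  assumes pd: "\<And>i x. i < n \<Longrightarrow> pd i (Y i) x (G i x)"
    and tame: "\<And>i. i < n \<Longrightarrow> tame (G i)"
    and Y: "\<And>i x. i < n \<Longrightarrow> x \<notin> annulus \<Longrightarrow> Y i x = 0"
    and G: "\<And>i x. i < n \<Longrightarrow> x \<notin> annulus \<Longrightarrow> G i x = 0"
  shows "integrable (Leb n) (\<lambda>x. \<Sum>i<n. G i x)" "(\<integral>x. (\<Sum>i<n. G i x) \<partial>Leb n) = 0"
proof -
  have int: "integrable (Leb n) (G i)" if "i < n" for i
    using that tame G by (intro tame_integrable) auto
  then show "integrable (Leb n) (\<lambda>x. \<Sum>i<n. G i x)" by auto
  have "(\<integral>x. G i x \<partial>Leb n) = 0" if i: "i < n" for i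
  proof -
    have far: "x \<notin> annulus" if "\<bar>x i\<bar> \<ge> \<bar>a i\<bar> + 4 * r" for x
    proof
      assume "x \<in> annulus"
      then have "\<bar>X i x\<bar> \<le> sqrt 9" using X_bound[OF i, of x] real_sqrt_le_mono[of "S x" 9] by (auto simp: annulus_def simp del: real_sqrt_le_iff)
      then have "\<bar>x i - a i\<bar> \<le> 3 * r" using r_pos by (simp add: X_def field_simps)
      with that r_pos show False by linarith
    qed
    have "(\<integral>x. G i x / r \<partial>Leb n) = 0"
      using int[OF i] pd[OF i] far Y[OF i] G[OF i]
      by (intro integral_partial_derivative_eq_0[of i n _ "Y i" "\<bar>a i\<bar> + 4 * r"] i) (auto simp: pd_def)
    then show ?thesis using r_pos by simp
  qed
  then show "(\<integral>x. (\<Sum>i<n. G i x) \<partial>Leb n) = 0"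
    using int by (subst Bochner_Integration.integral_sum) auto
qed

text \<open>Derivatives are carried as explicit data, in units of X, so that products can be
  differentiated by rules and their Laplacians computed by rewriting. Symmetry of the Hessian
  belongs to the data; mollified functions provide it directly.\<close>

definition C2 :: "((nat \<Rightarrow> real) \<Rightarrow> real) \<Rightarrow> (nat \<Rightarrow> (nat \<Rightarrow> real) \<Rightarrow> real) \<Rightarrow> (nat \<Rightarrow> nat \<Rightarrow> (nat \<Rightarrow> real) \<Rightarrow> real) \<Rightarrow> bool" where
  "C2 u u1 u2 \<longleftrightarrow>
     (\<forall>i<n. \<forall>x. pd i u x (u1 i x)) \<and> (\<forall>i<n. \<forall>j<n. \<forall>x. pd j (u1 i) x (u2 i j x)) \<and>
     (\<forall>i<n. \<forall>j<n. u2 i j = u2 j i) \<and>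
     tame u \<and> (\<forall>i<n. tame (u1 i)) \<and> (\<forall>i<n. \<forall>j<n. tame (u2 i j))"

definition euler :: "(nat \<Rightarrow> (nat \<Rightarrow> real) \<Rightarrow> real) \<Rightarrow> (nat \<Rightarrow> real) \<Rightarrow> real" where
  "euler u1 x = (\<Sum>j<n. X j x * u1 j x)"

definition lap :: "(nat \<Rightarrow> nat \<Rightarrow> (nat \<Rightarrow> real) \<Rightarrow> real) \<Rightarrow> (nat \<Rightarrow> real) \<Rightarrow> real" where
  "lap u2 x = (\<Sum>j<n. u2 j j x)"

definition grad2 :: "(nat \<Rightarrow> (nat \<Rightarrow> real) \<Rightarrow> real) \<Rightarrow> (nat \<Rightarrow> real) \<Rightarrow> real" where
  "grad2 u1 x = (\<Sum>j<n. (u1 j x)\<^sup>2)"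

text \<open>Derivative of t^2/2 - 5t with respect to t = ln(S)/2; its own derivative in t is
  1.\<close>

definition phi' :: "(nat \<Rightarrow> real) \<Rightarrow> real" where
  "phi' x = ln (S x) / 2 - 5"

lemma pd_phi': "i < n \<Longrightarrow> S x > 0 \<Longrightarrow> pd i phi' x (X i x / S x)"
  unfolding phi'_def
  by (rule pd_cong[OF pd_chain[OF _ pd_S, where m = "\<lambda>s. ln s / 2 - 5"]])
     (auto intro!: derivative_eq_intros)

lemma tame_phi': "tame phi'"
  unfolding phi'_def by (rule tame_radial) (auto intro!: continuous_intros)

end

section \<open>The Carleman inequality\<close>

context scaled_coordinates
begin

text \<open>Both sides pair the Hessian of z with X and grad z, in either order. This makes the two
  Hessian terms in the divergence of the Carleman field cancel.\<close>

lemma double_sum_swap: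
  assumes "\<And>i j. i < n \<Longrightarrow> j < n \<Longrightarrow> z2 i j = z2 j i"
  shows "(\<Sum>i<n. X i x * (\<Sum>j<n. z1 j x * z2 j i x)) = (\<Sum>i<n. z1 i x * (\<Sum>j<n. X j x * z2 j i x))"
proof -
  have "(\<Sum>i<n. X i x * (\<Sum>j<n. z1 j x * z2 j i x)) = (\<Sum>i<n. \<Sum>j<n. X i x * z1 j x * z2 j i x)"
    by (simp add: sum_distrib_left mult.assoc)
  also have "\<dots> = (\<Sum>j<n. \<Sum>i<n. X i x * z1 j x * z2 j i x)" by (rule sum.swap)
  also have "\<dots> = (\<Sum>j<n. \<Sum>i<n. X i x * z1 j x * z2 i j x)"
    by (intro sum.cong refl) (simp add: assms)
  also have "\<dots> = (\<Sum>i<n. z1 i x * (\<Sum>j<n. X j x * z2 j i x))"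
    by (simp add: sum_distrib_left mult_ac)
  finally show ?thesis .
qed

text \<open>
  Here \<open>e\<close>, \<open>g\<close>, \<open>q\<close>, \<open>l\<close> stand for \<open>X \<bullet> \<nabla>z\<close>, \<open>|\<nabla>z|\<^sup>2\<close>, \<open>\<Sum> X\<^sub>i z\<^sub>j z\<^sub>i\<^sub>j\<close> and \<open>\<Delta>z\<close>. The long expression is the divergence of the vector
  field \<open>Y\<close> in the proof of \<open>carleman_conjugated\<close>; \<open>A\<close> and \<open>B\<close> are the symmetric and antisymmetric parts.
\<close>

lemma carleman_algebra:
  fixes s :: real
  assumes s: "s > 0" and tau: "\<tau> \<ge> 0" and c: "N = 2 * c + 2"
    and y: "y = 2 * p * e + (2 * c * p + 1) * z"
  shows "s * (l - 2 * \<tau> * p * e / s + (\<tau>\<^sup>2 * p\<^sup>2 - \<tau> * (2 * c * p + 1)) * z / s)\<^sup>2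
    \<ge> 4 * \<tau>^3 * p\<^sup>2 * z\<^sup>2 / s
     + (- 2 * \<tau> * ((2 * e / s + 2 * c * z / s) * e + (2 * p + 2 * c * p + 1) * g + 2 * p * q + y * l
          - N * p * g - g / s * s - 2 * p * q)
        - 2 * \<tau> * c * (N * z\<^sup>2 / s + 2 * z / s * e - 2 * z\<^sup>2 / s\<^sup>2 * s)
        - 2 * \<tau>^3 * (N * p^3 * z\<^sup>2 / s + (3 * p\<^sup>2 * z\<^sup>2 / s\<^sup>2 - 2 * p^3 * z\<^sup>2 / s\<^sup>2) * s + 2 * p^3 * z / s * e))"
    (is "?L \<ge> ?R")
proof -
  define A where "A = s * l + \<tau>\<^sup>2 * p\<^sup>2 * z"
  define B where "B = - \<tau> * y"
  have L: "?L = (A + B)\<^sup>2 / s"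
    using s by (simp add: A_def B_def y field_simps power2_eq_square)
  \<comment> \<open>The terms in \<open>g\<close> cancel because \<open>N = 2 * c + 2\<close>. What
    is left over is a perfect square, since \<open>e + c * z\<close> is exp(-c t) times the
    t-derivative of exp(c t) z.\<close>
  have "?R = 2 * A * B / s - 4 * \<tau> * (e + c * z)\<^sup>2 / s"
    using s by (simp add: A_def B_def y c field_simps power2_eq_square power3_eq_cube)
  also have "\<dots> \<le> 2 * A * B / s" using s tau by simp
  also have "\<dots> \<le> (A + B)\<^sup>2 / s"
    using s by (intro divide_right_mono) (auto simp: power2_sum)
  finally show ?thesis by (simp only: L)
qed

text \<open>The squared bracket is the conjugated operator divided by S. The pointwise inequality
  \<open>carleman_algebra\<close> is integrated, which removes the divergence.\<close>

theorem carleman_conjugated: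
  assumes C2: "C2 z z1 z2" and tau: "\<tau> \<ge> 0"
    and z: "\<And>x. x \<notin> annulus \<Longrightarrow> z x = 0"
    and z1: "\<And>i x. i < n \<Longrightarrow> x \<notin> annulus \<Longrightarrow> z1 i x = 0"
    and z2: "\<And>i j x. i < n \<Longrightarrow> j < n \<Longrightarrow> x \<notin> annulus \<Longrightarrow> z2 i j x = 0"
  shows "(\<integral>x. 4 * \<tau>^3 * (phi' x)\<^sup>2 * (z x)\<^sup>2 / S x \<partial>Leb n)
    \<le> (\<integral>x. S x * (lap z2 x - 2 * \<tau> * phi' x * euler z1 x / S x
          + (\<tau>\<^sup>2 * (phi' x)\<^sup>2 - \<tau> * ((real n - 2) * phi' x + 1)) * z x / S x)\<^sup>2 \<partial>Leb n)"
    (is "(\<integral>x. ?l x \<partial>_) \<le> (\<integral>x. ?r x \<partial>_)")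
proof -
  \<comment> \<open>In polar coordinates |X|^-2 dx is exp(2 c t) dt times the sphere measure, so the
    adjoint of the t-derivative is its negative minus 2c.\<close>
  define c where "c = (real n - 2) / 2"
  define y where "y x = 2 * phi' x * euler z1 x + (2 * c * phi' x + 1) * z x" for x
  define t where "t i x = (\<Sum>j<n. X j x * z2 j i x)" for i x
  define q where "q i x = (\<Sum>j<n. z1 j x * z2 j i x)" for i x
  define Q where "Q x = (\<Sum>i<n. z1 i x * t i x)" for x
  \<comment> \<open>The first line is a Rellich field, turning \<open>y\<close> times the Laplacian
    into a divergence up to lower order; the second completes the square of e + c z; the third
    absorbs the mixed term in phi'^3 z e of order \<tau>^3 and leaves the positive term 4 \<tau>^3
    phi'^2 z^2 / S.\<close>
  define Y where "Y i x = - 2 * \<tau> * (y x * z1 i x - X i x * (phi' x * grad2 z1 x))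
      - 2 * \<tau> * c * (X i x * ((z x)\<^sup>2 * inverse (S x)))
      - 2 * \<tau>^3 * (X i x * ((phi' x)^3 * ((z x)\<^sup>2 * inverse (S x))))" for i x
  define G where "G i x =
     - 2 * \<tau> * ((2 * euler z1 x / S x + 2 * c * z x / S x) * (X i x * z1 i x)
        + (2 * phi' x + 2 * c * phi' x + 1) * (z1 i x)\<^sup>2 + 2 * phi' x * (z1 i x * t i x) + y x * z2 i i x
        - phi' x * grad2 z1 x - grad2 z1 x / S x * (X i x)\<^sup>2 - 2 * phi' x * (X i x * q i x))
     - 2 * \<tau> * c * ((z x)\<^sup>2 / S x + 2 * z x / S x * (X i x * z1 i x) - 2 * (z x)\<^sup>2 / (S x)\<^sup>2 * (X i x)\<^sup>2)
     - 2 * \<tau>^3 * ((phi' x)^3 * (z x)\<^sup>2 / S x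
         + (3 * (phi' x)\<^sup>2 * (z x)\<^sup>2 / (S x)\<^sup>2 - 2 * (phi' x)^3 * (z x)\<^sup>2 / (S x)\<^sup>2) * (X i x)\<^sup>2
         + 2 * (phi' x)^3 * z x / S x * (X i x * z1 i x))" for i x
  note d = C2[unfolded C2_def]
  have bmz: "tame z" "\<And>i. i < n \<Longrightarrow> tame (z1 i)" "\<And>i j. i < n \<Longrightarrow> j < n \<Longrightarrow> tame (z2 i j)"
    using d by auto
  have eul0: "euler z1 x = 0" "grad2 z1 x = 0" "lap z2 x = 0" if "x \<notin> annulus" for x
    using z1 z2 that by (auto simp: euler_def grad2_def lap_def)
  have Y0: "Y i x = 0" if "i < n" "x \<notin> annulus" for i x
    using that z z1 eul0 by (simp add: Y_def y_def)
  have G0: "G i x = 0" if "i < n" "x \<notin> annulus" for i x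
    using that z z1 z2 eul0 by (simp add: G_def y_def q_def)
  have G_tame: "tame (G i)" if "i < n" for i
    unfolding G_def y_def euler_def grad2_def q_def t_def power_divide[symmetric]
    using that by (intro tame_intros tame_phi' bmz) auto
  have Y_pd: "pd i (Y i) x (G i x)" if i: "i < n" for i x
  proof (cases "S x < 1/4")
    case True
    then have "x \<notin> annulus" by (simp add: annulus_def)
    moreover have "pd i (Y i) x 0"
      using True i Y0 by (intro pd_zero_near[of _ _ "1/4"]) (auto simp: annulus_def)
    ultimately show ?thesis using G0[OF i] by simp
  next
    case False
    then have s: "S x > 0" by simp
    have dz: "pd i z x (z1 i x)" "\<And>j. j < n \<Longrightarrow> pd i (z1 j) x (z2 j i x)"
      using d i by auto
    have dS: "pd i (\<lambda>x. inverse (S x)) x (- (2 * X i x / (S x)\<^sup>2))"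
      using s i by (intro pd_cong[OF pd_chain[OF DERIV_inverse pd_S]]) (auto simp: power2_eq_square field_simps)
    have dE: "pd i (euler z1) x (z1 i x + t i x)"
    proof (rule pd_cong)
      show "pd i (euler z1) x (\<Sum>j<n. (if i = j then 1 else 0) * z1 j x + z2 j i x * X j x)"
        unfolding euler_def by (intro pd_sum pd_mult pd_X dz) auto
      show "(\<Sum>j<n. (if i = j then 1 else 0) * z1 j x + z2 j i x * X j x) = z1 i x + t i x"
      proof -
        have "(\<Sum>j<n. (if i = j then 1 else 0) * z1 j x) = z1 i x"
          using i by (simp add: if_distrib[of "\<lambda>c. c * _"] cong: if_cong)
        then show ?thesis by (simp only: sum.distrib t_def mult.commute[of "z2 _ _ _"])
      qed
    qed
    have dg: "pd i (grad2 z1) x (2 * q i x)"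
    proof (rule pd_cong)
      show "pd i (grad2 z1) x (\<Sum>j<n. z2 j i x * z1 j x + z2 j i x * z1 j x)"
        unfolding grad2_def power2_eq_square by (intro pd_sum pd_mult dz) auto
    qed (simp add: q_def sum.distrib sum_distrib_left[symmetric] mult.commute)
    have dp: "pd i phi' x (X i x / S x)" using pd_phi'[OF i s] .
    show ?thesis
      unfolding Y_def y_def power2_eq_square power3_eq_cube
      by (rule pd_cong, (rule dz dS dE dg dp pd_diff pd_mult pd_add pd_X pd_const i)+)
         (use s in \<open>simp add: G_def y_def field_simps power2_eq_square power3_eq_cube\<close>)
  qed
  note div = integral_divergence_eq_0[OF Y_pd G_tame Y0 G0]
  have sumG: "(\<Sum>i<n. G i x) =
      - 2 * \<tau> * ((2 * euler z1 x / S x + 2 * c * z x / S x) * euler z1 x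
        + (2 * phi' x + 2 * c * phi' x + 1) * grad2 z1 x + 2 * phi' x * Q x + y x * lap z2 x
        - real n * phi' x * grad2 z1 x - grad2 z1 x / S x * S x - 2 * phi' x * Q x)
     - 2 * \<tau> * c * (real n * (z x)\<^sup>2 / S x + 2 * z x / S x * euler z1 x - 2 * (z x)\<^sup>2 / (S x)\<^sup>2 * S x)
     - 2 * \<tau>^3 * (real n * (phi' x)^3 * (z x)\<^sup>2 / S x
         + (3 * (phi' x)\<^sup>2 * (z x)\<^sup>2 / (S x)\<^sup>2 - 2 * (phi' x)^3 * (z x)\<^sup>2 / (S x)\<^sup>2) * S x
         + 2 * (phi' x)^3 * z x / S x * euler z1 x)" for x
  proof -
    have e: "(\<Sum>i<n. X i x * z1 i x) = euler z1 x" "(\<Sum>i<n. (z1 i x)\<^sup>2) = grad2 z1 x"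
      "(\<Sum>i<n. z1 i x * t i x) = Q x" "(\<Sum>i<n. z2 i i x) = lap z2 x" "(\<Sum>i<n. (X i x)\<^sup>2) = S x"
      by (simp_all add: euler_def grad2_def Q_def lap_def S_def)
    have e2: "(\<Sum>i<n. X i x * q i x) = Q x"
      unfolding Q_def q_def t_def using d by (intro double_sum_swap) auto
    have e3: "(\<Sum>i<n. k) = real n * k" for k :: real by simp
    show ?thesis
      unfolding G_def sum_subtractf sum.distrib sum_distrib_left[symmetric] e e2 e3
      by (simp only: mult_ac times_divide_eq_right)
  qed
  have le: "?l x + (\<Sum>i<n. G i x) \<le> ?r x" for x
  proof (cases "x \<in> annulus")
    case True
    then have s: "S x > 0" by (simp add: annulus_def)
    have n: "real n = 2 * c + 2" by (simp add: c_def field_simps)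
    have n2: "real n - 2 = 2 * c" by (simp add: c_def field_simps)
    show ?thesis
      unfolding sumG n2 by (rule carleman_algebra[OF s tau n y_def])
  next
    case False
    then show ?thesis using G0[OF _ False] by (simp add: z eul0)
  qed
  have int: "integrable (Leb n) ?l" "integrable (Leb n) ?r"
    unfolding lap_def euler_def
    by (rule tame_integrable; use z eul0 in \<open>(intro tame_intros tame_phi' bmz; simp add: lap_def euler_def) | (simp add: lap_def euler_def)\<close>)+
  have "(\<integral>x. ?l x \<partial>Leb n) = (\<integral>x. ?l x + (\<Sum>i<n. G i x) \<partial>Leb n)"
    using int div by (subst Bochner_Integration.integral_add) auto
  also have "\<dots> \<le> (\<integral>x. ?r x \<partial>Leb n)"
    using int div le by (intro integral_mono) auto
  finally show ?thesis .
qed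

end

section \<open>Radial cutoffs and weights\<close>

context scaled_coordinates
begin

lemma pd_radial:
  assumes i: "i < n" and m: "\<And>s. s > 0 \<Longrightarrow> (m has_real_derivative m' s) (at s)"
    and zero: "\<And>s. s < 1/4 \<Longrightarrow> m s = 0" "\<And>s. s < 1/4 \<Longrightarrow> m' s = 0"
  shows "pd i (\<lambda>x. m (S x)) x (m' (S x) * (2 * X i x))"
proof (cases "S x < 1/4")
  case True
  then have "pd i (\<lambda>x. m (S x)) x 0"
    using i zero by (intro pd_zero_near[of _ _ "1/4"]) auto
  then show ?thesis using True by (simp add: zero)
next
  case False
  then have "S x > 0" by simp
  from pd_chain[OF m[OF this] pd_S[OF i]] show ?thesis .
qed

section \<open>Products with radial factors and a Green identity\<close>

definition mult_grad ::
  "(real \<Rightarrow> real) \<Rightarrow> (real \<Rightarrow> real) \<Rightarrow> ((nat \<Rightarrow> real) \<Rightarrow> real) \<Rightarrow> (nat \<Rightarrow> (nat \<Rightarrow> real) \<Rightarrow> real) \<Rightarrow> nat \<Rightarrow> (nat \<Rightarrow> real) \<Rightarrow> real" where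
  "mult_grad m0 m1 u u1 = (\<lambda>(i::nat) x. m0 (S x) * u1 i x + 2 * X i x * m1 (S x) * (u x :: real))"

definition mult_hess ::
  "(real \<Rightarrow> real) \<Rightarrow> (real \<Rightarrow> real) \<Rightarrow> (real \<Rightarrow> real) \<Rightarrow> ((nat \<Rightarrow> real) \<Rightarrow> real) \<Rightarrow> (nat \<Rightarrow> (nat \<Rightarrow> real) \<Rightarrow> real)
    \<Rightarrow> (nat \<Rightarrow> nat \<Rightarrow> (nat \<Rightarrow> real) \<Rightarrow> real) \<Rightarrow> nat \<Rightarrow> nat \<Rightarrow> (nat \<Rightarrow> real) \<Rightarrow> real" where
  "mult_hess m0 m1 m2 u u1 u2 = (\<lambda>(i::nat) (j::nat) x.
     m0 (S x) * u2 i j x + 2 * X j x * m1 (S x) * u1 i x + 2 * X i x * m1 (S x) * u1 j x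
     + (4 * X i x * X j x * m2 (S x) + (if i = j then 2 else 0) * m1 (S x)) * (u x :: real))"

lemma C2_mult_radial:
  fixes m0 m1 m2 :: "real \<Rightarrow> real"
  assumes u: "C2 u u1 u2"
    and m: "\<And>s. s > 0 \<Longrightarrow> (m0 has_real_derivative m1 s) (at s)"
      "\<And>s. s > 0 \<Longrightarrow> (m1 has_real_derivative m2 s) (at s)"
    and m_zero: "\<And>s. s < 1/4 \<Longrightarrow> m0 s = 0" "\<And>s. s < 1/4 \<Longrightarrow> m1 s = 0" "\<And>s. s < 1/4 \<Longrightarrow> m2 s = 0"
    and m_meas: "m0 \<in> borel_measurable borel" "m1 \<in> borel_measurable borel" "m2 \<in> borel_measurable borel"
    and m_cont: "continuous_on {1/4..9} m2"
  shows "C2 (\<lambda>x. m0 (S x) * u x) (mult_grad m0 m1 u u1) (mult_hess m0 m1 m2 u u1 u2)"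
proof -
  note d = u[unfolded C2_def]
  have cont: "continuous_on {1/4..9} m0" "continuous_on {1/4..9} m1"
    by (rule continuous_at_imp_continuous_on, rule ballI, rule DERIV_isCont, rule m, simp)+
  have tame: "tame (\<lambda>x. m0 (S x))" "tame (\<lambda>x. m1 (S x))" "tame (\<lambda>x. m2 (S x))"
    using m_meas cont m_cont by (auto intro: tame_radial)
  have pd1: "pd i (\<lambda>x. m0 (S x)) x (m1 (S x) * (2 * X i x))" "pd i (\<lambda>x. m1 (S x)) x (m2 (S x) * (2 * X i x))"
    if "i < n" for i x
    using that by (auto intro!: pd_radial m simp: m_zero)
  show ?thesis
    unfolding C2_def mult_grad_def mult_hess_def
  proof (intro conjI allI impI)
    fix i x assume i: "i < n"
    show "pd i (\<lambda>x. m0 (S x) * u x) x (m0 (S x) * u1 i x + 2 * X i x * m1 (S x) * u x)"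
      using d i by (intro pd_cong[OF pd_mult[OF pd1(1)]]) (auto simp: algebra_simps)
  next
    fix i j x assume i: "i < n" and j: "j < n"
    have u: "pd j u x (u1 j x)" "pd j (u1 i) x (u2 i j x)" using d i j by auto
    show "pd j (\<lambda>x. m0 (S x) * u1 i x + 2 * X i x * m1 (S x) * u x) x
         (m0 (S x) * u2 i j x + 2 * X j x * m1 (S x) * u1 i x + 2 * X i x * m1 (S x) * u1 j x +
          (4 * X i x * X j x * m2 (S x) + (if i = j then 2 else 0) * m1 (S x)) * u x)"
      by (rule pd_cong, (rule u pd1 pd_X pd_const pd_add pd_mult j)+) (auto simp: algebra_simps)
  next
    fix i j assume "i < n" "j < n"
    moreover then have "u2 i j = u2 j i" using d by auto
    ultimately show "(\<lambda>x. m0 (S x) * u2 i j x + 2 * X j x * m1 (S x) * u1 i x + 2 * X i x * m1 (S x) * u1 j x +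
              (4 * X i x * X j x * m2 (S x) + (if i = j then 2 else 0) * m1 (S x)) * u x) =
       (\<lambda>x. m0 (S x) * u2 j i x + 2 * X i x * m1 (S x) * u1 j x + 2 * X j x * m1 (S x) * u1 i x +
              (4 * X j x * X i x * m2 (S x) + (if j = i then 2 else 0) * m1 (S x)) * u x)"
      by (auto simp: algebra_simps fun_eq_iff)
  qed (use d tame in \<open>auto intro!: tame_intros\<close>)
qed

lemma euler_mult_radial:
  fixes m0 m1 :: "real \<Rightarrow> real"
  shows
  "euler (mult_grad m0 m1 u u1) x = m0 (S x) * euler u1 x + 2 * S x * m1 (S x) * u x"
proof -
  have "euler (mult_grad m0 m1 u u1) x
      = (\<Sum>i<n. m0 (S x) * (X i x * u1 i x) + (2 * m1 (S x) * u x) * (X i x)\<^sup>2)"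
    unfolding euler_def mult_grad_def by (intro sum.cong) (auto simp: algebra_simps power2_eq_square)
  also have "\<dots> = m0 (S x) * euler u1 x + (2 * m1 (S x) * u x) * S x"
    by (simp add: sum.distrib sum_distrib_left euler_def S_def)
  finally show ?thesis by simp
qed

lemma lap_mult_radial:
  fixes m0 m1 m2 :: "real \<Rightarrow> real"
  shows
  "lap (mult_hess m0 m1 m2 u u1 u2) x
    = m0 (S x) * lap u2 x + 4 * m1 (S x) * euler u1 x + (4 * S x * m2 (S x) + 2 * real n * m1 (S x)) * u x"
proof -
  have "lap (mult_hess m0 m1 m2 u u1 u2) x
      = (\<Sum>i<n. m0 (S x) * u2 i i x + (4 * m1 (S x)) * (X i x * u1 i x) + (4 * m2 (S x) * u x) * (X i x)\<^sup>2 + 2 * m1 (S x) * u x)"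
    unfolding lap_def mult_hess_def by (intro sum.cong) (auto simp: algebra_simps power2_eq_square)
  also have "\<dots> = m0 (S x) * lap u2 x + (4 * m1 (S x)) * euler u1 x + (4 * m2 (S x) * u x) * S x + real n * (2 * m1 (S x) * u x)"
    by (simp add: sum.distrib sum_distrib_left[symmetric] euler_def S_def lap_def)
  finally show ?thesis by (simp add: algebra_simps)
qed

text \<open>The integral of \<open>m \<Delta>(u\<^sup>2) = 2 m (|\<nabla>u|\<^sup>2 + u \<Delta>u)\<close>, with \<open>\<Delta>\<close> moved to the radial factor \<open>m\<close>.\<close>

lemma caccioppoli:
  fixes m0 m1 m2 :: "real \<Rightarrow> real"
  assumes u: "C2 u u1 u2"
    and m: "\<And>s. s > 0 \<Longrightarrow> (m0 has_real_derivative m1 s) (at s)"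
      "\<And>s. s > 0 \<Longrightarrow> (m1 has_real_derivative m2 s) (at s)"
    and m_zero: "\<And>s. s \<notin> {1/4..9} \<Longrightarrow> m0 s = 0 \<and> m1 s = 0 \<and> m2 s = 0"
    and m_meas: "m0 \<in> borel_measurable borel" "m1 \<in> borel_measurable borel" "m2 \<in> borel_measurable borel"
    and m_cont: "continuous_on {1/4..9} m2"
  shows "2 * (\<integral>x. m0 (S x) * grad2 u1 x \<partial>Leb n)
     = (\<integral>x. (u x)\<^sup>2 * (4 * S x * m2 (S x) + 2 * real n * m1 (S x)) - 2 * m0 (S x) * u x * lap u2 x \<partial>Leb n)"
proof -
  note d = u[unfolded C2_def]
  have cont: "continuous_on {1/4..9} m0" "continuous_on {1/4..9} m1"
    by (rule continuous_at_imp_continuous_on, rule ballI, rule DERIV_isCont, rule m, simp)+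
  have tame: "tame (\<lambda>x. m0 (S x))" "tame (\<lambda>x. m1 (S x))" "tame (\<lambda>x. m2 (S x))"
    using m_meas cont m_cont by (auto intro: tame_radial)
  have z: "m0 (S x) = 0 \<and> m1 (S x) = 0 \<and> m2 (S x) = 0" if "x \<notin> annulus" for x
    using m_zero[of "S x"] that by (auto simp: annulus_def)
  have pd1: "pd i (\<lambda>x. m0 (S x)) x (m1 (S x) * (2 * X i x))" "pd i (\<lambda>x. m1 (S x)) x (m2 (S x) * (2 * X i x))"
    if "i < n" for i x
    using that by (auto intro!: pd_radial m simp: m_zero)
  \<comment> \<open>The field of Green's second identity: m grad(u^2) - u^2 grad m.\<close>
  define Y where "Y i x = 2 * m0 (S x) * u x * u1 i x - (u x * u x) * (2 * X i x * m1 (S x))" for i x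
  define G where "G i x = 2 * m0 (S x) * (u1 i x)\<^sup>2 + 2 * m0 (S x) * u x * u2 i i x
      - (u x)\<^sup>2 * (2 * m1 (S x)) - (u x)\<^sup>2 * (4 * m2 (S x)) * (X i x)\<^sup>2" for i x
  have Y_pd: "pd i (Y i) x (G i x)" if i: "i < n" for i x
  proof -
    have u: "pd i u x (u1 i x)" "pd i (u1 i) x (u2 i i x)" using d i by auto
    note p = pd1[OF i, of x]
    show ?thesis unfolding Y_def G_def
      by (rule pd_cong, (rule u p pd_X pd_const pd_diff pd_mult)+) (auto simp: algebra_simps power2_eq_square)
  qed
  have G_tame: "tame (G i)" if "i < n" for i
    unfolding G_def using that d tame by (intro tame_intros) auto
  have Y0: "Y i x = 0" "G i x = 0" if "x \<notin> annulus" for i x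
    using z[OF that] by (auto simp: Y_def G_def)
  have div: "(\<integral>x. (\<Sum>i<n. G i x) \<partial>Leb n) = 0"
    using Y_pd G_tame Y0 by (rule integral_divergence_eq_0)
  have sumG: "(\<Sum>i<n. G i x) = 2 * (m0 (S x) * grad2 u1 x)
     - ((u x)\<^sup>2 * (4 * S x * m2 (S x) + 2 * real n * m1 (S x)) - 2 * m0 (S x) * u x * lap u2 x)" for x
    unfolding G_def sum_subtractf sum.distrib sum_distrib_left[symmetric]
    by (simp add: grad2_def lap_def S_def[symmetric] algebra_simps)
  have int: "integrable (Leb n) (\<lambda>x. 2 * (m0 (S x) * grad2 u1 x))"
     "integrable (Leb n) (\<lambda>x. (u x)\<^sup>2 * (4 * S x * m2 (S x) + 2 * real n * m1 (S x)) - 2 * m0 (S x) * u x * lap u2 x)"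
    unfolding grad2_def lap_def using d tame z
    by (auto intro!: tame_integrable tame_intros)
  have "0 = (\<integral>x. 2 * (m0 (S x) * grad2 u1 x) \<partial>Leb n)
     - (\<integral>x. (u x)\<^sup>2 * (4 * S x * m2 (S x) + 2 * real n * m1 (S x)) - 2 * m0 (S x) * u x * lap u2 x \<partial>Leb n)"
    using div unfolding sumG by (simp only: Bochner_Integration.integral_diff[OF int])
  then show ?thesis by simp
qed

end

text \<open>Cutoffs in the squared radius, with \<open>k\<close> the order of the derivative.
  \<open>zin\<close> rises on [1/4, 3/4], inside the small ball; \<open>zout\<close> rises on
  [6, 8], between the radii 2 and 3. Their difference \<open>zeta\<close> is 1 in between.\<close>

definition zin :: "nat \<Rightarrow> real \<Rightarrow> real" where "zin k s = 2 ^ k * smooth_step k (2 * s - 1 / 2)"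
definition zout :: "nat \<Rightarrow> real \<Rightarrow> real" where "zout k s = (1 / 2) ^ k * smooth_step k ((s - 6) / 2)"
definition zeta :: "nat \<Rightarrow> real \<Rightarrow> real" where "zeta k s = zin k s - zout k s"

lemma zin_deriv: "(zin k has_real_derivative zin (Suc k) s) (at s)"
  unfolding zin_def by (auto intro!: derivative_eq_intros DERIV_chain2[OF smooth_step_deriv])

lemma zout_deriv: "(zout k has_real_derivative zout (Suc k) s) (at s)"
  unfolding zout_def by (auto intro!: derivative_eq_intros DERIV_chain2[OF smooth_step_deriv])

lemma zeta_deriv: "(zeta k has_real_derivative zeta (Suc k) s) (at s)"
  unfolding zeta_def by (auto intro!: derivative_eq_intros zin_deriv zout_deriv)

lemma zin_vals: "s \<le> 1/4 \<Longrightarrow> zin k s = 0" "s \<ge> 3/4 \<Longrightarrow> zin 0 s = 1" "s \<ge> 3/4 \<Longrightarrow> zin (Suc k) s = 0"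
  by (auto simp: zin_def smooth_step_le_0 smooth_step_ge_1 smooth_step_Suc_ge_1)

lemma zout_vals: "s \<le> 6 \<Longrightarrow> zout k s = 0" "s \<ge> 8 \<Longrightarrow> zout 0 s = 1" "s \<ge> 8 \<Longrightarrow> zout (Suc k) s = 0"
  by (auto simp: zout_def smooth_step_le_0 smooth_step_ge_1 smooth_step_Suc_ge_1)

lemma zeta_vals: "s \<le> 1/4 \<Longrightarrow> zeta k s = 0" "s \<ge> 8 \<Longrightarrow> zeta k s = 0" "3/4 \<le> s \<Longrightarrow> s \<le> 6 \<Longrightarrow> zeta 0 s = 1"
  by (auto simp: zeta_def zin_vals zout_vals) (cases k; simp add: zin_vals zout_vals)

lemma continuous_on_z: "continuous_on A (zin k)" "continuous_on A (zout k)" "continuous_on A (zeta k)"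
  using zin_deriv zout_deriv zeta_deriv by (meson DERIV_isCont continuous_at_imp_continuous_on)+

lemma z_measurable [measurable]: "zin k \<in> borel_measurable borel" "zout k \<in> borel_measurable borel"
  "zeta k \<in> borel_measurable borel"
  using continuous_on_z by (auto intro: borel_measurable_continuous_onI)

text \<open>Order 3 is reached because the Caccioppoli identity differentiates the square of a first
  derivative twice.\<close>

lemma exists_cutoff_bound: "\<exists>C\<ge>1. \<forall>k\<le>3. \<forall>s. \<bar>zin k s\<bar> \<le> C \<and> \<bar>zout k s\<bar> \<le> C"
proof -
  from smooth_step_bounded obtain C where C: "\<And>k x. \<bar>smooth_step k x\<bar> \<le> C k" by metis
  define D where "D = 1 + (\<Sum>k\<le>3. 2 ^ k * C k)"
  have C0: "C k \<ge> 0" for k using C[of k 0] by linarith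
  have "\<bar>zin k s\<bar> \<le> D \<and> \<bar>zout k s\<bar> \<le> D" if "k \<le> 3" for k s
  proof -
    have le: "2 ^ k * C k \<le> (\<Sum>k\<le>3. 2 ^ k * C k)"
      using that C0 by (intro member_le_sum) auto
    have "\<bar>zin k s\<bar> \<le> 2 ^ k * C k" using C by (simp add: zin_def abs_mult)
    moreover have "\<bar>zout k s\<bar> \<le> 2 ^ k * C k"
    proof -
      have "\<bar>zout k s\<bar> \<le> (1 / 2) ^ k * C k" using C by (simp add: zout_def abs_mult divide_right_mono power_divide)
      also have "\<dots> \<le> 2 ^ k * C k" using C0 by (intro mult_right_mono power_mono) auto
      finally show ?thesis .
    qed
    ultimately show ?thesis using le by (simp add: D_def)
  qed
  moreover have "D \<ge> 1" using C0 by (simp add: D_def sum_nonneg)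
  ultimately show ?thesis by blast
qed

definition cutoff_bound :: real where
  "cutoff_bound = (SOME C. C \<ge> 1 \<and> (\<forall>k\<le>3. \<forall>s. \<bar>zin k s\<bar> \<le> C \<and> \<bar>zout k s\<bar> \<le> C))"

lemma cutoff_bound: "cutoff_bound \<ge> 1" "k \<le> 3 \<Longrightarrow> \<bar>zin k s\<bar> \<le> cutoff_bound" "k \<le> 3 \<Longrightarrow> \<bar>zout k s\<bar> \<le> cutoff_bound"
  using someI_ex[OF exists_cutoff_bound] unfolding cutoff_bound_def by blast+

text \<open>
  \<open>Phi s = t\<^sup>2/2 - 5 t\<close> with \<open>t = ln s / 2\<close>; the 5 makes it strictly decreasing, with \<open>|phi'| \<ge> 1\<close>, where \<open>s \<le> 8\<close>.
\<close>

definition Phi :: "real \<Rightarrow> real" where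
  "Phi s = (ln s)\<^sup>2 / 8 - 5 / 2 * ln s"

lemma Phi_less: "0 < x \<Longrightarrow> x < y \<Longrightarrow> y \<le> 9 \<Longrightarrow> Phi y < Phi x"
proof -
  assume *: "0 < x" "x < y" "y \<le> 9"
  \<comment> \<open>Then ln x + ln y < 16, so the second factor below is less than 16/8 - 5/2 <
    0.\<close>
  have "ln y \<le> 8" "ln x < ln y" using * ln_le_minus_one[of y] by auto
  then have "(ln x - ln y) * ((ln x + ln y) / 8 - 5 / 2) > 0"
    by (intro mult_neg_neg) auto
  also have "(ln x - ln y) * ((ln x + ln y) / 8 - 5 / 2) = Phi x - Phi y"
    by (simp add: Phi_def field_simps power2_eq_square)
  finally show ?thesis by simp
qed

lemma Phi_antimono: "0 < x \<Longrightarrow> x \<le> y \<Longrightarrow> y \<le> 9 \<Longrightarrow> Phi y \<le> Phi x"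
  using Phi_less[of x y] by (cases "x = y") auto

definition W :: "real \<Rightarrow> real \<Rightarrow> real" where
  "W \<tau> s = exp (\<tau> * Phi s)"

lemma W_deriv: "s > 0 \<Longrightarrow> (W \<tau> has_real_derivative W \<tau> s * (\<tau> * ((ln s / 2 - 5) / (2 * s)))) (at s)"
  unfolding W_def Phi_def by (auto intro!: derivative_eq_intros simp: field_simps)

lemma W_measurable [measurable]: "W \<tau> \<in> borel_measurable borel"
  unfolding W_def Phi_def by measurable

lemma continuous_on_W: "continuous_on {1/4..9} (W \<tau>)"
  unfolding W_def Phi_def by (auto intro!: continuous_intros)

text \<open>For \<tau> > 0 the weight blows up at s = 0; the cutoff removes this. The global bound
  is what allows the weight to pass through L^2 limits.\<close>

lemma W_zeta_bounded: "\<exists>C. \<forall>s. \<bar>W \<tau> s * zeta 0 s\<bar> \<le> C"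
proof -
  have "bounded ((\<lambda>s. W \<tau> s * zeta 0 s) ` {1/4..9})"
    by (intro compact_imp_bounded compact_continuous_image continuous_intros continuous_on_W continuous_on_z) auto
  then obtain C where C: "\<forall>s\<in>{1/4..9}. \<bar>W \<tau> s * zeta 0 s\<bar> \<le> C" by (auto simp: bounded_iff)
  have "\<bar>W \<tau> s * zeta 0 s\<bar> \<le> max C 0" for s
    using C zeta_vals(1,2)[of s 0] by (cases "s \<in> {1/4..9}") (auto simp: le_max_iff_disj)
  then show ?thesis by blast
qed

section \<open>The localized estimate for smooth functions\<close>

context scaled_coordinates
begin

text \<open>\<open>caccioppoli\<close> with the square of \<open>zf 1\<close> as radial factor
  trades the gradient in a cutoff zone for u and its Laplacian. Vanishing is required of derivatives
  of the cutoff only, so \<open>zin\<close> and \<open>zout\<close> both qualify. From |m2| \<le> 4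
  M^2, |m1| \<le> 2 M^2 and s \<le> 9 come 144 + 4n; the remaining 1 is the price of the product of
  u and its Laplacian.\<close>

lemma grad2_cutoff_bound:
  fixes zf :: "nat \<Rightarrow> real \<Rightarrow> real" and M R :: real
  assumes u: "C2 u u1 u2"
    and deriv: "\<And>k s. (zf k has_real_derivative zf (Suc k) s) (at s)"
    and bound: "\<And>k s. k \<le> 3 \<Longrightarrow> \<bar>zf k s\<bar> \<le> M" and M: "M \<ge> 0"
    and zero: "\<And>k s. s \<notin> {1/4..<R} \<Longrightarrow> zf (Suc k) s = 0" and R: "R \<le> 9"
  shows "2 * (\<integral>x. (zf 1 (S x))\<^sup>2 * grad2 u1 x \<partial>Leb n)
     \<le> (145 + 4 * real n) * M\<^sup>2 * (\<integral>x. indicator {1/4..<R} (S x) * ((u x)\<^sup>2 + (lap u2 x)\<^sup>2) \<partial>Leb n)"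
proof -
  note d = u[unfolded C2_def]
  have cont: "continuous_on A (zf k)" for A k
    using deriv by (meson DERIV_isCont continuous_at_imp_continuous_on)
  have meas [measurable]: "zf k \<in> borel_measurable borel" for k
    using cont by (rule borel_measurable_continuous_onI)
  define m1 where "m1 s = 2 * zf 1 s * zf 2 s" for s
  define m2 where "m2 s = 2 * ((zf 2 s)\<^sup>2 + zf 1 s * zf 3 s)" for s
  have z: "zf 1 s = 0 \<and> zf 2 s = 0 \<and> zf 3 s = 0" if "s \<notin> {1/4..<R}" for s
    using zero[OF that, of 0] zero[OF that, of 1] zero[OF that, of 2] by (simp add: numeral_eq_Suc)
  have d1: "(zf 1 has_real_derivative zf 2 s) (at s)" "(zf 2 has_real_derivative zf 3 s) (at s)" for s
    using deriv[of 1 s] deriv[of 2 s] by (simp_all add: numeral_eq_Suc)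
  note d1 = d1 d1[unfolded One_nat_def]
  have "2 * (\<integral>x. (zf 1 (S x))\<^sup>2 * grad2 u1 x \<partial>Leb n)
     = (\<integral>x. (u x)\<^sup>2 * (4 * S x * m2 (S x) + 2 * real n * m1 (S x)) - 2 * (zf 1 (S x))\<^sup>2 * u x * lap u2 x \<partial>Leb n)"
  proof (rule caccioppoli[OF u])
    show "((\<lambda>s. (zf 1 s)\<^sup>2) has_real_derivative m1 s) (at s)" for s
      unfolding m1_def by (auto intro!: derivative_eq_intros d1)
    show "(m1 has_real_derivative m2 s) (at s)" for s
      unfolding m1_def m2_def by (auto intro!: derivative_eq_intros d1 simp: power2_eq_square)
    show "(zf 1 s)\<^sup>2 = 0 \<and> m1 s = 0 \<and> m2 s = 0" if "s \<notin> {1/4..9}" for s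
      using z[of s] that R by (auto simp: m1_def m2_def)
    show "continuous_on {1/4..9} m2" unfolding m2_def by (intro continuous_intros cont)
  qed (simp_all add: m1_def[abs_def] m2_def[abs_def])
  also have "\<dots> \<le> (\<integral>x. (145 + 4 * real n) * M\<^sup>2 * (indicator {1/4..<R} (S x) * ((u x)\<^sup>2 + (lap u2 x)\<^sup>2)) \<partial>Leb n)"
  proof (rule integral_mono)
    have bmz: "tame (\<lambda>x. zf 1 (S x))" "tame (\<lambda>x. m1 (S x))" "tame (\<lambda>x. m2 (S x))"
      unfolding m1_def m2_def by (intro tame_intros tame_radial meas cont)+
    have bml: "tame (lap u2)" unfolding lap_def using d by (intro tame_intros) auto
    have bmi: "tame (\<lambda>x. indicator {1/4..<R} (S x))"
      by (intro tame_radial_bounded[of _ 1]) (auto simp: indicator_def)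
    show "integrable (Leb n) (\<lambda>x. (u x)\<^sup>2 * (4 * S x * m2 (S x) + 2 * real n * m1 (S x)) - 2 * (zf 1 (S x))\<^sup>2 * u x * lap u2 x)"
      using d bmz bml z R
      by (intro tame_integrable tame_intros) (auto simp: annulus_def m1_def m2_def)
    show "integrable (Leb n) (\<lambda>x. (145 + 4 * real n) * M\<^sup>2 * (indicator {1/4..<R} (S x) * ((u x)\<^sup>2 + (lap u2 x)\<^sup>2)))"
      using d bmi bml R by (intro tame_integrable tame_intros) (auto simp: annulus_def indicator_def)
    fix x
    show "(u x)\<^sup>2 * (4 * S x * m2 (S x) + 2 * real n * m1 (S x)) - 2 * (zf 1 (S x))\<^sup>2 * u x * lap u2 x
       \<le> (145 + 4 * real n) * M\<^sup>2 * (indicator {1/4..<R} (S x) * ((u x)\<^sup>2 + (lap u2 x)\<^sup>2))"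
    proof (cases "S x \<in> {1/4..<R}")
      case False
      then show ?thesis using z[OF False] by (simp add: m1_def m2_def)
    next
      case True
      have S9: "S x \<le> 9" using True R by simp
      have b: "\<bar>zf 1 (S x)\<bar> \<le> M" "\<bar>zf 2 (S x)\<bar> \<le> M" "\<bar>zf 3 (S x)\<bar> \<le> M" by (simp_all add: bound)
      have p: "\<bar>zf i (S x) * zf j (S x)\<bar> \<le> M\<^sup>2" if "\<bar>zf i (S x)\<bar> \<le> M" "\<bar>zf j (S x)\<bar> \<le> M" for i j
        using mult_mono[OF that] M by (simp add: abs_mult power2_eq_square)
      have m1: "m1 (S x) \<le> 2 * M\<^sup>2" using p[OF b(1) b(2)] by (simp add: m1_def)
      have m2: "m2 (S x) \<le> 4 * M\<^sup>2" using p[OF b(2) b(2)] p[OF b(1) b(3)] by (simp add: m2_def power2_eq_square)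
      have "4 * S x * m2 (S x) \<le> 4 * S x * (4 * M\<^sup>2)" by (intro mult_left_mono m2) auto
      also have "\<dots> \<le> 4 * 9 * (4 * M\<^sup>2)" by (intro mult_right_mono mult_left_mono S9) auto
      finally have 1: "4 * S x * m2 (S x) \<le> 144 * M\<^sup>2" by simp
      have 2: "2 * real n * m1 (S x) \<le> 2 * real n * (2 * M\<^sup>2)" by (intro mult_left_mono m1) auto
      have 3: "(u x)\<^sup>2 * (4 * S x * m2 (S x) + 2 * real n * m1 (S x)) \<le> (u x)\<^sup>2 * ((144 + 4 * real n) * M\<^sup>2)"
        using 1 2 by (intro mult_left_mono) (auto simp: algebra_simps)
      have "- 2 * u x * lap u2 x \<le> (u x)\<^sup>2 + (lap u2 x)\<^sup>2"
        using zero_le_power2[of "u x + lap u2 x"] by (simp add: power2_sum)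
      then have "(zf 1 (S x))\<^sup>2 * (- 2 * u x * lap u2 x) \<le> (zf 1 (S x))\<^sup>2 * ((u x)\<^sup>2 + (lap u2 x)\<^sup>2)"
        by (intro mult_left_mono) auto
      also have "\<dots> \<le> M\<^sup>2 * ((u x)\<^sup>2 + (lap u2 x)\<^sup>2)"
        using p[OF b(1) b(1)] by (intro mult_right_mono) (auto simp: power2_eq_square)
      finally have 4: "- 2 * (zf 1 (S x))\<^sup>2 * u x * lap u2 x \<le> M\<^sup>2 * ((u x)\<^sup>2 + (lap u2 x)\<^sup>2)"
        by (simp add: algebra_simps)
      have nn: "0 \<le> (144 + 4 * real n) * M\<^sup>2 * (lap u2 x)\<^sup>2" by simp
      have eq: "(145 + 4 * real n) * M\<^sup>2 * ((u x)\<^sup>2 + (lap u2 x)\<^sup>2)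
        = (u x)\<^sup>2 * ((144 + 4 * real n) * M\<^sup>2) + M\<^sup>2 * ((u x)\<^sup>2 + (lap u2 x)\<^sup>2) + (144 + 4 * real n) * M\<^sup>2 * (lap u2 x)\<^sup>2"
        by (simp add: algebra_simps)
      have ind: "indicator {1/4..<R} (S x) = (1::real)" using True by simp
      show ?thesis unfolding ind mult_1 eq using 3 4 nn by linarith
    qed
  qed
  finally show ?thesis by simp
qed

lemma euler_square_le: "(euler u1 x)\<^sup>2 \<le> S x * grad2 u1 x"
  unfolding euler_def S_def grad2_def by (rule Cauchy_Schwarz_ineq_sum)

text \<open>For z = W zeta u the conjugated operator returns W times the Laplacian of zeta u: all
  derivatives of the weight cancel, and only those of the cutoff remain.\<close>

lemma carleman_cutoff:
  assumes u: "C2 u u1 u2" and tau: "\<tau> \<ge> 0"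
  shows "(\<integral>x. 4 * \<tau>^3 * (phi' x)\<^sup>2 * (W \<tau> (S x) * zeta 0 (S x) * u x)\<^sup>2 / S x \<partial>Leb n)
    \<le> (\<integral>x. S x * (W \<tau> (S x) * (zeta 0 (S x) * lap u2 x + 4 * zeta 1 (S x) * euler u1 x
          + (4 * S x * zeta 2 (S x) + 2 * real n * zeta 1 (S x)) * u x))\<^sup>2 \<partial>Leb n)"
proof -
  \<comment> \<open>\<open>h\<close> is the logarithmic derivative of the weight, so every
    derivative of W zeta is W times an explicit factor; \<open>h'\<close> is its derivative.\<close>
  define h where "h s = \<tau> * ((ln s / 2 - 5) / (2 * s))" for s
  define h' where "h' s = \<tau> * (1 / (4 * s\<^sup>2) - (ln s / 2 - 5) / (2 * s\<^sup>2))" for s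
  define m0 where "m0 s = W \<tau> s * zeta 0 s" for s
  define m1 where "m1 s = W \<tau> s * (zeta 1 s + h s * zeta 0 s)" for s
  define m2 where "m2 s = W \<tau> s * (h s * (zeta 1 s + h s * zeta 0 s) + (zeta 2 s + (h s * zeta 1 s + h' s * zeta 0 s)))" for s
  define z where "z x = m0 (S x) * u x" for x
  define z1 where "z1 = mult_grad m0 m1 u u1"
  define z2 where "z2 = mult_hess m0 m1 m2 u u1 u2"
  have dz: "(zeta 0 has_real_derivative zeta 1 s) (at s)" "(zeta 1 has_real_derivative zeta 2 s) (at s)" for s
    using zeta_deriv[of 0 s] zeta_deriv[of 1 s] by (simp_all add: numeral_eq_Suc)
  note dz = dz dz[unfolded One_nat_def]
  have dh: "(h has_real_derivative h' s) (at s)" if "s > 0" for s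
    unfolding h_def h'_def using that
    by (auto intro!: derivative_eq_intros simp: field_simps power2_eq_square)
  have dW: "(W \<tau> has_real_derivative W \<tau> s * h s) (at s)" if "s > 0" for s
    using W_deriv[OF that] by (simp add: h_def)
  have d0: "(m0 has_real_derivative m1 s) (at s)" if "s > 0" for s
    unfolding m0_def m1_def using that
    by (auto intro!: derivative_eq_intros dz dW simp: algebra_simps)
  have d1: "(m1 has_real_derivative m2 s) (at s)" if "s > 0" for s
    unfolding m1_def m2_def using that
    by (auto intro!: derivative_eq_intros dz dW dh simp: algebra_simps)
  have [measurable]: "h \<in> borel_measurable borel" "h' \<in> borel_measurable borel"
    unfolding h_def[abs_def] h'_def[abs_def] by measurable
  have zeros: "m0 s = 0" "m1 s = 0" "m2 s = 0" if "s \<notin> {1/4..8}" for s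
    using that zeta_vals(1,2)[of s] by (auto simp: m0_def m1_def m2_def)
  have C2z: "C2 z z1 z2"
    unfolding z_def z1_def z2_def
  proof (rule C2_mult_radial[OF u d0 d1])
    have "continuous_on {1/4..9} h" "continuous_on {1/4..9} h'"
      unfolding h_def h'_def by (auto intro!: continuous_intros)
    then show "continuous_on {1/4..9} m2"
      unfolding m2_def by (intro continuous_intros continuous_on_W continuous_on_z)
    show "m0 \<in> borel_measurable borel" "m1 \<in> borel_measurable borel" "m2 \<in> borel_measurable borel"
      unfolding m0_def[abs_def] m1_def[abs_def] m2_def[abs_def] by measurable
  qed (auto intro: zeros)
  have out: "m0 (S x) = 0" "m1 (S x) = 0" "m2 (S x) = 0" if "x \<notin> annulus" for x
    using that by (auto simp: annulus_def intro!: zeros)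
  have "(\<integral>x. 4 * \<tau>^3 * (phi' x)\<^sup>2 * (z x)\<^sup>2 / S x \<partial>Leb n)
    \<le> (\<integral>x. S x * (lap z2 x - 2 * \<tau> * phi' x * euler z1 x / S x
          + (\<tau>\<^sup>2 * (phi' x)\<^sup>2 - \<tau> * ((real n - 2) * phi' x + 1)) * z x / S x)\<^sup>2 \<partial>Leb n)"
    using C2z tau by (rule carleman_conjugated) (simp_all add: z_def z1_def z2_def mult_grad_def mult_hess_def out)
  also have "(\<lambda>x. S x * (lap z2 x - 2 * \<tau> * phi' x * euler z1 x / S x
          + (\<tau>\<^sup>2 * (phi' x)\<^sup>2 - \<tau> * ((real n - 2) * phi' x + 1)) * z x / S x)\<^sup>2)
     = (\<lambda>x. S x * (W \<tau> (S x) * (zeta 0 (S x) * lap u2 x + 4 * zeta 1 (S x) * euler u1 x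
          + (4 * S x * zeta 2 (S x) + 2 * real n * zeta 1 (S x)) * u x))\<^sup>2)"
  proof
    fix x
    show "S x * (lap z2 x - 2 * \<tau> * phi' x * euler z1 x / S x
          + (\<tau>\<^sup>2 * (phi' x)\<^sup>2 - \<tau> * ((real n - 2) * phi' x + 1)) * z x / S x)\<^sup>2
       = S x * (W \<tau> (S x) * (zeta 0 (S x) * lap u2 x + 4 * zeta 1 (S x) * euler u1 x
          + (4 * S x * zeta 2 (S x) + 2 * real n * zeta 1 (S x)) * u x))\<^sup>2"
    proof (cases "S x = 0")
      case False
      then have s: "S x > 0" by (simp add: less_le)
      have h: "h (S x) = \<tau> * phi' x / (2 * S x)" by (simp add: h_def phi'_def)
      have h': "h' (S x) = \<tau> * (1 / (4 * (S x)\<^sup>2) - phi' x / (2 * (S x)\<^sup>2))" by (simp add: h'_def phi'_def)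
      have "lap z2 x - 2 * \<tau> * phi' x * euler z1 x / S x
          + (\<tau>\<^sup>2 * (phi' x)\<^sup>2 - \<tau> * ((real n - 2) * phi' x + 1)) * z x / S x
        = W \<tau> (S x) * (zeta 0 (S x) * lap u2 x + 4 * zeta 1 (S x) * euler u1 x
          + (4 * S x * zeta 2 (S x) + 2 * real n * zeta 1 (S x)) * u x)"
        unfolding z1_def z2_def euler_mult_radial lap_mult_radial
        unfolding z_def m0_def m1_def m2_def h h'
        using s by (simp add: field_simps power2_eq_square)
      then show ?thesis by simp
    qed simp
  qed
  finally show ?thesis by (simp add: z_def m0_def)
qed

text \<open>The first summand is 4096 / 2 times the constant of \<open>grad2_cutoff_bound\<close>,
  the second the coefficient of the zeroth-order cutoff terms in \<open>rhs_pointwise_bound\<close>.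
  Only \<open>n\<close> enters.\<close>

definition energy_const :: real where
  "energy_const = (2048 * (145 + 4 * real n) + 32 * (36 + 2 * real n)\<^sup>2) * cutoff_bound\<^sup>2"

lemma energy_const_pos: "energy_const > 0"
proof -
  have "cutoff_bound\<^sup>2 > 0" using cutoff_bound(1) by simp
  then show ?thesis unfolding energy_const_def by (intro mult_pos_pos) (simp_all add: add_pos_nonneg)
qed

text \<open>\<open>F\<close>, \<open>E\<close>, \<open>g\<close> stand for the Laplacian, the Euler
  derivative and the squared gradient. Derivatives of the cutoff live in two zones, and the
  decreasing weight is bounded there by its value at 1/4 or at 6. With s \<le> 8 on the support,
  4096 = 8 * 64 * 8 and 32 = 8 * 4.\<close>

lemma rhs_pointwise_bound:
  fixes s F E g u M :: real
  assumes tau: "\<tau> \<ge> 0" and E: "E\<^sup>2 \<le> s * g" and s0: "s \<ge> 0" and g: "g \<ge> 0"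
  defines "M \<equiv> cutoff_bound"
  shows "s * (W \<tau> s * (zeta 0 s * F + 4 * zeta 1 s * E + (4 * s * zeta 2 s + 2 * real n * zeta 1 s) * u))\<^sup>2
    \<le> 16 * (W \<tau> s * zeta 0 s * F)\<^sup>2
     + (4096 * (W \<tau> (1/4))\<^sup>2 * ((zin 1 s)\<^sup>2 * g) + 4096 * (W \<tau> 6)\<^sup>2 * ((zout 1 s)\<^sup>2 * g))
     + (32 * (36 + 2 * real n)\<^sup>2 * M\<^sup>2 * (W \<tau> (1/4))\<^sup>2 * (indicator {1/4..<1} s * u\<^sup>2)
     + 32 * (36 + 2 * real n)\<^sup>2 * M\<^sup>2 * (W \<tau> 6)\<^sup>2 * (indicator {1/4..<9} s * u\<^sup>2))"
    (is "_ \<le> ?r")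
proof (cases "s \<in> {1/4..8}")
  case False
  then have "zeta k s = 0" for k using zeta_vals(1,2)[of s k] by auto
  moreover have "?r \<ge> 0"
    using g by (intro add_nonneg_nonneg mult_nonneg_nonneg) auto
  ultimately show ?thesis by simp
next
  case True
  then have s: "s > 0" "s \<le> 8" by auto
  define B where "B = 4 * s * zeta 2 s + 2 * real n * zeta 1 s"
  define w where "w = (W \<tau> s)\<^sup>2"
  have w0: "w \<ge> 0" by (simp add: w_def)
  have sq: "(a + b + c)\<^sup>2 \<le> 2 * a\<^sup>2 + 4 * b\<^sup>2 + 4 * c\<^sup>2" for a b c :: real
    using zero_le_power2[of "a - (b + c)"] zero_le_power2[of "b - c"]
    by (simp add: power2_eq_square algebra_simps)
  have MW: "W \<tau> s \<le> W \<tau> t" if "0 < t" "t \<le> s" for t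
    using that s tau Phi_antimono[of t s] by (auto simp: W_def intro: mult_left_mono)
  have MW2: "w \<le> (W \<tau> t)\<^sup>2" if "0 < t" "t \<le> s" for t
    unfolding w_def using MW[OF that] by (intro power_mono) (auto simp: W_def)
  have M: "\<bar>zin k s\<bar> \<le> M" "\<bar>zout k s\<bar> \<le> M" if "k \<le> 2" for k
    using cutoff_bound that by (auto simp: M_def)
  have M1: "M \<ge> 1" using cutoff_bound by (simp add: M_def)
  have Bb: "\<bar>4 * s * y + 2 * real n * z\<bar> \<le> (36 + 2 * real n) * M" if "\<bar>y\<bar> \<le> M" "\<bar>z\<bar> \<le> M" for y z :: real
  proof -
    have "\<bar>4 * s * y + 2 * real n * z\<bar> \<le> 4 * s * \<bar>y\<bar> + 2 * real n * \<bar>z\<bar>"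
      using s by (simp add: abs_mult order_trans[OF abs_triangle_ineq])
    also have "\<dots> \<le> 4 * s * M + 2 * real n * M"
      using s that by (intro add_mono mult_left_mono) auto
    also have "\<dots> \<le> (36 + 2 * real n) * M" using s M1 by (simp add: algebra_simps mult_right_mono)
    finally show ?thesis .
  qed
  have key: "w * (zeta 1 s)\<^sup>2 \<le> (W \<tau> (1/4))\<^sup>2 * (zin 1 s)\<^sup>2 + (W \<tau> 6)\<^sup>2 * (zout 1 s)\<^sup>2 \<and>
     w * B\<^sup>2 \<le> (36 + 2 * real n)\<^sup>2 * M\<^sup>2 * ((W \<tau> (1/4))\<^sup>2 * indicator {1/4..<1} s + (W \<tau> 6)\<^sup>2 * indicator {1/4..<9} s)"
  proof -
    consider "s < 3/4" | "3/4 \<le> s" "s < 6" | "6 \<le> s" by linarith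
    then show ?thesis
    proof cases
      case 1
      then have z: "zeta k s = zin k s" "zout k s = 0" for k by (simp_all add: zeta_def zout_vals)
      have w: "w \<le> (W \<tau> (1/4))\<^sup>2" using True by (intro MW2) auto
      have "B\<^sup>2 \<le> ((36 + 2 * real n) * M)\<^sup>2"
        using Bb[OF M(1)[of 2] M(1)[of 1]] by (simp add: B_def z abs_le_square_iff[symmetric] order_trans[OF _ abs_ge_self])
      then have "w * B\<^sup>2 \<le> (W \<tau> (1/4))\<^sup>2 * ((36 + 2 * real n) * M)\<^sup>2" using w by (intro mult_mono) auto
      also have "\<dots> = (36 + 2 * real n)\<^sup>2 * M\<^sup>2 * (W \<tau> (1/4))\<^sup>2" by (simp only: power_mult_distrib mult_ac)
      also have "\<dots> \<le> (36 + 2 * real n)\<^sup>2 * M\<^sup>2 * ((W \<tau> (1/4))\<^sup>2 * indicator {1/4..<1} s + (W \<tau> 6)\<^sup>2 * indicator {1/4..<9} s)"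
        using 1 True by (intro mult_left_mono) auto
      finally show ?thesis using w by (simp add: z mult_right_mono)
    next
      case 2
      then have "zin 1 s = 0" "zin 2 s = 0" "zout 1 s = 0" "zout 2 s = 0"
        using zin_vals(3)[of s 0] zin_vals(3)[of s 1] by (simp_all add: zout_vals numeral_eq_Suc)
      then show ?thesis by (simp add: B_def zeta_def)
    next
      case 3
      then have i: "zin 1 s = 0" "zin 2 s = 0" using zin_vals(3)[of s 0] zin_vals(3)[of s 1] by (simp_all add: numeral_eq_Suc)
      then have z: "zeta 1 s = - zout 1 s" "zeta 2 s = - zout 2 s" by (simp_all add: zeta_def)
      have w: "w \<le> (W \<tau> 6)\<^sup>2" using 3 by (intro MW2) auto
      have "B\<^sup>2 \<le> ((36 + 2 * real n) * M)\<^sup>2"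
        using Bb[of "- zout 2 s" "- zout 1 s"] M(2)[of 1] M(2)[of 2]
        by (simp add: B_def z z[unfolded One_nat_def] abs_le_square_iff[symmetric] order_trans[OF _ abs_ge_self])
      then have "w * B\<^sup>2 \<le> (W \<tau> 6)\<^sup>2 * ((36 + 2 * real n) * M)\<^sup>2" using w by (intro mult_mono) auto
      also have "\<dots> = (36 + 2 * real n)\<^sup>2 * M\<^sup>2 * (W \<tau> 6)\<^sup>2" by (simp only: power_mult_distrib mult_ac)
      also have "\<dots> \<le> (36 + 2 * real n)\<^sup>2 * M\<^sup>2 * ((W \<tau> (1/4))\<^sup>2 * indicator {1/4..<1} s + (W \<tau> 6)\<^sup>2 * indicator {1/4..<9} s)"
        using 3 True by (intro mult_left_mono) auto
      finally show ?thesis using w by (simp add: z[unfolded One_nat_def] i[unfolded One_nat_def] mult_right_mono)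
    qed
  qed
  have "s * (W \<tau> s * (zeta 0 s * F + 4 * zeta 1 s * E + B * u))\<^sup>2
      = s * w * (zeta 0 s * F + 4 * zeta 1 s * E + B * u)\<^sup>2"
    by (simp add: w_def power_mult_distrib)
  also have "\<dots> \<le> s * w * (2 * (zeta 0 s * F)\<^sup>2 + 4 * (4 * zeta 1 s * E)\<^sup>2 + 4 * (B * u)\<^sup>2)"
    using s w0 by (intro mult_left_mono sq) auto
  also have "\<dots> = s * (2 * (w * (zeta 0 s * F)\<^sup>2)) + s * (64 * (w * (zeta 1 s)\<^sup>2) * E\<^sup>2) + s * (4 * (w * B\<^sup>2) * u\<^sup>2)"
    by (simp add: algebra_simps power_mult_distrib)
  also have "\<dots> \<le> 8 * (2 * (w * (zeta 0 s * F)\<^sup>2)) + 8 * (64 * (w * (zeta 1 s)\<^sup>2) * (8 * g)) + 8 * (4 * (w * B\<^sup>2) * u\<^sup>2)"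
  proof (intro add_mono mult_mono mult_left_mono)
    show "E\<^sup>2 \<le> 8 * g" using E s g mult_right_mono[of s 8 g] by linarith
  qed (use s w0 g in auto)
  also have "\<dots> = 16 * (W \<tau> s * zeta 0 s * F)\<^sup>2 + 4096 * g * (w * (zeta 1 s)\<^sup>2) + 32 * u\<^sup>2 * (w * B\<^sup>2)"
    by (simp add: w_def power_mult_distrib)
  also have "\<dots> \<le> 16 * (W \<tau> s * zeta 0 s * F)\<^sup>2
     + 4096 * g * ((W \<tau> (1/4))\<^sup>2 * (zin 1 s)\<^sup>2 + (W \<tau> 6)\<^sup>2 * (zout 1 s)\<^sup>2)
     + 32 * u\<^sup>2 * ((36 + 2 * real n)\<^sup>2 * M\<^sup>2 * ((W \<tau> (1/4))\<^sup>2 * indicator {1/4..<1} s + (W \<tau> 6)\<^sup>2 * indicator {1/4..<9} s))"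
    using key g by (intro add_mono mult_left_mono order_refl) auto
  also have "\<dots> = ?r" by (simp add: algebra_simps)
  finally show ?thesis by (simp add: B_def)
qed

theorem local_carleman:
  assumes u: "C2 u u1 u2" and tau: "\<tau> \<ge> 0"
  shows "\<tau>^3 / 2 * (\<integral>x. (W \<tau> (S x) * zeta 0 (S x) * u x)\<^sup>2 \<partial>Leb n)
    \<le> 16 * (\<integral>x. (W \<tau> (S x) * zeta 0 (S x) * lap u2 x)\<^sup>2 \<partial>Leb n)
      + energy_const * (W \<tau> (1/4))\<^sup>2 * (\<integral>x. indicator {1/4..<1} (S x) * ((u x)\<^sup>2 + (lap u2 x)\<^sup>2) \<partial>Leb n)
      + energy_const * (W \<tau> 6)\<^sup>2 * (\<integral>x. indicator {1/4..<9} (S x) * ((u x)\<^sup>2 + (lap u2 x)\<^sup>2) \<partial>Leb n)"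
proof -
  note d = u[unfolded C2_def]
  define M where "M = cutoff_bound"
  define a where "a = (W \<tau> (1/4))\<^sup>2"
  define b where "b = (W \<tau> 6)\<^sup>2"
  define K where "K = 32 * (36 + 2 * real n)\<^sup>2 * M\<^sup>2"
  define G where "G = (145 + 4 * real n) * M\<^sup>2"
  have bml: "tame (lap u2)" "tame (euler u1)" "tame (grad2 u1)"
    unfolding lap_def euler_def grad2_def using d by (auto intro!: tame_intros)
  have bmi: "tame (\<lambda>x. indicator A (S x))" if "A \<in> sets borel" for A
    using that by (intro tame_radial_bounded[of _ 1]) (auto simp: indicator_def)
  have bmz: "tame (\<lambda>x. zeta k (S x))" "tame (\<lambda>x. zin k (S x))" "tame (\<lambda>x. zout k (S x))" "tame (\<lambda>x. W \<tau> (S x))" for k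
    by (intro tame_radial z_measurable continuous_on_z W_measurable continuous_on_W)+
  note bms = tame_intros bml bmi bmz tame_phi' d
  have z0: "zeta k (S x) = 0" if "x \<notin> annulus" for x k
    using that zeta_vals(1,2)[of "S x" k] by (auto simp: annulus_def)
  have z1: "zin 1 (S x) = 0" "zout 1 (S x) = 0" if "x \<notin> annulus" for x
    using that zin_vals(1,3)[of "S x"] zout_vals(1,3)[of "S x"] by (auto simp: annulus_def)
  note z1 = z1 z1[unfolded One_nat_def]
  have i0: "indicator {1/4..<1} (S x) = (0::real)" "indicator {1/4..<9} (S x) = (0::real)" if "x \<notin> annulus" for x
    using that by (auto simp: annulus_def indicator_def)
  define U where "U x = (W \<tau> (S x) * zeta 0 (S x) * u x)\<^sup>2" for x
  define F where "F x = (W \<tau> (S x) * zeta 0 (S x) * lap u2 x)\<^sup>2" for x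
  define gi where "gi x = (zin 1 (S x))\<^sup>2 * grad2 u1 x" for x
  define go where "go x = (zout 1 (S x))\<^sup>2 * grad2 u1 x" for x
  define ui where "ui x = indicator {1/4..<1} (S x) * (u x)\<^sup>2" for x
  define uo where "uo x = indicator {1/4..<9} (S x) * (u x)\<^sup>2" for x
  define vi where "vi x = indicator {1/4..<1} (S x) * ((u x)\<^sup>2 + (lap u2 x)\<^sup>2)" for x
  define vo where "vo x = indicator {1/4..<9} (S x) * ((u x)\<^sup>2 + (lap u2 x)\<^sup>2)" for x
  define L where "L x = 4 * \<tau>^3 * (phi' x)\<^sup>2 * (W \<tau> (S x) * zeta 0 (S x) * u x)\<^sup>2 / S x" for x
  define R where "R x = S x * (W \<tau> (S x) * (zeta 0 (S x) * lap u2 x + 4 * zeta 1 (S x) * euler u1 x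
          + (4 * S x * zeta 2 (S x) + 2 * real n * zeta 1 (S x)) * u x))\<^sup>2" for x
  have int: "integrable (Leb n) U" "integrable (Leb n) F" "integrable (Leb n) gi" "integrable (Leb n) go"
    "integrable (Leb n) ui" "integrable (Leb n) uo" "integrable (Leb n) vi" "integrable (Leb n) vo"
    "integrable (Leb n) L" "integrable (Leb n) R"
    unfolding U_def F_def gi_def go_def ui_def uo_def vi_def vo_def L_def R_def
    using d by (auto intro!: tame_integrable bms simp: z0 z1 i0)
  have LR: "(\<integral>x. L x \<partial>Leb n) \<le> (\<integral>x. R x \<partial>Leb n)"
    unfolding L_def R_def by (rule carleman_cutoff[OF u tau])
  have "\<tau>^3 / 2 * (\<integral>x. U x \<partial>Leb n) = (\<integral>x. \<tau>^3 / 2 * U x \<partial>Leb n)" by simp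
  also have "\<dots> \<le> (\<integral>x. L x \<partial>Leb n)"
  proof (rule integral_mono)
    fix x
    show "\<tau>^3 / 2 * U x \<le> L x"
    proof (cases "S x \<in> {1/4..8}")
      case False
      then show ?thesis using zeta_vals(1,2)[of "S x" 0] by (auto simp: U_def L_def)
    next
      case True
      then have s: "S x > 0" "S x \<le> 8" by auto
      \<comment> \<open>On the support of the cutoff S \<le> 8 and phi' \<le> -1, so 4 phi'^2 / S
        \<ge> 1/2; this is the factor 1/2 on the left of the estimate.\<close>
      have "ln (S x) \<le> 7" using ln_le_minus_one[OF s(1)] s(2) by linarith
      then have "phi' x \<le> - 1" by (simp add: phi'_def)
      then have p: "(phi' x)\<^sup>2 \<ge> 1" using one_le_power[of "- phi' x" 2] by simp
      have "1 / 2 \<le> 4 * 1 / S x" using s by (simp add: field_simps)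
      also have "\<dots> \<le> 4 * (phi' x)\<^sup>2 / S x" using s p by (intro divide_right_mono mult_left_mono) auto
      finally have "\<tau>^3 * U x * (1 / 2) \<le> \<tau>^3 * U x * (4 * (phi' x)\<^sup>2 / S x)"
        using tau by (intro mult_left_mono) (auto simp: U_def)
      then show ?thesis by (simp add: L_def U_def mult_ac)
    qed
  qed (use int in auto)
  also note LR
  also have "(\<integral>x. R x \<partial>Leb n) \<le> (\<integral>x. 16 * F x + (4096 * a * gi x + 4096 * b * go x) + (K * a * ui x + K * b * uo x) \<partial>Leb n)"
  proof (rule integral_mono)
    fix x
    show "R x \<le> 16 * F x + (4096 * a * gi x + 4096 * b * go x) + (K * a * ui x + K * b * uo x)"
      unfolding R_def F_def a_def b_def gi_def go_def K_def M_def ui_def uo_def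
      by (rule rhs_pointwise_bound[OF tau euler_square_le]) (simp_all add: grad2_def sum_nonneg)
  qed (use int in auto)
  also have "\<dots> = 16 * (\<integral>x. F x \<partial>Leb n) + 4096 * a * (\<integral>x. gi x \<partial>Leb n) + 4096 * b * (\<integral>x. go x \<partial>Leb n)
       + K * a * (\<integral>x. ui x \<partial>Leb n) + K * b * (\<integral>x. uo x \<partial>Leb n)"
    using int by simp
  also have "\<dots> \<le> 16 * (\<integral>x. F x \<partial>Leb n) + 2048 * a * (G * (\<integral>x. vi x \<partial>Leb n)) + 2048 * b * (G * (\<integral>x. vo x \<partial>Leb n))
       + K * a * (\<integral>x. vi x \<partial>Leb n) + K * b * (\<integral>x. vo x \<partial>Leb n)"
  proof -
    have 1: "2 * (\<integral>x. gi x \<partial>Leb n) \<le> G * (\<integral>x. vi x \<partial>Leb n)"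
      unfolding gi_def vi_def G_def M_def
      using cutoff_bound zin_deriv zin_vals
      by (intro grad2_cutoff_bound[OF u]) (auto intro: order_trans[OF _ cutoff_bound(1)])
    have 2: "2 * (\<integral>x. go x \<partial>Leb n) \<le> G * (\<integral>x. vo x \<partial>Leb n)"
      unfolding go_def vo_def G_def M_def
      using cutoff_bound zout_deriv zout_vals
      by (intro grad2_cutoff_bound[OF u]) (auto intro: order_trans[OF _ cutoff_bound(1)])
    have 3: "(\<integral>x. ui x \<partial>Leb n) \<le> (\<integral>x. vi x \<partial>Leb n)"
      by (rule integral_mono[OF int(5,7)]) (simp add: ui_def vi_def mult_left_mono)
    have 4: "(\<integral>x. uo x \<partial>Leb n) \<le> (\<integral>x. vo x \<partial>Leb n)"
      by (rule integral_mono[OF int(6,8)]) (simp add: uo_def vo_def mult_left_mono)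
    have ab: "a \<ge> 0" "b \<ge> 0" "K \<ge> 0" by (auto simp: a_def b_def K_def)
    have "4096 * a * (\<integral>x. gi x \<partial>Leb n) \<le> 2048 * a * (G * (\<integral>x. vi x \<partial>Leb n))"
      using mult_left_mono[OF 1, of "2048 * a"] ab by simp
    moreover have "4096 * b * (\<integral>x. go x \<partial>Leb n) \<le> 2048 * b * (G * (\<integral>x. vo x \<partial>Leb n))"
      using mult_left_mono[OF 2, of "2048 * b"] ab by simp
    moreover have "K * a * (\<integral>x. ui x \<partial>Leb n) \<le> K * a * (\<integral>x. vi x \<partial>Leb n)"
      "K * b * (\<integral>x. uo x \<partial>Leb n) \<le> K * b * (\<integral>x. vo x \<partial>Leb n)"
      using 3 4 ab by (intro mult_left_mono; simp)+
    ultimately show ?thesis by linarith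
  qed
  also have "\<dots> = 16 * (\<integral>x. F x \<partial>Leb n) + energy_const * a * (\<integral>x. vi x \<partial>Leb n) + energy_const * b * (\<integral>x. vo x \<partial>Leb n)"
    by (simp add: energy_const_def G_def K_def M_def algebra_simps)
  finally show ?thesis by (simp add: U_def F_def vi_def vo_def a_def b_def)
qed

end

section \<open>Averaging kernels\<close>

text \<open>The kernel is a probability density in each variable: total mass 1 in \<open>y\<close>
  makes \<open>T\<close> an average, total mass 1 in \<open>x\<close> makes it a contraction of L^1.
  The bound \<open>b j\<close> keeps its products with integrable functions integrable.\<close>

locale averaging = sigma_finite_measure M for M :: "'a measure" +
  fixes k :: "nat \<Rightarrow> 'a \<Rightarrow> 'a \<Rightarrow> real" and b :: "nat \<Rightarrow> real"
  assumes k_measurable [measurable]: "\<And>j. (\<lambda>(x, y). k j x y) \<in> borel_measurable (M \<Otimes>\<^sub>M M)"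
    and k_nonneg: "\<And>j x y. 0 \<le> k j x y" and k_le: "\<And>j x y. k j x y \<le> b j"
    and k_dy: "\<And>j x. x \<in> space M \<Longrightarrow> (\<integral>\<^sup>+y. k j x y \<partial>M) = 1"
    and k_dx: "\<And>j y. y \<in> space M \<Longrightarrow> (\<integral>\<^sup>+x. k j x y \<partial>M) = 1"
begin

sublocale pair: pair_sigma_finite M M ..

definition T :: "nat \<Rightarrow> ('a \<Rightarrow> real) \<Rightarrow> 'a \<Rightarrow> real" where
  "T j f x = (\<integral>y. f y * k j x y \<partial>M)"

lemma k_section [measurable]: "x \<in> space M \<Longrightarrow> k j x \<in> borel_measurable M"
  by measurable

lemma integrable_mult_k: "integrable M f \<Longrightarrow> x \<in> space M \<Longrightarrow> integrable M (\<lambda>y. f y * k j x y)" for f :: "'a \<Rightarrow> real"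
proof (rule Bochner_Integration.integrable_bound[of M "\<lambda>y. b j * \<bar>f y\<bar>"])
  assume "integrable M f" "x \<in> space M"
  then show "AE y in M. norm (f y * k j x y) \<le> norm (b j * \<bar>f y\<bar>)"
    using k_nonneg[of j x] k_le[of j x] order_trans[OF k_nonneg k_le, of j]
    by (intro always_eventually) (auto simp: abs_mult mult.commute[of "b j"] intro!: mult_left_mono)
qed auto

lemma integrable_k: "x \<in> space M \<Longrightarrow> integrable M (k j x)" and integral_k: "x \<in> space M \<Longrightarrow> (\<integral>y. k j x y \<partial>M) = 1"
proof -
  assume x: "x \<in> space M"
  then show "integrable M (k j x)" using k_dy[OF x] k_nonneg by (intro integrableI_nonneg) auto
  show "(\<integral>y. k j x y \<partial>M) = 1" using x k_dy[OF x] k_nonneg by (subst integral_eq_nn_integral) auto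
qed

lemma nn_integral_average:
  assumes [measurable]: "g \<in> borel_measurable M"
  shows "(\<integral>\<^sup>+x. (\<integral>\<^sup>+y. g y * ennreal (k j x y) \<partial>M) \<partial>M) = (\<integral>\<^sup>+y. g y \<partial>M)"
proof -
  have "(\<integral>\<^sup>+x. (\<integral>\<^sup>+y. g y * ennreal (k j x y) \<partial>M) \<partial>M) = (\<integral>\<^sup>+y. (\<integral>\<^sup>+x. g y * ennreal (k j x y) \<partial>M) \<partial>M)"
    by (rule pair.Fubini'[symmetric]) measurable
  also have "\<dots> = (\<integral>\<^sup>+y. g y * 1 \<partial>M)"
    by (intro nn_integral_cong) (simp add: nn_integral_cmult k_dx)
  finally show ?thesis by simp
qed

lemma T_integrable:
  assumes f: "integrable M f"
  shows "integrable M (T j f)" and "(\<integral>x. \<bar>T j f x\<bar> \<partial>M) \<le> (\<integral>x. \<bar>f x\<bar> \<partial>M)"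
proof -
  note [measurable] = borel_measurable_integrable[OF f]
  have m [measurable]: "T j f \<in> borel_measurable M"
    unfolding T_def by measurable
  have "(\<integral>\<^sup>+x. ennreal \<bar>T j f x\<bar> \<partial>M) \<le> (\<integral>\<^sup>+x. (\<integral>\<^sup>+y. ennreal \<bar>f y\<bar> * ennreal (k j x y) \<partial>M) \<partial>M)"
  proof (rule nn_integral_mono)
    fix x assume "x \<in> space M"
    have "ennreal \<bar>T j f x\<bar> \<le> (\<integral>\<^sup>+y. ennreal (norm (f y * k j x y)) \<partial>M)"
      unfolding T_def using integral_norm_bound_ennreal[OF integrable_mult_k[OF f \<open>x \<in> space M\<close>]] by simp
    also have "\<dots> = (\<integral>\<^sup>+y. ennreal \<bar>f y\<bar> * ennreal (k j x y) \<partial>M)"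
      by (simp add: abs_mult k_nonneg ennreal_mult)
    finally show "ennreal \<bar>T j f x\<bar> \<le> \<dots>" .
  qed
  also have "\<dots> = (\<integral>\<^sup>+y. ennreal \<bar>f y\<bar> \<partial>M)" by (rule nn_integral_average) simp
  finally have le: "(\<integral>\<^sup>+x. ennreal \<bar>T j f x\<bar> \<partial>M) \<le> (\<integral>\<^sup>+y. ennreal \<bar>f y\<bar> \<partial>M)" .
  also have fin: "\<dots> < \<infinity>" using f by (simp add: integrable_iff_bounded)
  finally show i: "integrable M (T j f)" by (simp add: integrable_iff_bounded)
  have "ennreal (\<integral>x. \<bar>T j f x\<bar> \<partial>M) \<le> ennreal (\<integral>x. \<bar>f x\<bar> \<partial>M)"
    using le i f by (subst (1 2) nn_integral_eq_integral[symmetric]) auto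
  then show "(\<integral>x. \<bar>T j f x\<bar> \<partial>M) \<le> (\<integral>x. \<bar>f x\<bar> \<partial>M)"
    by (subst (asm) ennreal_le_iff) auto
qed

lemma T_diff: "integrable M f \<Longrightarrow> integrable M g \<Longrightarrow> x \<in> space M \<Longrightarrow> T j (\<lambda>x. f x - g x) x = T j f x - T j g x"
  unfolding T_def by (simp add: left_diff_distrib integrable_mult_k)

lemma T_add: "integrable M f \<Longrightarrow> integrable M g \<Longrightarrow> x \<in> space M \<Longrightarrow> T j (\<lambda>x. f x + g x) x = T j f x + T j g x"
  unfolding T_def by (simp add: distrib_right integrable_mult_k)

lemma T_square_le:
  assumes f: "integrable M f" "integrable M (\<lambda>x. (f x)\<^sup>2)" and x: "x \<in> space M"
  shows "(T j f x)\<^sup>2 \<le> T j (\<lambda>x. (f x)\<^sup>2) x"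
proof -
  \<comment> \<open>Jensen's inequality: the variance of \<open>f\<close> under the probability density \<open>k j x\<close> is nonnegative.\<close>
  define c where "c = T j f x"
  note int = integrable_mult_k[OF f(2) x, of j] integrable_mult_k[OF f(1) x, of j] integrable_k[OF x, of j]
  have "0 \<le> (\<integral>y. (f y - c)\<^sup>2 * k j x y \<partial>M)" by (simp add: k_nonneg)
  also have "\<dots> = (\<integral>y. (f y)\<^sup>2 * k j x y - (2 * c * (f y * k j x y) - c\<^sup>2 * k j x y) \<partial>M)"
    by (intro Bochner_Integration.integral_cong) (auto simp: power2_eq_square algebra_simps)
  also have "\<dots> = T j (\<lambda>x. (f x)\<^sup>2) x - (2 * c * c - c\<^sup>2)"
    using int integral_k[OF x] by (simp add: T_def[symmetric] c_def)
  finally show ?thesis by (simp add: c_def power2_eq_square)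
qed

text \<open>Jensen's inequality pointwise, followed by the L^1 contraction applied to f^2.\<close>

lemma T_L2:
  assumes f: "integrable M f" "integrable M (\<lambda>x. (f x)\<^sup>2)"
  shows "integrable M (\<lambda>x. (T j f x)\<^sup>2)" and "(\<integral>x. (T j f x)\<^sup>2 \<partial>M) \<le> (\<integral>x. (f x)\<^sup>2 \<partial>M)"
proof -
  have [measurable]: "T j f \<in> borel_measurable M" using T_integrable(1)[OF f(1)] by simp
  show i: "integrable M (\<lambda>x. (T j f x)\<^sup>2)"
    by (rule Bochner_Integration.integrable_bound[OF T_integrable(1)[OF f(2), of j]])
       (auto intro!: AE_I2 order_trans[OF T_square_le[OF f]])
  have "(\<integral>x. (T j f x)\<^sup>2 \<partial>M) \<le> (\<integral>x. \<bar>T j (\<lambda>x. (f x)\<^sup>2) x\<bar> \<partial>M)"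
    using i T_integrable(1)[OF f(2), of j] T_square_le[OF f]
    by (intro integral_mono) (auto intro: order_trans[OF _ abs_ge_self])
  also have "\<dots> \<le> (\<integral>x. \<bar>(f x)\<^sup>2\<bar> \<partial>M)" by (rule T_integrable(2)[OF f(2)])
  finally show "(\<integral>x. (T j f x)\<^sup>2 \<partial>M) \<le> (\<integral>x. (f x)\<^sup>2 \<partial>M)" by simp
qed

definition conv1 :: "('a \<Rightarrow> real) \<Rightarrow> bool" where
  "conv1 f \<longleftrightarrow> (\<lambda>j. \<integral>x. \<bar>T j f x - f x\<bar> \<partial>M) \<longlonglongrightarrow> 0"

text \<open>Three-epsilon argument: T (f - g) is no larger in L^1 than f - g, uniformly in
  \<open>j\<close>.\<close>

lemma conv1_closure:
  assumes f: "integrable M f"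
    and approx: "\<And>\<delta>. \<delta> > 0 \<Longrightarrow> \<exists>g. integrable M g \<and> conv1 g \<and> (\<integral>x. \<bar>f x - g x\<bar> \<partial>M) < \<delta>"
  shows "conv1 f"
  unfolding conv1_def
proof (rule LIMSEQ_I)
  fix e :: real assume "e > 0"
  then obtain g where g: "integrable M g" "conv1 g" "(\<integral>x. \<bar>f x - g x\<bar> \<partial>M) < e / 3"
    using approx[of "e / 3"] by auto
  from LIMSEQ_D[OF g(2)[unfolded conv1_def], of "e / 3"] \<open>e > 0\<close> obtain N where
    N: "\<And>j. j \<ge> N \<Longrightarrow> (\<integral>x. \<bar>T j g x - g x\<bar> \<partial>M) < e / 3" by auto
  have "norm ((\<integral>x. \<bar>T j f x - f x\<bar> \<partial>M) - 0) < e" if "j \<ge> N" for j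
  proof -
    note int = f g(1) T_integrable(1)[OF f, of j] T_integrable(1)[OF g(1), of j]
      T_integrable(1)[of "\<lambda>x. f x - g x" j]
    have "(\<integral>x. \<bar>T j f x - f x\<bar> \<partial>M) \<le> (\<integral>x. \<bar>T j (\<lambda>x. f x - g x) x\<bar> + \<bar>T j g x - g x\<bar> + \<bar>f x - g x\<bar> \<partial>M)"
      using int by (intro integral_mono) (auto simp: T_diff)
    also have "\<dots> = (\<integral>x. \<bar>T j (\<lambda>x. f x - g x) x\<bar> \<partial>M) + (\<integral>x. \<bar>T j g x - g x\<bar> \<partial>M) + (\<integral>x. \<bar>f x - g x\<bar> \<partial>M)"
      using int by simp
    also have "\<dots> < e"
      using T_integrable(2)[of "\<lambda>x. f x - g x" j] f g N[OF that] by simp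
    finally show ?thesis by simp
  qed
  then show "\<exists>no. \<forall>n\<ge>no. norm ((\<integral>x. \<bar>T n f x - f x\<bar> \<partial>M) - 0) < e" by blast
qed

lemma conv1_add:
  assumes "integrable M f" "integrable M g" "conv1 f" "conv1 g"
  shows "conv1 (\<lambda>x. f x + g x)"
  unfolding conv1_def
proof (rule tendsto_sandwich[OF _ _ tendsto_const])
  show "(\<lambda>j. (\<integral>x. \<bar>T j f x - f x\<bar> \<partial>M) + (\<integral>x. \<bar>T j g x - g x\<bar> \<partial>M)) \<longlonglongrightarrow> 0"
    using tendsto_add[OF assms(3,4)[unfolded conv1_def]] by simp
  have "(\<integral>x. \<bar>T j (\<lambda>x. f x + g x) x - (f x + g x)\<bar> \<partial>M) \<le> (\<integral>x. \<bar>T j f x - f x\<bar> \<partial>M) + (\<integral>x. \<bar>T j g x - g x\<bar> \<partial>M)" for j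
  proof -
    note int = assms(1,2) T_integrable(1)[OF assms(1), of j] T_integrable(1)[OF assms(2), of j]
      T_integrable(1)[of "\<lambda>x. f x + g x" j]
    have "(\<integral>x. \<bar>T j (\<lambda>x. f x + g x) x - (f x + g x)\<bar> \<partial>M) \<le> (\<integral>x. \<bar>T j f x - f x\<bar> + \<bar>T j g x - g x\<bar> \<partial>M)"
      using int by (intro integral_mono) (auto simp: T_add)
    then show ?thesis using int by simp
  qed
  then show "\<forall>\<^sub>F j in sequentially. (\<integral>x. \<bar>T j (\<lambda>x. f x + g x) x - (f x + g x)\<bar> \<partial>M) \<le> (\<integral>x. \<bar>T j f x - f x\<bar> \<partial>M) + (\<integral>x. \<bar>T j g x - g x\<bar> \<partial>M)"
    by simp
qed simp

lemma conv1_cmult: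
  assumes "conv1 f" shows "conv1 (\<lambda>x. c * f x)"
proof -
  have "T j (\<lambda>x. c * f x) x - c * f x = c * (T j f x - f x)" for j x
    by (simp add: T_def mult.assoc right_diff_distrib)
  then have "(\<integral>x. \<bar>T j (\<lambda>x. c * f x) x - c * f x\<bar> \<partial>M) = \<bar>c\<bar> * (\<integral>x. \<bar>T j f x - f x\<bar> \<partial>M)" for j
    by (simp add: abs_mult)
  then show ?thesis
    using tendsto_mult_right_zero[OF assms[unfolded conv1_def], of "\<bar>c\<bar>"] by (simp add: conv1_def)
qed

theorem conv1_integrable:
  assumes ind: "\<And>A. A \<in> sets M \<Longrightarrow> emeasure M A < \<infinity> \<Longrightarrow> conv1 (indicator A)"
    and f: "integrable M f"
  shows "conv1 f"
  using f
proof (induction rule: integrable_induct)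
  case (base A c)
  then show ?case using conv1_cmult[OF ind, of A c] by (simp add: mult.commute)
next
  case (add f g)
  then show ?case by (intro conv1_add) auto
next
  case (lim f s)
  show ?case
  proof (rule conv1_closure[OF lim.hyps(4)])
    fix \<delta> :: real assume "\<delta> > 0"
    have [measurable]: "f \<in> borel_measurable M" "\<And>i. s i \<in> borel_measurable M" using lim by auto
    \<comment> \<open>The approximants satisfy |s i| \<le> 2 |f|, hence the dominating function 3
      |f|.\<close>
    have "(\<lambda>i. \<integral>x. \<bar>f x - s i x\<bar> \<partial>M) \<longlonglongrightarrow> (\<integral>x. 0 \<partial>M)"
    proof (rule integral_dominated_convergence[where w = "\<lambda>x. 3 * \<bar>f x\<bar>"])
      show "AE x in M. (\<lambda>i. \<bar>f x - s i x\<bar>) \<longlonglongrightarrow> 0"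
      proof (rule AE_I2)
        fix x assume "x \<in> space M"
        have "(\<lambda>i. \<bar>f x - s i x\<bar>) \<longlonglongrightarrow> \<bar>f x - f x\<bar>" by (intro tendsto_intros lim.hyps \<open>x \<in> space M\<close>)
        then show "(\<lambda>i. \<bar>f x - s i x\<bar>) \<longlonglongrightarrow> 0" by simp
      qed
      show "AE x in M. norm \<bar>f x - s i x\<bar> \<le> 3 * \<bar>f x\<bar>" for i
      proof (rule AE_I2)
        fix x assume "x \<in> space M"
        from lim.hyps(3)[OF this, of i] show "norm \<bar>f x - s i x\<bar> \<le> 3 * \<bar>f x\<bar>" by simp
      qed
    qed (use lim in auto)
    from LIMSEQ_D[OF this \<open>\<delta> > 0\<close>] obtain i where "(\<integral>x. \<bar>f x - s i x\<bar> \<partial>M) < \<delta>" by auto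
    then show "\<exists>g. integrable M g \<and> conv1 g \<and> (\<integral>x. \<bar>f x - g x\<bar> \<partial>M) < \<delta>"
      using lim by blast
  qed
qed

text \<open>Truncate at height N. For the truncated g both g and T g stay below N, so the squared
  error is at most 2N times the L^1 error, which tends to 0. The remainder is small in L^2, and so
  is its average by \<open>T_L2\<close>.\<close>

theorem L2_convergence:
  assumes ind: "\<And>A. A \<in> sets M \<Longrightarrow> emeasure M A < \<infinity> \<Longrightarrow> conv1 (indicator A)"
    and f: "integrable M f" "integrable M (\<lambda>x. (f x)\<^sup>2)"
  shows "(\<lambda>j. \<integral>x. (T j f x - f x)\<^sup>2 \<partial>M) \<longlonglongrightarrow> 0"
proof (rule LIMSEQ_I)
  fix e :: real assume e: "e > 0"
  note [measurable] = borel_measurable_integrable[OF f(1)]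
  define h where "h N x = max (- real N) (min (real N) (f x))" for N x
  have h_bound: "\<bar>h N x\<bar> \<le> real N" "\<bar>h N x\<bar> \<le> \<bar>f x\<bar>" for N x by (auto simp: h_def)
  have [measurable]: "h N \<in> borel_measurable M" for N unfolding h_def by measurable
  have h_int: "integrable M (h N)" "integrable M (\<lambda>x. (h N x)\<^sup>2)" for N
    by (rule Bochner_Integration.integrable_bound[OF f(1)]; use h_bound(2) in \<open>auto intro!: AE_I2\<close>)
       (rule Bochner_Integration.integrable_bound[OF f(2)]; use h_bound(2) in \<open>auto intro!: AE_I2 simp: abs_le_square_iff\<close>)
  have "(\<lambda>N. \<integral>x. (f x - h N x)\<^sup>2 \<partial>M) \<longlonglongrightarrow> (\<integral>x. 0 \<partial>M)"
  proof (rule integral_dominated_convergence[where w = "\<lambda>x. (f x)\<^sup>2"])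
    show "AE x in M. (\<lambda>N. (f x - h N x)\<^sup>2) \<longlonglongrightarrow> 0"
    proof (rule AE_I2, rule tendsto_eventually)
      fix x
      obtain N0 where "\<bar>f x\<bar> \<le> real N0" using real_arch_simple by blast
      then show "\<forall>\<^sub>F N in sequentially. (f x - h N x)\<^sup>2 = 0"
        unfolding eventually_sequentially by (intro exI[of _ N0]) (auto simp: h_def)
    qed
    show "AE x in M. norm ((f x - h N x)\<^sup>2) \<le> (f x)\<^sup>2" for N
      by (intro AE_I2) (auto simp: abs_le_square_iff[symmetric] h_def)
  qed (use f in auto)
  \<comment> \<open>The final bound counts the remainder 6 times and the truncated part 3
    times.\<close>
  from LIMSEQ_D[OF this, of "e / 9"] e obtain N where N: "(\<integral>x. (f x - h N x)\<^sup>2 \<partial>M) < e / 9" by auto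
  define g where "g = h N"
  have g: "integrable M g" "integrable M (\<lambda>x. (g x)\<^sup>2)" using h_int by (auto simp: g_def)
  define r where "r x = f x - g x" for x
  have r: "integrable M r" "integrable M (\<lambda>x. (r x)\<^sup>2)"
  proof -
    show "integrable M r" using f g by (simp add: r_def[abs_def])
    then show "integrable M (\<lambda>x. (r x)\<^sup>2)"
      by (intro Bochner_Integration.integrable_bound[OF f(2)] AE_I2)
         (auto simp: r_def g_def h_def abs_le_square_iff[symmetric])
  qed
  have "(\<lambda>j. 2 * real N * (\<integral>x. \<bar>T j g x - g x\<bar> \<partial>M)) \<longlonglongrightarrow> 2 * real N * 0"
    using conv1_integrable[OF ind g(1)] unfolding conv1_def by (intro tendsto_intros)
  from LIMSEQ_D[OF this, of "e / 9"] e obtain J where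
    J: "\<And>j. j \<ge> J \<Longrightarrow> 2 * real N * (\<integral>x. \<bar>T j g x - g x\<bar> \<partial>M) < e / 9" by (auto simp: abs_mult)
  have "norm ((\<integral>x. (T j f x - f x)\<^sup>2 \<partial>M) - 0) < e" if "j \<ge> J" for j
  proof -
    note int = T_integrable(1)[OF f(1), of j] T_integrable(1)[OF g(1), of j] T_L2(1)[OF f, of j] T_L2(1)[OF g, of j]
      T_integrable(1)[OF r(1), of j] T_L2(1)[OF r, of j]
    note [measurable] = int[THEN borel_measurable_integrable]
    have Tg: "\<bar>T j g x\<bar> \<le> real N" if x: "x \<in> space M" for x
    proof -
      have "\<bar>T j g x\<bar> \<le> (\<integral>y. \<bar>g y * k j x y\<bar> \<partial>M)" unfolding T_def by (rule integral_abs_bound)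
      also have "\<dots> \<le> (\<integral>y. real N * k j x y \<partial>M)"
        using integrable_mult_k[OF g(1) x, of j] integrable_mult_k[OF integrable_abs[OF g(1)] x, of j] integrable_k[OF x, of j] h_bound(1)[of N]
        by (intro integral_mono) (auto simp: abs_mult k_nonneg g_def intro!: mult_right_mono)
      also have "\<dots> = real N" using integral_k[OF x] by simp
      finally show ?thesis .
    qed
    have sq: "(T j g x - g x)\<^sup>2 \<le> 2 * real N * \<bar>T j g x - g x\<bar>" if "x \<in> space M" for x
    proof -
      have "\<bar>T j g x - g x\<bar> \<le> 2 * real N" using Tg[OF that] h_bound(1)[of N x] unfolding g_def by linarith
      then have "\<bar>T j g x - g x\<bar> * \<bar>T j g x - g x\<bar> \<le> 2 * real N * \<bar>T j g x - g x\<bar>" by (intro mult_right_mono) auto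
      then show ?thesis by (simp add: power2_eq_square)
    qed
    have i2: "integrable M (\<lambda>x. (T j g x - g x)\<^sup>2)"
    proof (rule Bochner_Integration.integrable_bound[of M "\<lambda>x. 2 * real N * \<bar>T j g x - g x\<bar>"])
      show "AE x in M. norm ((T j g x - g x)\<^sup>2) \<le> norm (2 * real N * \<bar>T j g x - g x\<bar>)"
        using sq by (intro AE_I2) (simp add: abs_mult)
    qed (use int g in \<open>auto simp: g_def\<close>)
    have "(\<integral>x. (T j f x - f x)\<^sup>2 \<partial>M) \<le> (\<integral>x. 3 * (T j r x)\<^sup>2 + 3 * (T j g x - g x)\<^sup>2 + 3 * (r x)\<^sup>2 \<partial>M)"
    proof (rule integral_mono')
      fix x assume x: "x \<in> space M"
      have "T j f x - f x = T j r x + (T j g x - g x) - r x"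
        using T_diff[OF f(1) g(1) x, of j] by (simp add: r_def[abs_def])
      moreover have "(a + b - c)\<^sup>2 \<le> 3 * a\<^sup>2 + 3 * b\<^sup>2 + 3 * c\<^sup>2" for a b c :: real
        using zero_le_power2[of "a - b"] zero_le_power2[of "a + c"] zero_le_power2[of "b + c"]
        by (simp add: power2_eq_square algebra_simps)
      ultimately show "(T j f x - f x)\<^sup>2 \<le> 3 * (T j r x)\<^sup>2 + 3 * (T j g x - g x)\<^sup>2 + 3 * (r x)\<^sup>2" by simp
    qed (use int i2 r in auto)
    also have "\<dots> = 3 * (\<integral>x. (T j r x)\<^sup>2 \<partial>M) + 3 * (\<integral>x. (T j g x - g x)\<^sup>2 \<partial>M) + 3 * (\<integral>x. (r x)\<^sup>2 \<partial>M)"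
      using int i2 r by simp
    also have "(\<integral>x. (T j g x - g x)\<^sup>2 \<partial>M) \<le> (\<integral>x. 2 * real N * \<bar>T j g x - g x\<bar> \<partial>M)"
      using i2 int g sq by (intro integral_mono) auto
    also have "\<dots> = 2 * real N * (\<integral>x. \<bar>T j g x - g x\<bar> \<partial>M)" by simp
    finally have "(\<integral>x. (T j f x - f x)\<^sup>2 \<partial>M) \<le> 6 * (\<integral>x. (r x)\<^sup>2 \<partial>M) + 3 * (2 * real N * (\<integral>x. \<bar>T j g x - g x\<bar> \<partial>M))"
      using T_L2(2)[OF r, of j] by simp
    also have "\<dots> < e" using N J[OF that] by (simp add: r_def g_def)
    finally show ?thesis by simp
  qed
  then show "\<exists>no. \<forall>n\<ge>no. norm ((\<integral>x. (T n f x - f x)\<^sup>2 \<partial>M) - 0) < e" by blast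
qed

end

section \<open>Mollification\<close>

context averaging
begin

lemma conv1_incseq:
  assumes B: "\<And>m::nat. B m \<in> sets M" "incseq B" and fin: "emeasure M (\<Union>m. B m) < \<infinity>"
    and conv: "\<And>m. conv1 (indicator (B m))"
  shows "conv1 (indicator (\<Union>m. B m))"
proof (rule conv1_closure)
  have U: "(\<Union>m. B m) \<in> sets M" using B by auto
  then show "integrable M (indicat_real (\<Union>m. B m))" using fin by (simp add: integrable_indicator_iff)
  fix \<delta> :: real assume "\<delta> > 0"
  have finB: "emeasure M (B m) < \<infinity>" for m
    by (rule le_less_trans[OF emeasure_mono[OF _ U] fin]) auto
  have "(\<lambda>m. measure M (B m)) \<longlonglongrightarrow> measure M (\<Union>m. B m)"
    using B fin by (intro Lim_measure_incseq) auto
  from LIMSEQ_D[OF this \<open>\<delta> > 0\<close>] obtain m where m: "\<bar>measure M (B m) - measure M (\<Union>m. B m)\<bar> < \<delta>" by auto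
  have "(\<integral>x. \<bar>indicat_real (\<Union>m. B m) x - indicat_real (B m) x\<bar> \<partial>M)
      = (\<integral>x. indicat_real (\<Union>m. B m) x - indicat_real (B m) x \<partial>M)"
    by (intro Bochner_Integration.integral_cong) (auto simp: indicator_def)
  also have "\<dots> = measure M (\<Union>m. B m) - measure M (B m)"
    using U B finB fin by (subst Bochner_Integration.integral_diff) (auto simp: integrable_indicator_iff Int_absorb2 sets.sets_into_space)
  also have "\<dots> < \<delta>" using m by simp
  finally show "\<exists>g. integrable M g \<and> conv1 g \<and> (\<integral>x. \<bar>indicat_real (\<Union>m. B m) x - g x\<bar> \<partial>M) < \<delta>"
    using conv B finB by (intro exI[of _ "indicat_real (B m)"]) (auto simp: integrable_indicator_iff)
qed

end

text \<open>The kernel is supported in \<open>[0, e]\<close> rather than centred: one-sided averages of the indicator of a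
  half-open interval \<open>(c, d]\<close> converge at every point, including the endpoints.\<close>

definition ker :: "real \<Rightarrow> nat \<Rightarrow> real \<Rightarrow> real" where
  "ker e k t = smooth_step (Suc k) (t / e) / e ^ Suc k"

lemma ker_deriv: "e > 0 \<Longrightarrow> (ker e k has_real_derivative ker e (Suc k) t) (at t)"
  unfolding ker_def by (auto intro!: derivative_eq_intros DERIV_chain2[OF smooth_step_deriv] simp: field_simps)

lemma ker_eq_0: "e > 0 \<Longrightarrow> t \<le> 0 \<or> e \<le> t \<Longrightarrow> ker e k t = 0"
  by (auto simp: ker_def divide_nonpos_pos smooth_step_le_0 smooth_step_Suc_ge_1)

lemma ker_nonneg: "e > 0 \<Longrightarrow> ker e 0 t \<ge> 0"
  by (simp add: ker_def smooth_step_mono)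

lemma ker_continuous: "continuous_on A (ker e k)"
  unfolding ker_def divide_inverse by (intro continuous_intros continuous_on_compose2[OF continuous_on_smooth_step]) auto

lemma ker_measurable [measurable]: "ker e k \<in> borel_measurable borel"
  using ker_continuous by (rule borel_measurable_continuous_onI)

lemma ker_bounded: "\<exists>C. \<forall>t. \<bar>ker e k t\<bar> \<le> C"
proof -
  from smooth_step_bounded obtain C where "\<forall>x. \<bar>smooth_step (Suc k) x\<bar> \<le> C" by blast
  then have "\<bar>ker e k t\<bar> \<le> C / \<bar>e ^ Suc k\<bar>" for t
    unfolding ker_def abs_divide by (intro divide_right_mono) auto
  then show ?thesis by blast
qed

lemma nn_integral_ker: "e > 0 \<Longrightarrow> (\<integral>\<^sup>+t. ker e 0 t \<partial>lborel) = 1"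
proof -
  assume e: "e > 0"
  have "(\<integral>\<^sup>+t. ker e 0 t \<partial>lborel) = (\<integral>\<^sup>+t. ennreal (ker e 0 t) * indicator {0..e} t \<partial>lborel)"
    using e ker_eq_0[OF e, of _ 0] by (intro nn_integral_cong) (auto simp: indicator_def)
  also have "\<dots> = smooth_step 0 (e / e) - smooth_step 0 (0 / e)"
  proof (rule nn_integral_FTC_Icc)
    show "((\<lambda>t. smooth_step 0 (t / e)) has_real_derivative ker e 0 t) (at t)" for t
    proof -
      have "((\<lambda>t. t / e) has_real_derivative 1 / e) (at t)" using e by (auto intro!: derivative_eq_intros)
      from DERIV_chain2[OF smooth_step_deriv this, of 0] show ?thesis by (simp add: ker_def)
    qed
  qed (use e ker_nonneg in auto)
  also have "\<dots> = 1" using e by (simp add: smooth_step_le_0 smooth_step_ge_1)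
  finally show ?thesis .
qed

lemma nn_integral_ker_shift: "e > 0 \<Longrightarrow> (\<integral>\<^sup>+t. ker e 0 (t - c) \<partial>lborel) = 1" "e > 0 \<Longrightarrow> (\<integral>\<^sup>+t. ker e 0 (c - t) \<partial>lborel) = 1"
  using nn_integral_real_affine[of "\<lambda>t. ennreal (ker e 0 t)" 1 "-c"]
    nn_integral_real_affine[of "\<lambda>t. ennreal (ker e 0 t)" "-1" c]
  by (simp_all add: nn_integral_ker)

text \<open>\<open>d\<close> is the multi-index of derivatives. For \<open>d = 0\<close> this is a
  product probability density, which can be nonzero only where y_i < x_i < y_i + e for all
  i.\<close>

definition pker :: "nat \<Rightarrow> real \<Rightarrow> (nat \<Rightarrow> nat) \<Rightarrow> (nat \<Rightarrow> real) \<Rightarrow> (nat \<Rightarrow> real) \<Rightarrow> real" where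
  "pker n e d x y = (\<Prod>i<n. ker e (d i) (x i - y i))"

lemma pker_measurable [measurable]: "(\<lambda>(x, y). pker n e d x y) \<in> borel_measurable (Leb n \<Otimes>\<^sub>M Leb n)"
  unfolding pker_def by measurable

lemma pker_measurable_section [measurable]: "pker n e d x \<in> borel_measurable (Leb n)"
  unfolding pker_def by measurable

lemma pker_bounded: "\<exists>C. \<forall>x y. \<bar>pker n e d x y\<bar> \<le> C"
proof -
  from ker_bounded obtain C where C: "\<And>k t. \<bar>ker e k t\<bar> \<le> C k" by metis
  have "\<bar>pker n e d x y\<bar> \<le> (\<Prod>i<n. C (d i))" for x y
    unfolding pker_def abs_prod by (intro prod_mono) (use C in auto)
  then show ?thesis by blast
qed

lemma pker_nonneg: "e > 0 \<Longrightarrow> pker n e (\<lambda>_. 0) x y \<ge> 0"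
  unfolding pker_def by (intro prod_nonneg) (simp add: ker_nonneg)

lemma pker_eq_0: "e > 0 \<Longrightarrow> i < n \<Longrightarrow> x i \<le> y i \<or> y i + e \<le> x i \<Longrightarrow> pker n e d x y = 0"
  unfolding pker_def by (rule prod_zero) (auto intro!: bexI[of _ i] ker_eq_0)

definition dirs :: "(nat \<Rightarrow> nat) \<Rightarrow> nat \<Rightarrow> nat \<Rightarrow> nat" where
  "dirs d i = d(i := Suc (d i))"

lemma pker_split: "i < n \<Longrightarrow> pker n e d x y = ker e (d i) (x i - y i) * (\<Prod>j\<in>{..<n} - {i}. ker e (d j) (x j - y j))"
  unfolding pker_def by (subst prod.remove[of _ i]) auto

lemma pker_deriv:
  assumes "e > 0" "i < n"
  shows "((\<lambda>t. pker n e d (x(i := t)) y) has_real_derivative pker n e (dirs d i) (x(i := s)) y) (at s)"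
proof -
  have "((\<lambda>t. ker e (d i) (t - y i) * (\<Prod>j\<in>{..<n} - {i}. ker e (d j) (x j - y j))) has_real_derivative
     ker e (Suc (d i)) (s - y i) * (\<Prod>j\<in>{..<n} - {i}. ker e (d j) (x j - y j))) (at s)"
    using assms by (auto intro!: derivative_eq_intros DERIV_chain2[OF ker_deriv])
  then show ?thesis using assms by (simp add: pker_split dirs_def)
qed

lemma pker_deriv2:
  assumes "e > 0" "i < n"
  shows "((\<lambda>t. pker n e d x (y(i := t))) has_real_derivative - pker n e (dirs d i) x (y(i := s))) (at s)"
proof -
  have "((\<lambda>t. ker e (d i) (x i - t) * (\<Prod>j\<in>{..<n} - {i}. ker e (d j) (x j - y j))) has_real_derivative
     - ker e (Suc (d i)) (x i - s) * (\<Prod>j\<in>{..<n} - {i}. ker e (d j) (x j - y j))) (at s)"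
    using assms by (auto intro!: derivative_eq_intros DERIV_chain2[OF ker_deriv])
  then show ?thesis using assms by (simp add: pker_split dirs_def)
qed

lemma nn_integral_pker:
  assumes "e > 0"
  shows "(\<integral>\<^sup>+x. pker n e (\<lambda>_. 0) x y \<partial>Leb n) = 1" "(\<integral>\<^sup>+y. pker n e (\<lambda>_. 0) x y \<partial>Leb n) = 1"
proof -
  have "(\<integral>\<^sup>+x. pker n e (\<lambda>_. 0) x y \<partial>Leb n) = (\<integral>\<^sup>+x. (\<Prod>i<n. ennreal (ker e 0 (x i - y i))) \<partial>Leb n)"
    unfolding pker_def using assms by (simp add: prod_ennreal ker_nonneg)
  also have "\<dots> = (\<Prod>i<n. \<integral>\<^sup>+t. ennreal (ker e 0 (t - y i)) \<partial>lborel)"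
    by (rule lborel_product.product_nn_integral_prod) auto
  finally show "(\<integral>\<^sup>+x. pker n e (\<lambda>_. 0) x y \<partial>Leb n) = 1" using assms by (simp add: nn_integral_ker_shift)
  have "(\<integral>\<^sup>+y. pker n e (\<lambda>_. 0) x y \<partial>Leb n) = (\<integral>\<^sup>+y. (\<Prod>i<n. ennreal (ker e 0 (x i - y i))) \<partial>Leb n)"
    unfolding pker_def using assms by (simp add: prod_ennreal ker_nonneg)
  also have "\<dots> = (\<Prod>i<n. \<integral>\<^sup>+t. ennreal (ker e 0 (x i - t)) \<partial>lborel)"
    by (rule lborel_product.product_nn_integral_prod) auto
  finally show "(\<integral>\<^sup>+y. pker n e (\<lambda>_. 0) x y \<partial>Leb n) = 1" using assms by (simp add: nn_integral_ker_shift)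
qed

definition eps :: "nat \<Rightarrow> real" where "eps j = 1 / (real j + 1)"

lemma eps_pos [simp]: "eps j > 0" and eps_le_1: "eps j \<le> 1"
  by (auto simp: eps_def field_simps)

lemma eventually_eps_less: "\<delta> > 0 \<Longrightarrow> eventually (\<lambda>j. eps j < \<delta>) sequentially"
proof -
  assume "\<delta> > 0"
  have "eps \<longlonglongrightarrow> 0" unfolding eps_def using LIMSEQ_inverse_real_of_nat by (simp add: inverse_eq_divide add.commute)
  from order_tendstoD(2)[OF this \<open>\<delta> > 0\<close>] show ?thesis .
qed

locale mollifier =
  fixes n :: nat

sublocale mollifier \<subseteq> averaging "Leb n" "\<lambda>j x y. pker n (eps j) (\<lambda>_. 0) x y"
  "\<lambda>j. SOME C. \<forall>x y. \<bar>pker n (eps j) (\<lambda>_. 0) x y\<bar> \<le> C"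
proof -
  interpret sigma_finite_measure "Leb n" by (rule lborel_product.sigma_finite) simp
  show "averaging (Leb n) (\<lambda>j x y. pker n (eps j) (\<lambda>_. 0) x y) (\<lambda>j. SOME C. \<forall>x y. \<bar>pker n (eps j) (\<lambda>_. 0) x y\<bar> \<le> C)"
  proof
    show "pker n (eps j) (\<lambda>_. 0) x y \<le> (SOME C. \<forall>x y. \<bar>pker n (eps j) (\<lambda>_. 0) x y\<bar> \<le> C)" for j x y
      using someI_ex[OF pker_bounded[of n "eps j" "\<lambda>_. 0"]] by (meson abs_le_D1)
  qed (auto simp: pker_nonneg nn_integral_pker)
qed

context mollifier
begin

definition hbox :: "(nat \<Rightarrow> real) \<Rightarrow> (nat \<Rightarrow> real) \<Rightarrow> (nat \<Rightarrow> real) set" where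
  "hbox c d = Pi\<^sub>E {..<n} (\<lambda>i. {c i<..d i})"

lemma hbox_sets [measurable]: "hbox c d \<in> sets (Leb n)"
  unfolding hbox_def by (intro sets_PiM_I_finite) auto

lemma hbox_finite: "emeasure (Leb n) (hbox c d) < \<infinity>"
proof -
  have "emeasure lborel {a<..b} \<noteq> top" for a b :: real by (cases "a \<le> b") auto
  then show ?thesis unfolding hbox_def
    by (subst lborel_product.emeasure_PiM) (simp_all add: ennreal_prod_eq_top less_top[symmetric])
qed

lemma in_hbox_iff: "x \<in> space (Leb n) \<Longrightarrow> x \<in> hbox c d \<longleftrightarrow> (\<forall>i<n. c i < x i \<and> x i \<le> d i)"
  by (auto simp: hbox_def space_PiM PiE_iff)

lemma conv1_hbox: "conv1 (indicator (hbox c d))"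
proof -
  let ?f = "indicator (hbox c d) :: _ \<Rightarrow> real"
  have int: "integrable (Leb n) ?f" using hbox_finite by (simp add: integrable_indicator_iff)
  have T01: "0 \<le> T j ?f x \<and> T j ?f x \<le> 1" if "x \<in> space (Leb n)" for j x
  proof
    show "0 \<le> T j ?f x" unfolding T_def by (simp add: k_nonneg)
    have "T j ?f x \<le> (\<integral>y. pker n (eps j) (\<lambda>_. 0) x y \<partial>Leb n)"
      unfolding T_def using integrable_mult_k[OF int that, of j] integrable_k[OF that, of j]
      by (intro integral_mono) (auto simp: indicator_def k_nonneg)
    then show "T j ?f x \<le> 1" using integral_k[OF that] by simp
  qed
  have all: "T j ?f x = 1" if x: "x \<in> space (Leb n)"
    and "\<And>y. y \<in> space (Leb n) \<Longrightarrow> pker n (eps j) (\<lambda>_. 0) x y \<noteq> 0 \<Longrightarrow> y \<in> hbox c d" for x j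
  proof -
    have "T j ?f x = (\<integral>y. pker n (eps j) (\<lambda>_. 0) x y \<partial>Leb n)"
      unfolding T_def using that(2) by (intro Bochner_Integration.integral_cong) (auto simp: indicator_def)
    then show ?thesis using integral_k[OF x] by simp
  qed
  have none: "T j ?f x = 0" if x: "x \<in> space (Leb n)"
    and "\<And>y. y \<in> hbox c d \<Longrightarrow> pker n (eps j) (\<lambda>_. 0) x y = 0" for x j
  proof -
    have "T j ?f x = (\<integral>y. 0 \<partial>Leb n)"
      unfolding T_def using that(2) by (intro Bochner_Integration.integral_cong) (auto simp: indicator_def)
    then show ?thesis by simp
  qed
  have hb: "c i < y i" "y i \<le> d i" if "y \<in> hbox c d" "i < n" for y i
    using that by (auto simp: hbox_def PiE_iff)
  have near: "y i < x i \<and> x i < y i + eps j" if "pker n (eps j) (\<lambda>_. 0) x y \<noteq> 0" "i < n" for x y i j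
    using pker_eq_0[of "eps j" i n x y] that by force
  have pointwise: "eventually (\<lambda>j. T j ?f x = ?f x) sequentially" if x: "x \<in> space (Leb n)" for x
  proof (cases "x \<in> hbox c d")
    case True
    have "eventually (\<lambda>j. \<forall>i\<in>{..<n}. eps j < x i - c i) sequentially"
      using True hb by (intro eventually_ball_finite ballI eventually_eps_less) auto
    then show ?thesis
    proof (rule eventually_mono)
      fix j assume j: "\<forall>i\<in>{..<n}. eps j < x i - c i"
      have "T j ?f x = 1"
      proof (rule all[OF x])
        fix y assume y: "y \<in> space (Leb n)" "pker n (eps j) (\<lambda>_. 0) x y \<noteq> 0"
        show "y \<in> hbox c d" unfolding in_hbox_iff[OF y(1)]
          using near[OF y(2)] j hb[OF True] by (force simp: algebra_simps)
      qed
      then show "T j ?f x = ?f x" using True by simp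
    qed
  next
    case False
    then obtain i where i: "i < n" "x i \<le> c i \<or> d i < x i" using in_hbox_iff[OF x] by (auto simp: not_less not_le)
    have "eventually (\<lambda>j. T j ?f x = 0) sequentially"
    proof (cases "x i \<le> c i")
      case True
      then show ?thesis using hb[of _ i] i by (intro always_eventually allI none[OF x] pker_eq_0[of _ i]) force+
    next
      case False
      then have "d i < x i" using i by auto
      then have "eventually (\<lambda>j. eps j < x i - d i) sequentially" by (intro eventually_eps_less) auto
      then show ?thesis
        by (rule eventually_mono) (use hb[of _ i] i in \<open>force intro!: none[OF x] pker_eq_0[of _ i]\<close>)
    qed
    then show ?thesis using False by simp
  qed
  \<comment> \<open>The averages spread the box upwards only, and by at most 1 because
    \<open>eps j\<close> never exceeds 1: one dominating set for all \<open>j\<close>.\<close>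
  define B where "B = hbox c (\<lambda>i. d i + 1)"
  have supp: "\<bar>T j ?f x - ?f x\<bar> \<le> indicator B x" if x: "x \<in> space (Leb n)" for j x
  proof (cases "x \<in> B")
    case True
    then show ?thesis using T01[OF x, of j] by (simp add: indicator_def)
  next
    case False
    then have "x \<notin> hbox c d" using in_hbox_iff[OF x] by (force simp: B_def)
    moreover obtain i where i: "i < n" "x i \<le> c i \<or> d i + 1 < x i" using False in_hbox_iff[OF x] by (auto simp: B_def not_less not_le)
    have "T j ?f x = 0"
      using hb[of _ i] i eps_le_1[of j] by (intro none[OF x] pker_eq_0[of _ i]) force+
    ultimately show ?thesis using False by simp
  qed
  have "(\<lambda>j. \<integral>x. \<bar>T j ?f x - ?f x\<bar> \<partial>Leb n) \<longlonglongrightarrow> (\<integral>x. 0 \<partial>Leb n)"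
  proof (rule integral_dominated_convergence[where w = "indicator B"])
    show "integrable (Leb n) (indicat_real B)" unfolding B_def using hbox_finite by (simp add: integrable_indicator_iff)
    show "(\<lambda>x. \<bar>T j ?f x - ?f x\<bar>) \<in> borel_measurable (Leb n)" for j
      using T_integrable(1)[OF int, of j, THEN borel_measurable_integrable] by measurable
    show "AE x in Leb n. (\<lambda>j. \<bar>T j ?f x - ?f x\<bar>) \<longlonglongrightarrow> 0"
      by (intro AE_I2 tendsto_eventually eventually_mono[OF pointwise]) auto
    show "AE x in Leb n. norm \<bar>T j ?f x - ?f x\<bar> \<le> indicator B x" for j
      using supp by (intro AE_I2) simp
  qed simp
  then show ?thesis by (simp add: conv1_def)
qed

text \<open>Dynkin's argument for sets cut down to the cube \<open>Q N\<close>: the lower orthants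
  generate, they meet the cube in half-open boxes, and inside the cube complements have finite
  measure. Monotone exhaustion then removes the cube.\<close>

lemma conv1_indicator:
  assumes A: "A \<in> sets (Leb n)" "emeasure (Leb n) A < \<infinity>"
  shows "conv1 (indicator A)"
proof -
  define Q where "Q N = hbox (\<lambda>_. - real N) (\<lambda>_. real N)" for N
  \<comment> \<open>The lower orthants, in the shape that \<open>sets_PiM_sigma\<close>
    produces.\<close>
  define P where "P = {{f\<in>(\<Pi>\<^sub>E i\<in>{..<n}. (UNIV::real set)). \<forall>i\<in>j. f i \<in> F i} | F j. j \<in> {{..<n}} \<and> F \<in> Pi j (\<lambda>_. range (\<lambda>a. {..a}))}"
  have Ps: "P \<subseteq> Pow (\<Pi>\<^sub>E i\<in>{..<n}. UNIV)" by (auto simp: P_def)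
  have "sets (Leb n) = sets (\<Pi>\<^sub>M i\<in>{..<n}. sigma (UNIV::real set) (range (\<lambda>a. {..a})))"
    by (intro sets_PiM_cong) (auto simp: borel_eq_atMost[symmetric])
  also have "\<dots> = sets (sigma (\<Pi>\<^sub>E i\<in>{..<n}. UNIV) P)"
    unfolding P_def
  proof (rule sets_PiM_sigma)
    have "(UNIV::real set) = (\<Union>k::nat. {..real k})" using real_arch_simple by auto
    then show "\<exists>S\<subseteq>range (\<lambda>a. {..a}). countable S \<and> (UNIV::real set) = \<Union>S"
      by (intro exI[of _ "range (\<lambda>k::nat. {..real k})"]) auto
  qed auto
  also have "\<dots> = sigma_sets (\<Pi>\<^sub>E i\<in>{..<n}. UNIV) P" using Ps by simp
  finally have gen: "sets (Leb n) = sigma_sets (\<Pi>\<^sub>E i\<in>{..<n}. UNIV) P" .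
  have Pbox: "\<exists>a. B = {f\<in>(\<Pi>\<^sub>E i\<in>{..<n}. UNIV). \<forall>i<n. f i \<le> a i}" if "B \<in> P" for B
  proof -
    from that obtain F where F: "B = {f\<in>(\<Pi>\<^sub>E i\<in>{..<n}. (UNIV::real set)). \<forall>i<n. f i \<in> F i}" "\<And>i. i < n \<Longrightarrow> \<exists>a. F i = {..a}"
      by (auto simp: P_def Pi_iff image_iff)
    then obtain a where "\<And>i. i < n \<Longrightarrow> F i = {..a i}" by metis
    with F(1) show ?thesis by (intro exI[of _ a]) auto
  qed
  have Int: "Int_stable P"
  proof (rule Int_stableI)
    fix B C assume "B \<in> P" "C \<in> P"
    from Pbox[OF this(1)] Pbox[OF this(2)] obtain a b where
      ab: "B = {f\<in>(\<Pi>\<^sub>E i\<in>{..<n}. UNIV). \<forall>i<n. f i \<le> a i}" "C = {f\<in>(\<Pi>\<^sub>E i\<in>{..<n}. UNIV). \<forall>i<n. f i \<le> b i}"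
      by blast
    have "B \<inter> C = {f\<in>(\<Pi>\<^sub>E i\<in>{..<n}. UNIV). \<forall>i\<in>{..<n}. f i \<in> {..min (a i) (b i)}}"
      unfolding ab by auto
    moreover have "(\<lambda>i. {..min (a i) (b i)}) \<in> Pi {..<n} (\<lambda>_. range (\<lambda>a. {..a}))" by simp
    ultimately show "B \<inter> C \<in> P"
      unfolding P_def mem_Collect_eq
      by (intro exI[of _ "\<lambda>i. {..min (a i) (b i)}"] exI[of _ "{..<n}"] conjI) (assumption | rule singletonI)+
  qed
  have Qint: "integrable (Leb n) (indicat_real (B \<inter> Q N))" if "B \<in> sets (Leb n)" for B N
  proof -
    have "emeasure (Leb n) (B \<inter> Q N) < \<infinity>"
      using hbox_finite unfolding Q_def by (rule le_less_trans[OF emeasure_mono, rotated 2]) auto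
    with that show ?thesis by (simp add: integrable_indicator_iff Q_def)
  qed
  have main: "conv1 (indicator (B \<inter> Q N))" if "B \<in> sets (Leb n)" for B N
    using Int Ps that[unfolded gen]
  proof (induction rule: sigma_sets_induct_disjoint)
    case (basic B)
    from Pbox[OF this] obtain a where a: "B = {f\<in>(\<Pi>\<^sub>E i\<in>{..<n}. UNIV). \<forall>i<n. f i \<le> a i}" ..
    have "B \<inter> Q N = hbox (\<lambda>_. - real N) (\<lambda>i. min (a i) (real N))"
      unfolding a Q_def hbox_def set_eq_iff Int_iff mem_Collect_eq PiE_iff greaterThanAtMost_iff min.bounded_iff lessThan_iff Ball_def
      by blast
    then show ?case using conv1_hbox by simp
  next
    case empty
    then show ?case by (simp add: conv1_def T_def)
  next
    case (compl B)
    then have B: "B \<in> sets (Leb n)" by (simp add: gen)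
    have "conv1 (\<lambda>x. indicator (Q N) x + (-1) * indicator (B \<inter> Q N) x)"
      using Qint[OF sets.top, of N] Qint[OF B, of N] compl sets.sets_into_space[OF hbox_sets] conv1_hbox
      by (intro conv1_add conv1_cmult) (auto simp: Q_def Int_absorb1)
    moreover have "(\<lambda>x. indicator (Q N) x + (-1) * indicator (B \<inter> Q N) x) = (indicator (((\<Pi>\<^sub>E i\<in>{..<n}. UNIV) - B) \<inter> Q N) :: _ \<Rightarrow> real)"
      by (auto simp: indicator_def Q_def hbox_def PiE_iff fun_eq_iff)
    ultimately show ?case by simp
  next
    case (union B)
    then have B: "B i \<in> sets (Leb n)" for i by (auto simp: gen)
    have "conv1 (indicator (\<Union>m. (\<Union>i<m. B i) \<inter> Q N))"
    proof (rule conv1_incseq)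
      show "(\<Union>i<m. B i) \<inter> Q N \<in> sets (Leb n)" for m using B by (auto simp: Q_def)
      show "incseq (\<lambda>m. (\<Union>i<m. B i) \<inter> Q N)" by (auto simp: incseq_def) (meson lessThan_iff less_le_trans)
      have "emeasure (Leb n) (\<Union>m. (\<Union>i<m. B i) \<inter> Q N) \<le> emeasure (Leb n) (Q N)"
        by (intro emeasure_mono) (auto simp: Q_def)
      also have "\<dots> < \<infinity>" unfolding Q_def by (rule hbox_finite)
      finally show "emeasure (Leb n) (\<Union>m. (\<Union>i<m. B i) \<inter> Q N) < \<infinity>" .
      show "conv1 (indicator ((\<Union>i<m. B i) \<inter> Q N))" for m
      proof (induction m)
        case 0
        then show ?case by (simp add: conv1_def T_def)
      next
        case (Suc m)
        have "conv1 (\<lambda>x. indicator ((\<Union>i<m. B i) \<inter> Q N) x + indicator (B m \<inter> Q N) x)"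
          using Suc union B by (intro conv1_add Qint) auto
        moreover have "(\<lambda>x. indicator ((\<Union>i<m. B i) \<inter> Q N) x + indicator (B m \<inter> Q N) x)
            = (indicator ((\<Union>i<Suc m. B i) \<inter> Q N) :: _ \<Rightarrow> real)"
        proof
          fix x
          have "B i \<inter> B m = {}" if "i < m" for i using union(1) that by (auto simp: disjoint_family_on_def)
          then show "indicator ((\<Union>i<m. B i) \<inter> Q N) x + indicator (B m \<inter> Q N) x = (indicator ((\<Union>i<Suc m. B i) \<inter> Q N) x :: real)"
            by (auto simp: indicator_def less_Suc_eq)
        qed
        ultimately show ?case by simp
      qed
    qed
    moreover have "(\<Union>m. (\<Union>i<m. B i) \<inter> Q N) = (\<Union>i. B i) \<inter> Q N" by auto
    ultimately show ?case by simp
  qed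
  have "conv1 (indicator (\<Union>N. A \<inter> Q N))"
  proof (rule conv1_incseq)
    show "A \<inter> Q N \<in> sets (Leb n)" for N using A by (auto simp: Q_def)
    show "incseq (\<lambda>N. A \<inter> Q N)"
    proof -
      have "Q N \<subseteq> Q M" if "N \<le> M" for N M
        using that unfolding Q_def hbox_def by (intro PiE_mono) auto
      then show ?thesis unfolding incseq_def by blast
    qed
    show "emeasure (Leb n) (\<Union>N. A \<inter> Q N) < \<infinity>"
      by (rule le_less_trans[OF emeasure_mono[OF _ A(1)] A(2)]) auto
    show "conv1 (indicator (A \<inter> Q N))" for N using main A by auto
  qed
  moreover have "(\<Union>N. A \<inter> Q N) = A"
  proof (intro equalityI subsetI)
    fix x assume x: "x \<in> A"
    then have sp: "x \<in> space (Leb n)" using sets.sets_into_space A by blast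
    obtain N where N: "1 + (\<Sum>i<n. \<bar>x i\<bar>) \<le> real N" using real_arch_simple by blast
    have "\<bar>x i\<bar> < real N" if "i < n" for i
      using member_le_sum[of i "{..<n}" "\<lambda>i. \<bar>x i\<bar>"] that N by auto
    then have "x \<in> Q N" unfolding Q_def in_hbox_iff[OF sp] by (force simp: abs_less_iff)
    with x show "x \<in> (\<Union>N. A \<inter> Q N)" by auto
  qed auto
  ultimately show ?thesis by simp
qed

lemmas mollifier_L2_convergence = L2_convergence[OF conv1_indicator]

end

section \<open>Passage to weak solutions\<close>

text \<open>By the mean value theorem every difference quotient of the kernel is bounded by
  \<open>C\<close>, so \<open>C * \<bar>u y\<bar>\<close> dominates.\<close>

lemma has_derivative_integral_kernel:
  fixes u :: "'a \<Rightarrow> real" and k k' :: "real \<Rightarrow> 'a \<Rightarrow> real"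
  assumes u: "integrable M u"
    and d: "\<And>t y. ((\<lambda>t. k t y) has_real_derivative k' t y) (at t)"
    and k: "\<And>t. k t \<in> borel_measurable M" "\<And>t y. \<bar>k t y\<bar> \<le> B"
    and k': "\<And>t. k' t \<in> borel_measurable M" "\<And>t y. \<bar>k' t y\<bar> \<le> C"
  shows "((\<lambda>t. \<integral>y. u y * k t y \<partial>M) has_real_derivative (\<integral>y. u y * k' t y \<partial>M)) (at t)"
  unfolding DERIV_def tendsto_at_iff_sequentially comp_def
proof (intro allI impI)
  note [measurable] = borel_measurable_integrable[OF u] k(1) k'(1)
  fix h :: "nat \<Rightarrow> real" assume h: "\<forall>i. h i \<in> UNIV - {0}" "h \<longlonglongrightarrow> 0"
  have int: "integrable M (\<lambda>y. u y * k t y)" for t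
    by (rule Bochner_Integration.integrable_bound[OF integrable_mult_left[OF u, of B]])
       (auto intro!: AE_I2 mult_left_mono order_trans[OF k(2) abs_ge_self] simp: abs_mult)
  have eq: "((\<integral>y. u y * k (t + h i) y \<partial>M) - (\<integral>y. u y * k t y \<partial>M)) / h i
      = (\<integral>y. u y * ((k (t + h i) y - k t y) / h i) \<partial>M)" for i
    using int by (subst Bochner_Integration.integral_diff[symmetric]) (auto simp: right_diff_distrib[symmetric])
  have "(\<lambda>i. \<integral>y. u y * ((k (t + h i) y - k t y) / h i) \<partial>M) \<longlonglongrightarrow> (\<integral>y. u y * k' t y \<partial>M)"
  proof (rule integral_dominated_convergence[where w = "\<lambda>y. C * \<bar>u y\<bar>"])
    show "AE y in M. (\<lambda>i. u y * ((k (t + h i) y - k t y) / h i)) \<longlonglongrightarrow> u y * k' t y"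
    proof (rule AE_I2)
      fix y
      have "(\<lambda>i. (k (t + h i) y - k t y) / h i) \<longlonglongrightarrow> k' t y"
        using d[of y t, unfolded DERIV_def tendsto_at_iff_sequentially comp_def] h by blast
      then show "(\<lambda>i. u y * ((k (t + h i) y - k t y) / h i)) \<longlonglongrightarrow> u y * k' t y"
        by (intro tendsto_mult tendsto_const)
    qed
    show "AE y in M. norm (u y * ((k (t + h i) y - k t y) / h i)) \<le> C * \<bar>u y\<bar>" for i
    proof (rule AE_I2)
      fix y
      have "norm (k (t + h i) y - k t y) \<le> C * norm (t + h i - t)"
        by (rule field_differentiable_bound[of UNIV "\<lambda>t. k t y" "\<lambda>t. k' t y"]) (use d k'(2) in auto)
      then have "\<bar>(k (t + h i) y - k t y) / h i\<bar> \<le> C"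
        using h(1) by (simp add: field_simps)
      then have "\<bar>u y\<bar> * \<bar>(k (t + h i) y - k t y) / h i\<bar> \<le> \<bar>u y\<bar> * C" by (rule mult_left_mono) simp
      then show "norm (u y * ((k (t + h i) y - k t y) / h i)) \<le> C * \<bar>u y\<bar>"
        by (simp add: abs_mult mult.commute)
    qed
  qed (use u in auto)
  then show "(\<lambda>i. ((\<integral>y. u y * k (t + h i) y \<partial>M) - (\<integral>y. u y * k t y \<partial>M)) / h i) \<longlonglongrightarrow> (\<integral>y. u y * k' t y \<partial>M)"
    by (simp only: eq)
qed

section \<open>Mollified functions and their derivatives\<close>

definition mollify :: "nat \<Rightarrow> real \<Rightarrow> (nat \<Rightarrow> nat) \<Rightarrow> ((nat \<Rightarrow> real) \<Rightarrow> real) \<Rightarrow> (nat \<Rightarrow> real) \<Rightarrow> real" where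
  "mollify n e d u x = (\<integral>y. u y * pker n e d x y \<partial>Leb n)"

lemma (in mollifier) T_eq_mol: "T j u = mollify n (eps j) (\<lambda>_. 0) u"
  by (simp add: T_def mollify_def fun_eq_iff)

lemma mollify_deriv:
  assumes "integrable (Leb n) u" "e > 0" "i < n"
  shows "((\<lambda>t. mollify n e d u (x(i := t))) has_real_derivative mollify n e (dirs d i) u x) (at (x i))"
proof -
  obtain B where B: "\<And>x y. \<bar>pker n e d x y\<bar> \<le> B" using pker_bounded by metis
  obtain C where C: "\<And>x y. \<bar>pker n e (dirs d i) x y\<bar> \<le> C" using pker_bounded by metis
  have "((\<lambda>t. mollify n e d u (x(i := t))) has_real_derivative
      (\<integral>y. u y * pker n e (dirs d i) (x(i := x i)) y \<partial>Leb n)) (at (x i))"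
    unfolding mollify_def using assms B C
    by (intro has_derivative_integral_kernel[where B = B and C = C] pker_deriv) auto
  then show ?thesis by (simp add: mollify_def)
qed

lemma mollify_measurable: "u \<in> borel_measurable (Leb n) \<Longrightarrow> mollify n e d u \<in> borel_measurable (Leb n)"
proof -
  interpret sigma_finite_measure "Leb n" by (rule lborel_product.sigma_finite) simp
  assume u: "u \<in> borel_measurable (Leb n)"
  have "(\<lambda>(x, y). u y * pker n e d x y) \<in> borel_measurable (Leb n \<Otimes>\<^sub>M Leb n)"
    using borel_measurable_times[OF measurable_compose[OF measurable_snd u] pker_measurable[unfolded split_beta']]
    by (simp only: split_beta')
  from borel_measurable_lebesgue_integral[OF this] show "mollify n e d u \<in> borel_measurable (Leb n)"
    by (simp only: mollify_def[abs_def])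
qed

lemma integrable_mult_pker:
  assumes "integrable (Leb n) u"
  shows "integrable (Leb n) (\<lambda>y. u y * pker n e d x y)"
proof -
  obtain B where B: "\<And>x y. \<bar>pker n e d x y\<bar> \<le> B" using pker_bounded by metis
  show ?thesis
    by (rule Bochner_Integration.integrable_bound[OF integrable_mult_left[OF assms, of B]])
       (use assms B in \<open>auto intro!: AE_I2 mult_left_mono order_trans[OF B abs_ge_self] simp: abs_mult\<close>)
qed

lemma mollify_bounded:
  assumes "integrable (Leb n) u"
  shows "\<exists>C. \<forall>x. \<bar>mollify n e d u x\<bar> \<le> C"
proof -
  obtain B where B: "\<And>x y. \<bar>pker n e d x y\<bar> \<le> B" using pker_bounded by metis
  have "\<bar>mollify n e d u x\<bar> \<le> (\<integral>y. B * \<bar>u y\<bar> \<partial>Leb n)" for x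
  proof -
    have "\<bar>mollify n e d u x\<bar> \<le> (\<integral>y. \<bar>u y * pker n e d x y\<bar> \<partial>Leb n)"
      unfolding mollify_def by (rule integral_abs_bound)
    also have "\<dots> \<le> (\<integral>y. B * \<bar>u y\<bar> \<partial>Leb n)"
    proof (rule integral_mono)
      show "integrable (Leb n) (\<lambda>y. \<bar>u y * pker n e d x y\<bar>)"
        by (rule integrable_abs[OF integrable_mult_pker[OF assms]])
    qed (use assms B in \<open>auto simp: abs_mult mult.commute[of B] intro!: mult_left_mono\<close>)
    finally show ?thesis .
  qed
  then show ?thesis by blast
qed

lemma dirs_commute: "dirs (dirs d i) j = dirs (dirs d j) i"
  by (auto simp: dirs_def fun_eq_iff)

text \<open>Each derivative with respect to X costs a factor \<open>r\<close>; the Hessian is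
  symmetric because the order of raising the multi-index is irrelevant.\<close>

lemma (in scaled_coordinates) mollify_C2:
  assumes u: "integrable (Leb n) u" and e: "e > 0"
  shows "C2 (mollify n e (\<lambda>_. 0) u) (\<lambda>i x. r * mollify n e (dirs (\<lambda>_. 0) i) u x)
     (\<lambda>i j x. r\<^sup>2 * mollify n e (dirs (dirs (\<lambda>_. 0) i) j) u x)"
proof -
  have tame: "tame (mollify n e d u)" for d
    using mollify_bounded[OF u, of e d] mollify_measurable[OF borel_measurable_integrable[OF u], of e d]
    unfolding tame_def by blast
  have pd: "pd i (mollify n e d u) x (r * mollify n e (dirs d i) u x)" if "i < n" for i d x
    unfolding pd_def using mollify_deriv[OF u e that, of d x] r_pos by simp
  show ?thesis
    unfolding C2_def
  proof (intro conjI allI impI)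
    fix i j x assume "i < n" "j < n"
    then show "pd j (\<lambda>x. r * mollify n e (dirs (\<lambda>_. 0) i) u x) x (r\<^sup>2 * mollify n e (dirs (dirs (\<lambda>_. 0) i) j) u x)"
      by (intro pd_cong[OF pd_mult[OF pd_const pd]]) (auto simp: power2_eq_square)
    show "(\<lambda>x. r\<^sup>2 * mollify n e (dirs (dirs (\<lambda>_. 0) i) j) u x) = (\<lambda>x. r\<^sup>2 * mollify n e (dirs (dirs (\<lambda>_. 0) j) i) u x)"
      by (simp only: dirs_commute[of _ i j])
  qed (auto intro!: tame_intros tame pd)
qed

section \<open>The kernel as a test function of its second variable\<close>

lemma partials_pker:
  assumes "e > 0" "is \<in> lists {..<n}"
  shows "partials is (pker n e (\<lambda>_. 0) x) = (\<lambda>y. (-1) ^ length is * pker n e (foldr (\<lambda>i d. dirs d i) is (\<lambda>_. 0)) x y)"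
  using assms(2)
proof (induction "is")
  case (Cons i "is")
  then have i: "i < n" and IH: "partials is (pker n e (\<lambda>_. 0) x) = (\<lambda>y. (-1) ^ length is * pker n e (foldr (\<lambda>i d. dirs d i) is (\<lambda>_. 0)) x y)"
    by auto
  have "deriv (\<lambda>t. (-1) ^ length is * pker n e d x (y(i := t))) (y i) = (-1) ^ length is * (- pker n e (dirs d i) x y)" for d y
    using pker_deriv2[OF assms(1) i, of d x y "y i"] by (intro DERIV_imp_deriv DERIV_cmult) simp
  then show ?case by (simp add: IH fun_eq_iff)
qed simp

lemma pker_continuous: "continuous_map (Rn_top n) euclideanreal (pker n e d x)"
  unfolding pker_def Rn_top_def
proof (rule continuous_map_prod)
  fix i assume i: "i \<in> {..<n}"
  have "continuous_map (product_topology (\<lambda>_. euclideanreal) {..<n}) euclideanreal ((\<lambda>t. ker e (d i) (x i - t)) \<circ> (\<lambda>y. y i))"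
  proof (rule continuous_map_compose)
    show "continuous_map (product_topology (\<lambda>_. euclideanreal) {..<n}) euclideanreal (\<lambda>y. y i)"
      using i by (rule continuous_map_product_projection)
    show "continuous_map euclideanreal euclideanreal (\<lambda>t. ker e (d i) (x i - t))"
      by (auto intro!: continuous_on_compose2[OF ker_continuous[of UNIV]] continuous_intros)
  qed
  then show "continuous_map (product_topology (\<lambda>_. euclideanreal) {..<n}) euclideanreal (\<lambda>y. ker e (d i) (x i - y i))"
    by (simp add: comp_def)
qed simp

text \<open>The one-sided support makes the relevant compact set the box of side \<open>e\<close>
  with upper corner \<open>x\<close>. Testing a weak derivative with this kernel evaluates the
  mollified derivative at \<open>x\<close>.\<close>

lemma pker_test_function:
  assumes e: "e > 0" and sub: "Pi\<^sub>E {..<n} (\<lambda>i. {x i - e..x i}) \<subseteq> \<Omega>"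
  shows "pker n e (\<lambda>_. 0) x \<in> test_functions n \<Omega>"
proof -
  let ?K = "Pi\<^sub>E {..<n} (\<lambda>i. {x i - e..x i})"
  have "smooth n (pker n e (\<lambda>_. 0) x)"
    unfolding smooth_def
  proof (intro ballI conjI allI impI)
    fix "is" assume "is": "is \<in> lists {..<n}"
    show "continuous_map (Rn_top n) euclideanreal (partials is (pker n e (\<lambda>_. 0) x))"
      unfolding partials_pker[OF e "is"] by (intro continuous_map_real_mult_left pker_continuous)
    fix i y assume i: "i < n"
    show "(\<lambda>t. partials is (pker n e (\<lambda>_. 0) x) (y(i := t))) differentiable at (y i)"
      unfolding partials_pker[OF e "is"]
      unfolding real_differentiable_def using DERIV_cmult[OF pker_deriv2[OF e i]] by blast
  qed
  moreover have "compactin (Rn_top n) ?K"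
    unfolding Rn_top_def compactin_PiE by auto
  moreover have "\<forall>y\<in>Rn n - ?K. pker n e (\<lambda>_. 0) x y = 0"
  proof
    fix y assume "y \<in> Rn n - ?K"
    then obtain i where "i < n" "y i < x i - e \<or> x i < y i"
      by (auto simp: Rn_def PiE_iff not_le)
    then show "pker n e (\<lambda>_. 0) x y = 0" using e by (intro pker_eq_0[of e i]) auto
  qed
  ultimately show ?thesis unfolding test_functions_def using sub by blast
qed

text \<open>Write v^2 - u^2 = (v - u)^2 + 2 (v - u) u and split the cross term by Young's inequality
  with a parameter that shrinks with \<open>j\<close>.\<close>

lemma L2_weighted_limit:
  fixes u :: "'a \<Rightarrow> real"
  assumes u: "integrable M (\<lambda>x. (u x)\<^sup>2)" "\<And>j. integrable M (\<lambda>x. (v j x)\<^sup>2)"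
    and [measurable]: "u \<in> borel_measurable M" "\<And>j. v j \<in> borel_measurable M" "w \<in> borel_measurable M"
    and conv: "(\<lambda>j. \<integral>x. (v j x - u x)\<^sup>2 \<partial>M) \<longlonglongrightarrow> 0"
    and w: "\<And>x. \<bar>w x\<bar> \<le> C"
  shows "(\<lambda>j. \<integral>x. (w x * v j x)\<^sup>2 \<partial>M) \<longlonglongrightarrow> (\<integral>x. (w x * u x)\<^sup>2 \<partial>M)"
proof -
  define a where "a j = (\<integral>x. (v j x - u x)\<^sup>2 \<partial>M)" for j
  define A where "A = (\<integral>x. (u x)\<^sup>2 \<partial>M)"
  \<comment> \<open>The reciprocal keeps the parameter positive when \<open>a j = 0\<close>; the
    root gives \<open>a j / \<delta> j \<le> sqrt (a j)\<close>. Both summands tend to 0.\<close>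
  define \<delta> where "\<delta> j = sqrt (a j) + inverse (real (Suc j))" for j
  have a0: "a j \<ge> 0" for j by (simp add: a_def)
  have \<delta>0: "\<delta> j > 0" for j unfolding \<delta>_def using a0[of j] by (simp add: add_nonneg_pos)
  have idiff: "integrable M (\<lambda>x. (v j x - u x)\<^sup>2)" for j
  proof (rule Bochner_Integration.integrable_bound)
    show "integrable M (\<lambda>x. 2 * (v j x)\<^sup>2 + 2 * (u x)\<^sup>2)" using u by auto
    have "(b - c)\<^sup>2 \<le> 2 * b\<^sup>2 + 2 * c\<^sup>2" for b c :: real
      using zero_le_power2[of "b + c"] by (simp add: power2_eq_square algebra_simps)
    then show "AE x in M. norm ((v j x - u x)\<^sup>2) \<le> norm (2 * (v j x)\<^sup>2 + 2 * (u x)\<^sup>2)" by simp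
  qed simp
  have C2: "(w x)\<^sup>2 \<le> C\<^sup>2" for x
    using w[of x] by (intro abs_le_square_iff[THEN iffD1]) auto
  have iw: "integrable M (\<lambda>x. (w x * g x)\<^sup>2)" if "integrable M (\<lambda>x. (g x)\<^sup>2)" "g \<in> borel_measurable M" for g :: "'a \<Rightarrow> real"
  proof (rule Bochner_Integration.integrable_bound)
    show "integrable M (\<lambda>x. C\<^sup>2 * (g x)\<^sup>2)" using that by simp
    show "AE x in M. norm ((w x * g x)\<^sup>2) \<le> norm (C\<^sup>2 * (g x)\<^sup>2)"
      using C2 by (intro AE_I2) (simp add: power_mult_distrib mult_right_mono)
  qed (use that in measurable)
  have bound: "norm ((\<integral>x. (w x * v j x)\<^sup>2 \<partial>M) - (\<integral>x. (w x * u x)\<^sup>2 \<partial>M)) \<le> C\<^sup>2 * (a j + sqrt (a j) + \<delta> j * A)" for j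
  proof -
    have "norm ((\<integral>x. (w x * v j x)\<^sup>2 \<partial>M) - (\<integral>x. (w x * u x)\<^sup>2 \<partial>M)) = norm (\<integral>x. (w x * v j x)\<^sup>2 - (w x * u x)\<^sup>2 \<partial>M)"
      using iw[OF u(1)] iw[OF u(2), of j] by simp
    also have "\<dots> \<le> (\<integral>x. norm ((w x * v j x)\<^sup>2 - (w x * u x)\<^sup>2) \<partial>M)"
      by (rule integral_norm_bound)
    also have "\<dots> \<le> (\<integral>x. C\<^sup>2 * ((v j x - u x)\<^sup>2 + ((v j x - u x)\<^sup>2 / \<delta> j + \<delta> j * (u x)\<^sup>2)) \<partial>M)"
    proof (rule integral_mono)
      fix x
      define d where "d = v j x - u x"
      have "2 * \<bar>d * u x\<bar> \<le> d\<^sup>2 / \<delta> j + \<delta> j * (u x)\<^sup>2"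
      proof -
        have "0 \<le> (\<bar>d\<bar> - \<delta> j * \<bar>u x\<bar>)\<^sup>2 / \<delta> j" using \<delta>0[of j] by simp
        also have "\<dots> = d\<^sup>2 / \<delta> j + \<delta> j * (u x)\<^sup>2 - 2 * \<bar>d * u x\<bar>"
          using \<delta>0[of j] by (simp add: power2_diff abs_mult field_simps power2_eq_square)
        finally show ?thesis by simp
      qed
      moreover have "(v j x)\<^sup>2 - (u x)\<^sup>2 = d\<^sup>2 + 2 * (d * u x)" by (simp add: d_def power2_eq_square algebra_simps)
      ultimately have "\<bar>(v j x)\<^sup>2 - (u x)\<^sup>2\<bar> \<le> d\<^sup>2 + (d\<^sup>2 / \<delta> j + \<delta> j * (u x)\<^sup>2)" using zero_le_power2[of d] by linarith
      then have "(w x)\<^sup>2 * \<bar>(v j x)\<^sup>2 - (u x)\<^sup>2\<bar> \<le> C\<^sup>2 * (d\<^sup>2 + (d\<^sup>2 / \<delta> j + \<delta> j * (u x)\<^sup>2))"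
        using C2[of x] by (intro mult_mono) auto
      moreover have "norm ((w x * v j x)\<^sup>2 - (w x * u x)\<^sup>2) = (w x)\<^sup>2 * \<bar>(v j x)\<^sup>2 - (u x)\<^sup>2\<bar>"
        by (simp add: power_mult_distrib right_diff_distrib[symmetric] abs_mult)
      ultimately show "norm ((w x * v j x)\<^sup>2 - (w x * u x)\<^sup>2) \<le> C\<^sup>2 * ((v j x - u x)\<^sup>2 + ((v j x - u x)\<^sup>2 / \<delta> j + \<delta> j * (u x)\<^sup>2))"
        by (simp add: d_def)
    qed (use iw[OF u(1)] iw[OF u(2), of j] idiff u in auto)
    also have "\<dots> = C\<^sup>2 * (a j + (a j / \<delta> j + \<delta> j * A))" using idiff u by (simp add: a_def A_def)
    also have "\<dots> \<le> C\<^sup>2 * (a j + (sqrt (a j) + \<delta> j * A))"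
    proof -
      have "a j = sqrt (a j) * sqrt (a j)" using a0 by simp
      also have "\<dots> \<le> sqrt (a j) * \<delta> j" using a0 by (intro mult_left_mono) (auto simp: \<delta>_def)
      finally have "a j / \<delta> j \<le> sqrt (a j)" using \<delta>0[of j] by (simp add: field_simps)
      then show ?thesis by (intro mult_left_mono add_left_mono add_right_mono) auto
    qed
    finally show ?thesis by (simp add: add.assoc)
  qed
  have "a \<longlonglongrightarrow> 0" using conv by (simp add: a_def[abs_def])
  then have "(\<lambda>j. sqrt (a j)) \<longlonglongrightarrow> sqrt 0" by (rule tendsto_real_sqrt)
  then have "(\<lambda>j. C\<^sup>2 * (a j + sqrt (a j) + \<delta> j * A)) \<longlonglongrightarrow> C\<^sup>2 * (0 + sqrt 0 + (sqrt 0 + 0) * A)"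
    unfolding \<delta>_def using \<open>a \<longlonglongrightarrow> 0\<close> LIMSEQ_inverse_real_of_nat by (intro tendsto_intros)
  then have "(\<lambda>j. C\<^sup>2 * (a j + sqrt (a j) + \<delta> j * A)) \<longlonglongrightarrow> 0" by simp
  then have "(\<lambda>j. (\<integral>x. (w x * v j x)\<^sup>2 \<partial>M) - (\<integral>x. (w x * u x)\<^sup>2 \<partial>M)) \<longlonglongrightarrow> 0"
    by (rule Lim_null_comparison[OF always_eventually[OF allI[OF bound]]])
  then show ?thesis by (rule LIM_zero_cancel)
qed

abbreviation (in scaled_coordinates) weight :: "real \<Rightarrow> real \<Rightarrow> real" where
  "weight \<tau> \<equiv> \<lambda>s. W \<tau> s * zeta 0 s"

abbreviation (in scaled_coordinates) energy :: "(real \<Rightarrow> real) \<Rightarrow> ((nat \<Rightarrow> real) \<Rightarrow> real) \<Rightarrow> real" where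
  "energy w v \<equiv> \<integral>x. (w (S x) * v x)\<^sup>2 \<partial>Leb n"

text \<open>All that the Carleman argument uses of the weak equation. It is asked only eventually,
  since the support of the kernel has to fit into the domain for every point of the ball S <
  9.\<close>

definition (in scaled_coordinates) mollified_laplace :: "((nat \<Rightarrow> real) \<Rightarrow> real) \<Rightarrow> ((nat \<Rightarrow> real) \<Rightarrow> real) \<Rightarrow> bool" where
  "mollified_laplace u f \<longleftrightarrow> (\<forall>\<^sub>F j in sequentially. \<forall>x\<in>space (Leb n). S x < 9 \<longrightarrow>
     (\<Sum>i<n. mollify n (eps j) (dirs (dirs (\<lambda>_. 0) i) i) u x) = mollify n (eps j) (\<lambda>_. 0) f x)"

text \<open>The right-hand side is itself a mollification, so no commutator with a potential arises,
  and every weight is a bounded function of S, so each energy converges. The factor r^2 is the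
  Laplacian in X against the one in x.\<close>

lemma (in scaled_coordinates) carleman_limit:
  assumes u: "integrable (Leb n) u" "integrable (Leb n) (\<lambda>x. (u x)\<^sup>2)"
    and f: "integrable (Leb n) f" "integrable (Leb n) (\<lambda>x. (f x)\<^sup>2)"
    and eq: "mollified_laplace u f"
    and tau: "\<tau> \<ge> 0"
  shows "\<tau>^3 / 2 * energy (weight \<tau>) u
    \<le> 16 * energy (weight \<tau>) (\<lambda>x. r\<^sup>2 * f x)
      + energy_const * (W \<tau> (1/4))\<^sup>2 * (energy (indicator {1/4..<1}) u + energy (indicator {1/4..<1}) (\<lambda>x. r\<^sup>2 * f x))
      + energy_const * (W \<tau> 6)\<^sup>2 * (energy (indicator {1/4..<9}) u + energy (indicator {1/4..<9}) (\<lambda>x. r\<^sup>2 * f x))"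
proof -
  interpret mollifier n .
  define uj where "uj j = mollify n (eps j) (\<lambda>_. 0) u" for j
  define fj where "fj j x = r\<^sup>2 * mollify n (eps j) (\<lambda>_. 0) f x" for j x
  define u1 where "u1 j i x = r * mollify n (eps j) (dirs (\<lambda>_. 0) i) u x" for j i x
  define u2 where "u2 j i k x = r\<^sup>2 * mollify n (eps j) (dirs (dirs (\<lambda>_. 0) i) k) u x" for j i k x
  have C2: "C2 (uj j) (u1 j) (u2 j)" for j
    unfolding uj_def u1_def[abs_def] u2_def[abs_def] using u(1) by (rule mollify_C2) simp
  have uu: "integrable (Leb n) (\<lambda>x. (uj j x)\<^sup>2)" "uj j \<in> borel_measurable (Leb n)" for j
    using T_L2(1)[OF u, of j] T_integrable(1)[OF u(1), of j] by (auto simp: uj_def T_eq_mol)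
  have ff: "integrable (Leb n) (\<lambda>x. (fj j x)\<^sup>2)" "fj j \<in> borel_measurable (Leb n)" for j
    using T_L2(1)[OF f, of j] T_integrable(1)[OF f(1), of j] by (auto simp: fj_def[abs_def] T_eq_mol power_mult_distrib)
  have cu: "(\<lambda>j. \<integral>x. (uj j x - u x)\<^sup>2 \<partial>Leb n) \<longlonglongrightarrow> 0"
    using mollifier_L2_convergence[OF _ _ u] by (simp add: uj_def T_eq_mol)
  have cf: "(\<lambda>j. \<integral>x. (fj j x - r\<^sup>2 * f x)\<^sup>2 \<partial>Leb n) \<longlonglongrightarrow> 0"
  proof -
    have "(\<lambda>j. r^4 * (\<integral>x. (T j f x - f x)\<^sup>2 \<partial>Leb n)) \<longlonglongrightarrow> r^4 * 0"
      using mollifier_L2_convergence[OF _ _ f] by (intro tendsto_mult tendsto_const) auto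
    moreover have "(\<integral>x. (fj j x - r\<^sup>2 * f x)\<^sup>2 \<partial>Leb n) = r^4 * (\<integral>x. (T j f x - f x)\<^sup>2 \<partial>Leb n)" for j
      unfolding fj_def T_eq_mol
      by (subst integral_mult_right_zero[symmetric]) (simp add: right_diff_distrib[symmetric] power_mult_distrib)
    ultimately show ?thesis by simp
  qed
  have fi: "integrable (Leb n) (\<lambda>x. (r\<^sup>2 * f x)\<^sup>2)" using f(2) by (simp add: power_mult_distrib)
  have lim: "(\<lambda>j. \<integral>x. (w (S x) * uj j x)\<^sup>2 \<partial>Leb n) \<longlonglongrightarrow> (\<integral>x. (w (S x) * u x)\<^sup>2 \<partial>Leb n)"
    "(\<lambda>j. \<integral>x. (w (S x) * fj j x)\<^sup>2 \<partial>Leb n) \<longlonglongrightarrow> (\<integral>x. (w (S x) * (r\<^sup>2 * f x))\<^sup>2 \<partial>Leb n)"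
    if "w \<in> borel_measurable borel" "\<And>s. \<bar>w s\<bar> \<le> C" for w C
  proof -
    have [measurable]: "u \<in> borel_measurable (Leb n)" "f \<in> borel_measurable (Leb n)" "w \<in> borel_measurable borel"
      using u f that by auto
    have w: "(\<lambda>x. w (S x)) \<in> borel_measurable (Leb n)" by measurable
    show "(\<lambda>j. \<integral>x. (w (S x) * uj j x)\<^sup>2 \<partial>Leb n) \<longlonglongrightarrow> (\<integral>x. (w (S x) * u x)\<^sup>2 \<partial>Leb n)"
      using u(2) uu(1) _ uu(2) w cu that(2) by (rule L2_weighted_limit) simp
    show "(\<lambda>j. \<integral>x. (w (S x) * fj j x)\<^sup>2 \<partial>Leb n) \<longlonglongrightarrow> (\<integral>x. (w (S x) * (r\<^sup>2 * f x))\<^sup>2 \<partial>Leb n)"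
      using fi ff(1) _ ff(2) w cf that(2) by (rule L2_weighted_limit) simp
  qed
  obtain C where C: "\<And>s. \<bar>W \<tau> s * zeta 0 s\<bar> \<le> C" using W_zeta_bounded by blast
  have mw: "(\<lambda>s. W \<tau> s * zeta 0 s) \<in> borel_measurable borel" by measurable
  have mi: "indicat_real {1/4..<c} \<in> borel_measurable borel" for c :: real by measurable
  have ib: "\<bar>indicat_real A s\<bar> \<le> 1" for A and s :: real by (simp add: indicator_def)
  note lw = lim[OF mw C]
  note li = lim[OF mi[of 1] ib] lim[OF mi[of 9] ib]
  define L where "L j = \<tau>^3 / 2 * energy (weight \<tau>) (uj j)" for j
  define R where "R j = 16 * energy (weight \<tau>) (fj j)
      + energy_const * (W \<tau> (1/4))\<^sup>2 * (energy (indicator {1/4..<1}) (uj j) + energy (indicator {1/4..<1}) (fj j))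
      + energy_const * (W \<tau> 6)\<^sup>2 * (energy (indicator {1/4..<9}) (uj j) + energy (indicator {1/4..<9}) (fj j))" for j
  have LR: "eventually (\<lambda>j. L j \<le> R j) sequentially"
    using eq[unfolded mollified_laplace_def]
  proof (rule eventually_mono)
    fix j assume j: "\<forall>x\<in>space (Leb n). S x < 9 \<longrightarrow>
        (\<Sum>i<n. mollify n (eps j) (dirs (dirs (\<lambda>_. 0) i) i) u x) = mollify n (eps j) (\<lambda>_. 0) f x"
    have lap: "lap (u2 j) x = fj j x" if "x \<in> space (Leb n)" "S x < 9" for x
      using j that by (simp add: lap_def u2_def fj_def sum_distrib_left[symmetric])
    have e1: "energy (weight \<tau>) (lap (u2 j)) = energy (weight \<tau>) (fj j)"
    proof (intro Bochner_Integration.integral_cong refl)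
      fix x assume x: "x \<in> space (Leb n)"
      show "(W \<tau> (S x) * zeta 0 (S x) * lap (u2 j) x)\<^sup>2 = (W \<tau> (S x) * zeta 0 (S x) * fj j x)\<^sup>2"
        using lap[OF x] zeta_vals(2)[of "S x" 0] by (cases "S x < 9") auto
    qed
    have e2: "(\<integral>x. indicator {1/4..<c} (S x) * ((uj j x)\<^sup>2 + (lap (u2 j) x)\<^sup>2) \<partial>Leb n)
      = energy (indicator {1/4..<c}) (uj j) + energy (indicator {1/4..<c}) (fj j)"
      if "c \<le> 9" for c :: real
    proof -
      have i: "integrable (Leb n) (\<lambda>x. (indicator {1/4..<c} (S x) * g x)\<^sup>2)"
        if "integrable (Leb n) (\<lambda>x. (g x)\<^sup>2)" "g \<in> borel_measurable (Leb n)" for g :: "_ \<Rightarrow> real"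
        by (rule Bochner_Integration.integrable_bound[OF that(1)]) (use that(2) in \<open>auto simp: indicator_def\<close>)
      have "(\<integral>x. indicator {1/4..<c} (S x) * ((uj j x)\<^sup>2 + (lap (u2 j) x)\<^sup>2) \<partial>Leb n)
        = (\<integral>x. (indicator {1/4..<c} (S x) * uj j x)\<^sup>2 + (indicator {1/4..<c} (S x) * fj j x)\<^sup>2 \<partial>Leb n)"
        using lap \<open>c \<le> 9\<close> by (intro Bochner_Integration.integral_cong) (auto simp: indicator_def)
      then show ?thesis using i[OF uu] i[OF ff] by simp
    qed
    show "L j \<le> R j"
      using local_carleman[OF C2[of j] tau] unfolding L_def R_def e1 by (simp only: e2)
  qed
  have "L \<longlonglongrightarrow> \<tau>^3 / 2 * energy (weight \<tau>) u"
    unfolding L_def by (intro tendsto_intros lw)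
  moreover have "R \<longlonglongrightarrow> 16 * energy (weight \<tau>) (\<lambda>x. r\<^sup>2 * f x)
      + energy_const * (W \<tau> (1/4))\<^sup>2 * (energy (indicator {1/4..<1}) u + energy (indicator {1/4..<1}) (\<lambda>x. r\<^sup>2 * f x))
      + energy_const * (W \<tau> 6)\<^sup>2 * (energy (indicator {1/4..<9}) u + energy (indicator {1/4..<9}) (\<lambda>x. r\<^sup>2 * f x))"
    unfolding R_def by (intro tendsto_add tendsto_mult tendsto_const lw li)
  ultimately show ?thesis using LR by (intro tendsto_le[OF sequentially_bot])
qed

section \<open>The three-annuli estimate\<close>

text \<open>Exponents after division by the weight at 4, the squared radius of the middle ball; 1/4
  and 6 are the inner ends of the two cutoff zones. Neither depends on the dimension.\<close>

definition expo_in :: real where "expo_in = Phi (1/4) - Phi 4"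
definition expo_out :: real where "expo_out = Phi 4 - Phi 6"

lemma expo_pos: "expo_in > 0" "expo_out > 0"
  by (auto simp: expo_in_def expo_out_def Phi_less)

definition (in scaled_coordinates) mass :: "((nat \<Rightarrow> real) \<Rightarrow> real) \<Rightarrow> ((nat \<Rightarrow> real) \<Rightarrow> real) \<Rightarrow> real \<Rightarrow> real" where
  "mass u1 u2 c = (\<integral>x. indicator {..<c} (S x) * ((u1 x)\<^sup>2 + (u2 x)\<^sup>2) \<partial>Leb n)"

text \<open>The bound by \<kappa> holds only for the real and imaginary parts together, so the two
  Carleman estimates are added first. The energies with weight \<open>w\<close> are absorbed on the
  left; those in the cutoff zones only contribute a factor 1 + K^2.\<close>

lemma (in scaled_coordinates) three_annuli:
  fixes \<kappa> \<tau> K :: real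
  defines "K \<equiv> r\<^sup>2 * \<kappa>"
  assumes u1: "integrable (Leb n) u1" "integrable (Leb n) (\<lambda>x. (u1 x)\<^sup>2)"
    and u2: "integrable (Leb n) u2" "integrable (Leb n) (\<lambda>x. (u2 x)\<^sup>2)"
    and f1: "integrable (Leb n) f1" "integrable (Leb n) (\<lambda>x. (f1 x)\<^sup>2)"
    and f2: "integrable (Leb n) f2" "integrable (Leb n) (\<lambda>x. (f2 x)\<^sup>2)"
    and eq1: "mollified_laplace u1 f1"
    and eq2: "mollified_laplace u2 f2"
    and le: "AE x in Leb n. S x < 9 \<longrightarrow> (f1 x)\<^sup>2 + (f2 x)\<^sup>2 \<le> \<kappa>\<^sup>2 * ((u1 x)\<^sup>2 + (u2 x)\<^sup>2)"
    and \<kappa>: "\<kappa> \<ge> 0" and tau: "\<tau> \<ge> 4 * (1 + K)"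
  shows "mass u1 u2 4 \<le> (energy_const + 1) *
    (exp (2 * \<tau> * expo_in) * mass u1 u2 1 + exp (- 2 * \<tau> * expo_out) * mass u1 u2 9)"
proof -
  have K0: "K \<ge> 0" using \<kappa> by (simp add: K_def)
  have tau0: "\<tau> \<ge> 0" by (rule order_trans[OF _ tau]) (use K0 in simp)
  define m where "m = mass u1 u2"
  note m_eq = m_def[symmetric] and m_def = m_def[THEN fun_cong, unfolded mass_def]
  define J where "J w = energy w u1 + energy w u2" for w :: "real \<Rightarrow> real"
  define H where "H w = energy w (\<lambda>x. r\<^sup>2 * f1 x) + energy w (\<lambda>x. r\<^sup>2 * f2 x)" for w :: "real \<Rightarrow> real"
  define w where "w s = W \<tau> s * zeta 0 s" for s
  have [measurable]: "u1 \<in> borel_measurable (Leb n)" "u2 \<in> borel_measurable (Leb n)"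
    "f1 \<in> borel_measurable (Leb n)" "f2 \<in> borel_measurable (Leb n)"
    using u1 u2 f1 f2 by auto
  have [measurable]: "w \<in> borel_measurable borel" unfolding w_def[abs_def] by measurable
  have int: "integrable (Leb n) (\<lambda>x. (v (S x) * (c * h x))\<^sup>2)"
    if "v \<in> borel_measurable borel" "\<And>s. \<bar>v s\<bar> \<le> C" "integrable (Leb n) (\<lambda>x. (h x)\<^sup>2)" "h \<in> borel_measurable (Leb n)"
    for v :: "real \<Rightarrow> real" and h :: "(nat \<Rightarrow> real) \<Rightarrow> real" and C c :: real
  proof (rule Bochner_Integration.integrable_bound)
    show "integrable (Leb n) (\<lambda>x. (C * c)\<^sup>2 * (h x)\<^sup>2)" using that by simp
    note [measurable] = that(1,4)
    show "(\<lambda>x. (v (S x) * (c * h x))\<^sup>2) \<in> borel_measurable (Leb n)" by measurable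
    have "(v s)\<^sup>2 \<le> C\<^sup>2" for s using that(2)[of s] by (intro abs_le_square_iff[THEN iffD1]) auto
    then show "AE x in Leb n. norm ((v (S x) * (c * h x))\<^sup>2) \<le> norm ((C * c)\<^sup>2 * (h x)\<^sup>2)"
      by (intro AE_I2) (simp add: power_mult_distrib mult.assoc mult_right_mono)
  qed
  have HJ: "H v \<le> K\<^sup>2 * J v"
    if v: "v \<in> borel_measurable borel" "\<And>s. \<bar>v s\<bar> \<le> C" "\<And>s. s \<ge> 9 \<Longrightarrow> v s = 0" for v C
  proof -
    note i = int[OF v(1,2) u1(2), of 1] int[OF v(1,2) u2(2), of 1] int[OF v(1,2) f1(2), of "r\<^sup>2"] int[OF v(1,2) f2(2), of "r\<^sup>2"]
    have "H v = (\<integral>x. (v (S x) * (r\<^sup>2 * f1 x))\<^sup>2 + (v (S x) * (r\<^sup>2 * f2 x))\<^sup>2 \<partial>Leb n)"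
      unfolding H_def using i by simp
    also have "\<dots> \<le> (\<integral>x. K\<^sup>2 * ((v (S x) * u1 x)\<^sup>2 + (v (S x) * u2 x)\<^sup>2) \<partial>Leb n)"
    proof (rule integral_mono_AE)
      show "AE x in Leb n. (v (S x) * (r\<^sup>2 * f1 x))\<^sup>2 + (v (S x) * (r\<^sup>2 * f2 x))\<^sup>2 \<le> K\<^sup>2 * ((v (S x) * u1 x)\<^sup>2 + (v (S x) * u2 x)\<^sup>2)"
        using le
      proof (rule AE_mp, intro AE_I2 impI)
        fix x assume *: "S x < 9 \<longrightarrow> (f1 x)\<^sup>2 + (f2 x)\<^sup>2 \<le> \<kappa>\<^sup>2 * ((u1 x)\<^sup>2 + (u2 x)\<^sup>2)"
        show "(v (S x) * (r\<^sup>2 * f1 x))\<^sup>2 + (v (S x) * (r\<^sup>2 * f2 x))\<^sup>2 \<le> K\<^sup>2 * ((v (S x) * u1 x)\<^sup>2 + (v (S x) * u2 x)\<^sup>2)"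
        proof (cases "S x < 9")
          case True
          then have "(v (S x) * r\<^sup>2)\<^sup>2 * ((f1 x)\<^sup>2 + (f2 x)\<^sup>2) \<le> (v (S x) * r\<^sup>2)\<^sup>2 * (\<kappa>\<^sup>2 * ((u1 x)\<^sup>2 + (u2 x)\<^sup>2))"
            using * by (intro mult_left_mono) auto
          then show ?thesis by (simp add: K_def power_mult_distrib algebra_simps)
        qed (simp add: v(3))
      qed
    qed (use i in auto)
    also have "\<dots> = K\<^sup>2 * J v" unfolding J_def using i by simp
    finally show ?thesis .
  qed
  have J0: "J v \<ge> 0" for v by (simp add: J_def)
  obtain C where C: "\<And>s. \<bar>w s\<bar> \<le> C" unfolding w_def using W_zeta_bounded by blast
  define a where "a = (W \<tau> (1/4))\<^sup>2"
  define b where "b = (W \<tau> 6)\<^sup>2"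
  define d where "d = (W \<tau> 4)\<^sup>2"
  define ii where "ii = indicat_real {1/4..<(1::real)}"
  define io where "io = indicat_real {1/4..<(9::real)}"
  have imeas: "ii \<in> borel_measurable borel" "io \<in> borel_measurable borel"
    unfolding ii_def io_def by measurable
  have ib: "\<bar>ii s\<bar> \<le> 1" "\<bar>io s\<bar> \<le> 1" for s by (auto simp: ii_def io_def indicator_def)
  have ab: "a > 0" "b > 0" "d > 0" by (auto simp: a_def b_def d_def W_def)
  note E = energy_const_pos
  have carl: "\<tau>^3 / 2 * J w \<le> 16 * H w + energy_const * a * (J ii + H ii) + energy_const * b * (J io + H io)"
    using carleman_limit[OF u1 f1 eq1 tau0] carleman_limit[OF u2 f2 eq2 tau0]
    unfolding J_def H_def w_def a_def b_def ii_def io_def by (simp add: algebra_simps)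
  also have "\<dots> \<le> 16 * (K\<^sup>2 * J w) + energy_const * a * (J ii + K\<^sup>2 * J ii) + energy_const * b * (J io + K\<^sup>2 * J io)"
    using E ab ib imeas C zeta_vals(2)
    by (intro add_mono mult_left_mono add_left_mono HJ) (auto simp: ii_def io_def w_def indicator_def)
  finally have "(\<tau>^3 / 2 - 16 * K\<^sup>2) * J w \<le> (1 + K\<^sup>2) * (energy_const * a * J ii + energy_const * b * J io)"
    by (simp add: algebra_simps)
  \<comment> \<open>The lower bound on \<tau> is chosen so that the left factor beats the 1 + K^2 on
    the right; cancelling it leaves a constant free of \<kappa>, which survives only in the range of
    \<tau>.\<close>
  moreover have "1 + K\<^sup>2 \<le> \<tau>^3 / 2 - 16 * K\<^sup>2"
  proof -
    have "(4 * (1 + K))^3 \<le> \<tau>^3" using tau K0 by (intro power_mono) auto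
    moreover have "(4 * (1 + K))^3 = 64 + 192 * K + 192 * K\<^sup>2 + 64 * K^3"
      by (simp add: power3_eq_cube power2_eq_square algebra_simps)
    moreover have "K^3 \<ge> 0" "K\<^sup>2 \<ge> 0" using K0 by auto
    ultimately show ?thesis using K0 by linarith
  qed
  ultimately have "(1 + K\<^sup>2) * J w \<le> (1 + K\<^sup>2) * (energy_const * a * J ii + energy_const * b * J io)"
    using mult_right_mono[OF _ J0[of w]] order_trans by blast
  then have Jw: "J w \<le> energy_const * a * J ii + energy_const * b * J io"
    by (subst (asm) mult_le_cancel_left_pos) (auto simp: add_pos_nonneg)
  have im: "integrable (Leb n) (\<lambda>x. v (S x) * ((u1 x)\<^sup>2 + (u2 x)\<^sup>2))"
    if "v \<in> borel_measurable borel" "\<And>s. 0 \<le> v s \<and> v s \<le> 1" for v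
  proof (rule Bochner_Integration.integrable_bound)
    show "integrable (Leb n) (\<lambda>x. (u1 x)\<^sup>2 + (u2 x)\<^sup>2)" using u1 u2 by auto
    note [measurable] = that(1)
    show "(\<lambda>x. v (S x) * ((u1 x)\<^sup>2 + (u2 x)\<^sup>2)) \<in> borel_measurable (Leb n)" by measurable
    show "AE x in Leb n. norm (v (S x) * ((u1 x)\<^sup>2 + (u2 x)\<^sup>2)) \<le> norm ((u1 x)\<^sup>2 + (u2 x)\<^sup>2)"
      using that(2) by (intro AE_I2) (simp add: abs_mult mult_left_le_one_le)
  qed
  have imi: "integrable (Leb n) (\<lambda>x. indicator A (S x) * ((u1 x)\<^sup>2 + (u2 x)\<^sup>2))" if "A \<in> sets borel" for A
    using that by (intro im) (auto simp: indicator_def)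
  have Jm: "J (indicat_real {1/4..<c}) \<le> m c" for c
  proof -
    have meas: "indicat_real {1/4..<c} \<in> borel_measurable borel" by measurable
    have i: "\<bar>indicat_real {1/4..<c} s\<bar> \<le> 1" for s by (auto simp: indicator_def)
    note i2 = int[OF meas i u1(2), of 1] int[OF meas i u2(2), of 1]
    have "J (indicat_real {1/4..<c}) = (\<integral>x. (indicat_real {1/4..<c} (S x) * u1 x)\<^sup>2 + (indicat_real {1/4..<c} (S x) * u2 x)\<^sup>2 \<partial>Leb n)"
      unfolding J_def using i2 by simp
    also have "\<dots> \<le> m c"
      unfolding m_def using i2 imi[of "{..<c}"] by (intro integral_mono) (auto simp: indicator_def)
    finally show ?thesis .
  qed
  have m0: "m c \<ge> 0" for c unfolding m_def by (intro Bochner_Integration.integral_nonneg) auto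
  \<comment> \<open>Where S < 1 the mass of the small ball suffices; for 1 \<le> S < 4 the cutoff is
    1 and the weight is at least its value at 4.\<close>
  have "d * m 4 = (\<integral>x. d * (indicator {..<4} (S x) * ((u1 x)\<^sup>2 + (u2 x)\<^sup>2)) \<partial>Leb n)" by (simp add: m_def)
  also have "\<dots> \<le> (\<integral>x. d * (indicator {..<1} (S x) * ((u1 x)\<^sup>2 + (u2 x)\<^sup>2)) + ((w (S x) * u1 x)\<^sup>2 + (w (S x) * u2 x)\<^sup>2) \<partial>Leb n)"
  proof (rule integral_mono)
    fix x
    show "d * (indicator {..<4} (S x) * ((u1 x)\<^sup>2 + (u2 x)\<^sup>2))
      \<le> d * (indicator {..<1} (S x) * ((u1 x)\<^sup>2 + (u2 x)\<^sup>2)) + ((w (S x) * u1 x)\<^sup>2 + (w (S x) * u2 x)\<^sup>2)"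
    proof (cases "1 \<le> S x \<and> S x < 4")
      case True
      then have "W \<tau> 4 \<le> W \<tau> (S x)" "zeta 0 (S x) = 1"
        using Phi_antimono[of "S x" 4] tau0 by (auto simp: W_def zeta_vals intro: mult_left_mono)
      then have "d \<le> (w (S x))\<^sup>2" unfolding d_def w_def by (simp add: W_def power_mono)
      from mult_right_mono[OF this, of "(u1 x)\<^sup>2 + (u2 x)\<^sup>2"] True show ?thesis
        by (simp add: power_mult_distrib distrib_left)
    qed (use ab in \<open>auto simp: indicator_def\<close>)
  qed (use int[OF \<open>w \<in> borel_measurable borel\<close> C u1(2), of 1] int[OF \<open>w \<in> borel_measurable borel\<close> C u2(2), of 1] imi in auto)
  also have "\<dots> = d * m 1 + J w"
    unfolding m_def J_def using int[OF \<open>w \<in> borel_measurable borel\<close> C u1(2), of 1] int[OF \<open>w \<in> borel_measurable borel\<close> C u2(2), of 1] imi[of "{..<1}"]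
    by simp
  also have "\<dots> \<le> d * m 1 + (energy_const * a * m 1 + energy_const * b * m 9)"
  proof -
    have "energy_const * a * J ii \<le> energy_const * a * m 1" "energy_const * b * J io \<le> energy_const * b * m 9"
      using E ab Jm[of 1] Jm[of 9] by (auto simp: ii_def io_def)
    with Jw show ?thesis by linarith
  qed
  finally have main: "m 4 \<le> m 1 + (energy_const * (a / d) * m 1 + energy_const * (b / d) * m 9)"
    using ab by (simp add: field_simps)
  have ad: "a / d = exp (2 * \<tau> * expo_in)" "b / d = exp (- 2 * \<tau> * expo_out)"
    by (simp_all add: a_def b_def d_def W_def expo_in_def expo_out_def power2_eq_square exp_add[symmetric] exp_diff[symmetric] algebra_simps)
  have "m 1 \<le> exp (2 * \<tau> * expo_in) * m 1"
    using mult_right_mono[of 1 "exp (2 * \<tau> * expo_in)" "m 1"] m0[of 1] tau0 expo_pos by simp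
  moreover have "0 \<le> exp (- 2 * \<tau> * expo_out) * m 9" using m0 by simp
  ultimately show ?thesis
    using main unfolding ad m_eq by (simp add: algebra_simps)
qed

text \<open>The choice exp(t (P + Q)) = Z / A balances the two terms, both becoming the square of
  the interpolated norm. If this t is below \<open>t0\<close>, then Z \<le> exp(t0 (P + Q)) A, and D
  \<le> Z is already enough.\<close>

lemma three_balls_optimization:
  fixes A D Z P Q C t0 :: real
  assumes A: "0 \<le> A" "A \<le> D" "D \<le> Z" and P: "P > 0" "Q > 0" and C: "C \<ge> 1" and t0: "t0 \<ge> 0"
    and bound: "\<And>t. t \<ge> t0 \<Longrightarrow> D\<^sup>2 \<le> C * (exp (2 * t * P) * A\<^sup>2 + exp (- 2 * t * Q) * Z\<^sup>2)"
  shows "D \<le> sqrt (2 * C) * exp (t0 * Q) * A powr (Q / (P + Q)) * Z powr (1 - Q / (P + Q))"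
proof (cases "A = 0")
  case True
  have "D = 0"
  proof (rule ccontr)
    assume "D \<noteq> 0"
    then have D: "D > 0" using A by simp
    \<comment> \<open>With A = 0 any large t is admissible. This one, through exp(x) \<ge> 1 + x,
      leads to D^2 + C Z^2 \<le> C Z^2.\<close>
    define t where "t = t0 + C * Z\<^sup>2 / (2 * Q * D\<^sup>2)"
    have "t \<ge> t0" using P C by (simp add: t_def)
    from bound[OF this] True have "D\<^sup>2 \<le> C * exp (- 2 * t * Q) * Z\<^sup>2" by simp
    then have "D\<^sup>2 * exp (2 * t * Q) \<le> C * Z\<^sup>2"
      by (simp add: exp_minus field_simps)
    moreover have "exp (2 * t * Q) \<ge> 1 + 2 * t * Q" by (rule exp_ge_add_one_self)
    moreover have "2 * t * Q \<ge> C * Z\<^sup>2 / D\<^sup>2" using P t0 D by (simp add: t_def field_simps)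
    ultimately have "D\<^sup>2 * (1 + C * Z\<^sup>2 / D\<^sup>2) \<le> C * Z\<^sup>2"
      by (meson add_left_mono mult_left_mono order_trans zero_le_power2)
    then show False using D by (simp add: distrib_left)
  qed
  \<comment> \<open>Here \<open>A powr\<close> a positive exponent is 0 as well, so both sides
    vanish.\<close>
  then show ?thesis using C by simp
next
  case False
  then have pos: "A > 0" "Z > 0" using A by auto
  define \<alpha> where "\<alpha> = Q / (P + Q)"
  define M where "M = A powr \<alpha> * Z powr (1 - \<alpha>)"
  have M: "M = exp (\<alpha> * ln A + (1 - \<alpha>) * ln Z)" using pos by (simp add: M_def powr_def exp_add)
  have PQ: "P + Q > 0" using P by simp
  have a1: "\<alpha> * (P + Q) = Q" "(1 - \<alpha>) * (P + Q) = P" using PQ by (simp_all add: \<alpha>_def field_simps)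
  define t where "t = (ln Z - ln A) / (P + Q)"
  have tPQ: "t * (P + Q) = ln Z - ln A" using PQ by (simp add: t_def)
  have s2: "sqrt (2 * C) \<ge> 1" using C by simp
  have e1: "exp (t0 * Q) \<ge> 1" using t0 P by simp
  have "D \<le> sqrt (2 * C) * exp (t0 * Q) * M"
  proof (cases "t \<ge> t0")
    case True
    have tP: "t * P = (1 - \<alpha>) * (ln Z - ln A)" "t * Q = \<alpha> * (ln Z - ln A)"
      using a1 tPQ by (metis mult.left_commute)+
    have 1: "exp (2 * t * P) * A\<^sup>2 = M\<^sup>2"
    proof -
      have "exp (t * P) * A = exp (t * P + ln A)" using pos by (simp add: exp_add)
      also have "\<dots> = M" unfolding M tP by (simp add: algebra_simps)
      finally have "(exp (t * P) * A)\<^sup>2 = M\<^sup>2" by simp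
      then show ?thesis by (simp add: power_mult_distrib exp_double[symmetric] mult.assoc)
    qed
    have 2: "exp (- 2 * t * Q) * Z\<^sup>2 = M\<^sup>2"
    proof -
      have "exp (- (t * Q)) * Z = exp (- (t * Q) + ln Z)" using pos by (simp only: exp_add exp_ln)
      also have "\<dots> = M" unfolding M tP by (simp add: algebra_simps)
      finally have "(exp (- (t * Q)) * Z)\<^sup>2 = M\<^sup>2" by simp
      then show ?thesis by (simp add: power_mult_distrib exp_double[symmetric] mult.assoc)
    qed
    from bound[OF True] have "D\<^sup>2 \<le> 2 * C * M\<^sup>2" unfolding 1 2 by simp
    then have "sqrt (D\<^sup>2) \<le> sqrt (2 * C * M\<^sup>2)" by (rule real_sqrt_le_mono)
    then have "D \<le> sqrt (2 * C) * M" using A by (simp add: real_sqrt_mult M)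
    also have "\<dots> \<le> sqrt (2 * C) * M * exp (t0 * Q)"
      using mult_left_mono[OF e1, of "sqrt (2 * C) * M"] C by (simp add: M)
    finally show ?thesis by (simp add: mult_ac)
  next
    case False
    then have "t * (P + Q) \<le> t0 * (P + Q)" using PQ by (intro mult_right_mono) auto
    then have "ln Z \<le> ln A + t0 * (P + Q)" using tPQ by linarith
    then have "\<alpha> * ln Z \<le> \<alpha> * (ln A + t0 * (P + Q))" using P by (intro mult_left_mono) (auto simp: \<alpha>_def)
    also have "\<dots> = \<alpha> * ln A + t0 * (\<alpha> * (P + Q))" by (simp add: algebra_simps)
    also have "\<dots> = \<alpha> * ln A + t0 * Q" by (simp only: a1)
    finally have "ln Z \<le> \<alpha> * ln A + (1 - \<alpha>) * ln Z + t0 * Q" by (simp add: algebra_simps)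
    then have "exp (ln Z) \<le> M * exp (t0 * Q)" unfolding M exp_add[symmetric] by (subst exp_le_cancel_iff)
    then have "Z \<le> M * exp (t0 * Q)" using pos by simp
    also have "\<dots> \<le> sqrt (2 * C) * (M * exp (t0 * Q))"
      using mult_right_mono[OF s2, of "M * exp (t0 * Q)"] by (simp add: M)
    finally show ?thesis using A by (simp add: mult_ac)
  qed
  then show ?thesis by (simp add: M_def \<alpha>_def mult_ac)
qed

section \<open>Measurability of the domain and Borel representatives\<close>

lemma openin_Rn_top_measurable:
  assumes "openin (Rn_top n) \<Omega>"
  shows "\<Omega> \<in> sets (Leb n)"
proof -
  define B where "B a b = Pi\<^sub>E {..<n} (\<lambda>i. {a i<..<(b i :: real)})" for a b
  \<comment> \<open>Corners are taken as extensional tuples: functions with arbitrary values outside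
    {..<n} would not form a countable set.\<close>
  define I where "I = {..<n} \<rightarrow>\<^sub>E (\<rat> :: real set)"
  have "countable I" unfolding I_def by (intro countable_PiE countable_rat) auto
  have B: "B a b \<in> sets (Leb n)" for a b unfolding B_def by (intro sets_PiM_I_finite) auto
  have eq: "\<Omega> = \<Union>((\<lambda>(a, b). B a b) ` {(a, b) \<in> I \<times> I. B a b \<subseteq> \<Omega>})"
  proof (intro equalityI subsetI)
    fix x assume x: "x \<in> \<Omega>"
    with assms obtain U where U: "\<And>i. i < n \<Longrightarrow> open (U i)" "x \<in> Pi\<^sub>E {..<n} U" "Pi\<^sub>E {..<n} U \<subseteq> \<Omega>"
      unfolding Rn_top_def openin_product_topology_alt by (metis lessThan_iff open_openin)
    have "\<exists>a b. a \<in> \<rat> \<and> b \<in> \<rat> \<and> a < x i \<and> x i < b \<and> {a<..<b} \<subseteq> U i" if i: "i < n" for i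
    proof -
      have "x i \<in> U i" using U(2) i by (auto simp: PiE_iff)
      with U(1)[OF i] obtain e where e: "e > 0" "\<And>y. \<bar>y - x i\<bar> < e \<Longrightarrow> y \<in> U i"
        by (metis open_real)
      obtain a where "a \<in> \<rat>" "x i - e < a" "a < x i" using Rats_dense_in_real[of "x i - e" "x i"] e(1) by auto
      moreover obtain b where "b \<in> \<rat>" "x i < b" "b < x i + e" using Rats_dense_in_real[of "x i" "x i + e"] e(1) by auto
      ultimately show ?thesis using e(2) by (intro exI[of _ a] exI[of _ b]) (auto simp: abs_less_iff)
    qed
    then obtain a b where ab: "\<And>i. i < n \<Longrightarrow> a i \<in> \<rat> \<and> b i \<in> \<rat> \<and> a i < x i \<and> x i < b i \<and> {a i<..<b i} \<subseteq> U i"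
      by metis
    have "B (restrict a {..<n}) (restrict b {..<n}) = B a b" unfolding B_def by (intro PiE_cong) auto
    moreover have "B a b \<subseteq> \<Omega>" using ab U(3) unfolding B_def by (intro order_trans[OF PiE_mono U(3)]) auto
    moreover have "x \<in> B a b" using ab U(2) by (auto simp: B_def PiE_iff)
    moreover have "restrict a {..<n} \<in> I" "restrict b {..<n} \<in> I" using ab by (auto simp: I_def)
    ultimately show "x \<in> \<Union>((\<lambda>(a, b). B a b) ` {(a, b) \<in> I \<times> I. B a b \<subseteq> \<Omega>})"
      by (intro UN_I[of "(restrict a {..<n}, restrict b {..<n})"]) auto
  qed auto
  have "countable {(a, b) \<in> I \<times> I. B a b \<subseteq> \<Omega>}"
    by (rule countable_subset[of _ "I \<times> I"]) (use \<open>countable I\<close> in auto)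
  then have "\<Union>((\<lambda>(a, b). B a b) ` {(a, b) \<in> I \<times> I. B a b \<subseteq> \<Omega>}) \<in> sets (Leb n)"
    by (rule sets.countable_UN'') (use B in auto)
  then show ?thesis by (rule ssubst[OF eq])
qed

lemma sets_completion_Int: "\<Omega> \<in> sets M \<Longrightarrow> \<Omega> \<inter> space (completion M) \<in> sets (completion M)"
  by (auto intro: sets_completionI_sets)

lemma L2_space_measurable:
  assumes "\<Omega> \<in> sets (Leb n)" "h \<in> L2_space n \<Omega>"
  shows "(\<lambda>x. indicator \<Omega> x *\<^sub>R h x) \<in> borel_measurable (completion (Leb n))"
  using assms(2) borel_measurable_restrict_space_iff[OF sets_completion_Int[OF assms(1)], of h]
  unfolding L2_space_def leb_on_def by simp

text \<open>
  Members of \<open>L2_space\<close> are only measurable for the completed measure, while the product measure, and with it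
  Fubini's theorem, needs Borel functions.
\<close>

lemma L2_space_Borel_parts:
  assumes \<Omega>: "\<Omega> \<in> sets (Leb n)" "emeasure (Leb n) \<Omega> < \<infinity>" and h: "h \<in> L2_space n \<Omega>"
  obtains g1 g2 where
    "integrable (Leb n) g1" "integrable (Leb n) (\<lambda>x. (g1 x)\<^sup>2)"
    "integrable (Leb n) g2" "integrable (Leb n) (\<lambda>x. (g2 x)\<^sup>2)"
    "AE x in Leb n. indicator \<Omega> x *\<^sub>R h x = Complex (g1 x) (g2 x)"
proof -
  let ?C = "completion (Leb n)"
  note \<Omega>C = sets_completion_Int[OF \<Omega>(1)]
  note m = L2_space_measurable[OF \<Omega>(1) h]
  have i: "integrable ?C (\<lambda>x. (cmod (indicator \<Omega> x *\<^sub>R h x))\<^sup>2)"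
  proof -
    have "integrable ?C (\<lambda>x. indicator \<Omega> x *\<^sub>R (cmod (h x))\<^sup>2)"
      using h integrable_restrict_space[OF \<Omega>C, of "\<lambda>x. (cmod (h x))\<^sup>2"] unfolding L2_space_def leb_on_def by simp
    moreover have "(\<lambda>x. indicator \<Omega> x *\<^sub>R (cmod (h x))\<^sup>2) = (\<lambda>x. (cmod (indicator \<Omega> x *\<^sub>R h x))\<^sup>2)"
      by (auto simp: indicator_def)
    ultimately show ?thesis by simp
  qed
  have "(\<lambda>x. Re (indicator \<Omega> x *\<^sub>R h x)) \<in> borel_measurable ?C" "(\<lambda>x. Im (indicator \<Omega> x *\<^sub>R h x)) \<in> borel_measurable ?C"
    using m by measurable
  from this[THEN completion_ex_borel_measurable_real] obtain g1 g2 where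
    g: "g1 \<in> borel_measurable (Leb n)" "AE x in Leb n. Re (indicator \<Omega> x *\<^sub>R h x) = g1 x"
    "g2 \<in> borel_measurable (Leb n)" "AE x in Leb n. Im (indicator \<Omega> x *\<^sub>R h x) = g2 x"
    by blast
  note [measurable] = g(1,3)
  have ae: "AE x in Leb n. indicator \<Omega> x *\<^sub>R h x = Complex (g1 x) (g2 x)"
    using g(2,4) by eventually_elim (simp add: complex_eq_iff)
  have sq: "integrable (Leb n) (\<lambda>x. (g1 x)\<^sup>2)" "integrable (Leb n) (\<lambda>x. (g2 x)\<^sup>2)"
  proof -
    have m': "(\<lambda>x. (g1 x)\<^sup>2) \<in> borel_measurable ?C" "(\<lambda>x. (g2 x)\<^sup>2) \<in> borel_measurable ?C"
      by (intro measurable_completion; measurable)+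
    have "integrable ?C (\<lambda>x. (g1 x)\<^sup>2)"
      by (rule Bochner_Integration.integrable_bound[OF i m'(1)])
         (use AE_completion[OF ae] in \<open>eventually_elim, simp add: cmod_power2\<close>)
    moreover have "integrable ?C (\<lambda>x. (g2 x)\<^sup>2)"
      by (rule Bochner_Integration.integrable_bound[OF i m'(2)])
         (use AE_completion[OF ae] in \<open>eventually_elim, simp add: cmod_power2\<close>)
    moreover have "integrable ?C (\<lambda>x. (g1 x)\<^sup>2) = integrable (Leb n) (\<lambda>x. (g1 x)\<^sup>2)"
      "integrable ?C (\<lambda>x. (g2 x)\<^sup>2) = integrable (Leb n) (\<lambda>x. (g2 x)\<^sup>2)"
      by (rule integrable_completion, measurable)+
    ultimately show "integrable (Leb n) (\<lambda>x. (g1 x)\<^sup>2)" "integrable (Leb n) (\<lambda>x. (g2 x)\<^sup>2)"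
      by simp_all
  qed
  \<comment> \<open>Since |g| \<le> g^2 + 1 and \<Omega> has finite measure, square integrability
    gives integrability, which mollification requires.\<close>
  have L1: "integrable (Leb n) g"
    if [measurable]: "g \<in> borel_measurable (Leb n)" and "integrable (Leb n) (\<lambda>x. (g x)\<^sup>2)" "AE x in Leb n. x \<notin> \<Omega> \<longrightarrow> g x = 0"
    for g :: "_ \<Rightarrow> real"
  proof (rule Bochner_Integration.integrable_bound)
    show "integrable (Leb n) (\<lambda>x. (g x)\<^sup>2 + indicator \<Omega> x)"
      using that \<Omega> by (auto simp: integrable_indicator_iff)
    show "AE x in Leb n. norm (g x) \<le> norm ((g x)\<^sup>2 + indicator \<Omega> x)"
      using that(3)
    proof eventually_elim
      fix x assume "x \<notin> \<Omega> \<longrightarrow> g x = 0"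
      moreover have "\<bar>g x\<bar> \<le> (g x)\<^sup>2 + 1"
        using zero_le_power2[of "\<bar>g x\<bar> - 1"] zero_le_power2[of "g x"] unfolding power2_diff by simp
      ultimately show "norm (g x) \<le> norm ((g x)\<^sup>2 + indicator \<Omega> x)"
        by (cases "x \<in> \<Omega>") auto
    qed
  qed measurable
  have "AE x in Leb n. x \<notin> \<Omega> \<longrightarrow> g1 x = 0" "AE x in Leb n. x \<notin> \<Omega> \<longrightarrow> g2 x = 0"
    using ae by (eventually_elim, auto simp: complex_eq_iff)+
  with L1 sq that ae g show ?thesis by blast
qed

text \<open>Carries the integrals in the weak formulation from the restricted completed measure to
  Borel functions on the whole space, where the mollifications live.\<close>

lemma integral_leb_on_parts:
  assumes \<Omega>: "\<Omega> \<in> sets (Leb n)"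
    and g: "integrable (Leb n) g1" "integrable (Leb n) g2"
    and ae: "AE x in Leb n. indicator \<Omega> x *\<^sub>R h x = Complex (g1 x) (g2 x)"
    and h: "h \<in> L2_space n \<Omega>"
    and \<psi>: "\<psi> \<in> borel_measurable (Leb n)" "\<And>x. \<bar>\<psi> x\<bar> \<le> C"
  shows "(\<integral>x. h x * of_real (\<psi> x) \<partial>leb_on n \<Omega>)
    = Complex (\<integral>x. g1 x * \<psi> x \<partial>Leb n) (\<integral>x. g2 x * \<psi> x \<partial>Leb n)"
proof -
  let ?C = "completion (Leb n)"
  note [measurable] = \<psi>(1) g[THEN borel_measurable_integrable]
  note \<Omega>C = sets_completion_Int[OF \<Omega>]
  note m = L2_space_measurable[OF \<Omega> h]
  have \<psi>C: "\<psi> \<in> borel_measurable ?C" by (intro measurable_completion \<psi>)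
  have int: "integrable (Leb n) (\<lambda>x. g x * \<psi> x)" if "integrable (Leb n) g" for g
    by (rule Bochner_Integration.integrable_bound[OF integrable_mult_left[OF that, of C]])
       (use that \<psi> order_trans[OF \<psi>(2) abs_ge_self] in \<open>auto intro!: AE_I2 mult_left_mono simp: abs_mult\<close>)
  have F: "(\<lambda>x. complex_of_real (g1 x * \<psi> x) + \<i> * complex_of_real (g2 x * \<psi> x)) \<in> borel_measurable (Leb n)" by measurable
  have "(\<integral>x. h x * of_real (\<psi> x) \<partial>leb_on n \<Omega>) = (\<integral>x. indicator \<Omega> x *\<^sub>R (h x * of_real (\<psi> x)) \<partial>?C)"
    unfolding leb_on_def by (rule integral_restrict_space[OF \<Omega>C])
  also have "\<dots> = (\<integral>x. complex_of_real (g1 x * \<psi> x) + \<i> * complex_of_real (g2 x * \<psi> x) \<partial>?C)"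
  proof (rule integral_cong_AE)
    show "(\<lambda>x. indicator \<Omega> x *\<^sub>R (h x * of_real (\<psi> x))) \<in> borel_measurable ?C"
      using borel_measurable_times[OF m measurable_compose[OF \<psi>C borel_measurable_of_real]] by simp
    show "(\<lambda>x. complex_of_real (g1 x * \<psi> x) + \<i> * complex_of_real (g2 x * \<psi> x)) \<in> borel_measurable ?C"
      by (intro measurable_completion F)
    show "AE x in ?C. indicator \<Omega> x *\<^sub>R (h x * of_real (\<psi> x)) = complex_of_real (g1 x * \<psi> x) + \<i> * complex_of_real (g2 x * \<psi> x)"
      using AE_completion[OF ae]
    proof eventually_elim
      fix x assume "indicator \<Omega> x *\<^sub>R h x = Complex (g1 x) (g2 x)"
      then have "indicator \<Omega> x *\<^sub>R (h x * of_real (\<psi> x)) = Complex (g1 x) (g2 x) * of_real (\<psi> x)"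
        by (metis mult_scaleR_left)
      then show "indicator \<Omega> x *\<^sub>R (h x * of_real (\<psi> x)) = complex_of_real (g1 x * \<psi> x) + \<i> * complex_of_real (g2 x * \<psi> x)"
        by (simp add: complex_eq_iff)
    qed
  qed
  also have "\<dots> = (\<integral>x. complex_of_real (g1 x * \<psi> x) + \<i> * complex_of_real (g2 x * \<psi> x) \<partial>Leb n)"
    by (rule integral_completion[OF F])
  also have "\<dots> = complex_of_real (\<integral>x. g1 x * \<psi> x \<partial>Leb n) + \<i> * complex_of_real (\<integral>x. g2 x * \<psi> x \<partial>Leb n)"
  proof -
    note i = integrable_of_real[OF int[OF g(1)], where 'a = complex] integrable_of_real[OF int[OF g(2)], where 'a = complex]
    show ?thesis
      by (subst Bochner_Integration.integral_add[OF i(1) integrable_mult_right[OF i(2)]])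
         (simp only: integral_mult_right_zero integral_complex_of_real)
  qed
  finally show ?thesis by (simp add: complex_eq_iff)
qed

lemma L2_norm_parts:
  assumes \<Omega>: "\<Omega> \<in> sets (Leb n)" and B: "B \<in> sets (Leb n)" "B \<subseteq> \<Omega>"
    and g [measurable]: "g1 \<in> borel_measurable (Leb n)" "g2 \<in> borel_measurable (Leb n)"
    and ae: "AE x in Leb n. indicator \<Omega> x *\<^sub>R h x = Complex (g1 x) (g2 x)"
    and h: "h \<in> L2_space n \<Omega>"
  shows "L2_norm n B h = sqrt (\<integral>x. indicator B x * ((g1 x)\<^sup>2 + (g2 x)\<^sup>2) \<partial>Leb n)"
proof -
  let ?C = "completion (Leb n)"
  note [measurable] = B(1)
  note BC = sets_completion_Int[OF B(1)]
  note m = L2_space_measurable[OF \<Omega> h]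
  have "(\<integral>x. (cmod (h x))\<^sup>2 \<partial>leb_on n B) = (\<integral>x. indicator B x *\<^sub>R (cmod (h x))\<^sup>2 \<partial>?C)"
    unfolding leb_on_def by (rule integral_restrict_space[OF BC])
  also have "\<dots> = (\<integral>x. indicator B x * (cmod (indicator \<Omega> x *\<^sub>R h x))\<^sup>2 \<partial>?C)"
    using B(2) by (intro Bochner_Integration.integral_cong) (auto simp: indicator_def)
  also have "\<dots> = (\<integral>x. indicator B x * ((g1 x)\<^sup>2 + (g2 x)\<^sup>2) \<partial>?C)"
  proof (rule integral_cong_AE)
    have "indicat_real B \<in> borel_measurable ?C" by (intro measurable_completion) measurable
    then show "(\<lambda>x. indicator B x * (cmod (indicator \<Omega> x *\<^sub>R h x))\<^sup>2) \<in> borel_measurable ?C"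
      by (intro borel_measurable_times borel_measurable_power measurable_compose[OF m borel_measurable_norm])
    show "(\<lambda>x. indicator B x * ((g1 x)\<^sup>2 + (g2 x)\<^sup>2)) \<in> borel_measurable ?C"
      by (intro measurable_completion) measurable
    show "AE x in ?C. indicator B x * (cmod (indicator \<Omega> x *\<^sub>R h x))\<^sup>2 = indicator B x * ((g1 x)\<^sup>2 + (g2 x)\<^sup>2)"
      using AE_completion[OF ae] by eventually_elim (simp add: cmod_power2)
  qed
  also have "\<dots> = (\<integral>x. indicator B x * ((g1 x)\<^sup>2 + (g2 x)\<^sup>2) \<partial>Leb n)"
    by (rule integral_completion) measurable
  finally show ?thesis by (simp add: L2_norm_def)
qed

section \<open>Three balls in a domain\<close>

lemma Rn_dist_eq: "r > 0 \<Longrightarrow> Rn_dist n a x = r * sqrt (scaled_coordinates.S n a r x)"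
proof -
  assume r: "r > 0"
  interpret scaled_coordinates n a r by standard (rule r)
  have "(\<Sum>i<n. (a i - x i)\<^sup>2) = r\<^sup>2 * S x"
    using r unfolding S_def X_def sum_distrib_left
    by (intro sum.cong) (auto simp: power_divide power2_commute)
  then show ?thesis using r by (simp add: Rn_dist_def L2_set_def real_sqrt_mult)
qed

lemma Rn_ball_eq:
  assumes "r > 0" "k > 0"
  shows "Rn_ball n a (k * r) = {x \<in> space (Leb n). scaled_coordinates.S n a r x < k\<^sup>2}"
proof -
  interpret scaled_coordinates n a r by standard (rule assms)
  have "Rn_dist n a x < k * r \<longleftrightarrow> S x < k\<^sup>2" for x
    using assms real_sqrt_less_iff[of "S x" "k\<^sup>2"] by (simp add: Rn_dist_eq mult.commute[of k])
  then show ?thesis by (simp add: Rn_ball_def Rn_def space_PiM)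
qed

lemma Rn_dist_triangle: "Rn_dist n x z \<le> Rn_dist n x y + Rn_dist n y z"
  using L2_set_triangle_ineq[of "\<lambda>i. x i - y i" "\<lambda>i. y i - z i" "{..<n}"] by (simp add: Rn_dist_def)

text \<open>The strict inequality in \<open>inner_part\<close> leaves a margin \<delta>. It makes
  room for the support of the kernel at points up to the rim of the largest ball.\<close>

lemma inner_part_ball:
  assumes x: "x \<in> inner_part n \<Omega> \<rho>"
  obtains \<delta> where "\<delta> > 0" "\<And>y. y \<in> Rn n \<Longrightarrow> Rn_dist n x y < \<rho> + \<delta> \<Longrightarrow> y \<in> \<Omega>"
proof
  let ?I = "INF y \<in> Rn n - \<Omega>. Rn_dist n x y"
  show "?I - \<rho> > 0" using x by (simp add: inner_part_def)
  show "y \<in> \<Omega>" if "y \<in> Rn n" "Rn_dist n x y < \<rho> + (?I - \<rho>)" for y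
  proof (rule ccontr)
    assume "y \<notin> \<Omega>"
    then have "?I \<le> Rn_dist n x y"
      using that(1) by (intro cINF_lower) (auto simp: Rn_dist_def intro!: bdd_belowI2[where m = 0] L2_set_nonneg)
    with that(2) show False by simp
  qed
qed

lemma bounded_domain_measure:
  assumes "bounded_lipschitz_domain n \<Omega>"
  shows "\<Omega> \<in> sets (Leb n)" "emeasure (Leb n) \<Omega> < \<infinity>"
proof -
  have op: "openin (Rn_top n) \<Omega>" using assms by (simp add: bounded_lipschitz_domain_def)
  then show "\<Omega> \<in> sets (Leb n)" by (rule openin_Rn_top_measurable)
  obtain M where M: "\<And>x. x \<in> \<Omega> \<Longrightarrow> L2_set x {..<n} \<le> M" using assms by (auto simp: bounded_lipschitz_domain_def)
  let ?B = "Pi\<^sub>E {..<n} (\<lambda>_. {-M..M})"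
  have "\<Omega> \<subseteq> ?B"
  proof
    fix x assume x: "x \<in> \<Omega>"
    have "\<bar>x i\<bar> \<le> M" if "i < n" for i
      using member_le_L2_set[of "{..<n}" i "\<lambda>i. \<bar>x i\<bar>"] that M[OF x] by (simp add: L2_set_def)
    moreover have "x \<in> Pi\<^sub>E {..<n} (\<lambda>_. UNIV)"
      using openin_subset[OF op] x by (auto simp: Rn_top_def)
    ultimately show "x \<in> ?B" by (auto simp: PiE_iff abs_le_iff) (metis abs_ge_minus_self abs_le_iff minus_le_iff)
  qed
  moreover have "?B \<in> sets (Leb n)" by (intro sets_PiM_I_finite) auto
  moreover have "emeasure (Leb n) ?B < \<infinity>"
  proof -
    have "emeasure lborel {-M..M} < top" by (cases "-M \<le> M") auto
    then show ?thesis
      by (subst lborel_product.emeasure_PiM) (simp_all add: power_less_top_ennreal)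
  qed
  ultimately show "emeasure (Leb n) \<Omega> < \<infinity>" by (meson emeasure_mono le_less_trans)
qed

lemma AE_leb_on:
  assumes "\<Omega> \<in> sets (Leb n)"
  shows "(AE x in leb_on n \<Omega>. P x) \<longleftrightarrow> (AE x in Leb n. x \<in> \<Omega> \<longrightarrow> P x)"
  using sets_completion_Int[OF assms] unfolding leb_on_def by (simp add: AE_restrict_space_iff AE_completion_iff)

text \<open>The kernel depends on x - y, so two derivatives in y equal two in x, the signs
  cancelling. Testing with it moves both derivatives from the kernel onto u.\<close>

lemma weak_deriv_mol:
  assumes \<Omega>: "\<Omega> \<in> sets (Leb n)" and e: "e > 0" and i: "i < n"
    and sub: "Pi\<^sub>E {..<n} (\<lambda>i. {x i - e..x i}) \<subseteq> \<Omega>"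
    and w: "has_weak_deriv n \<Omega> [i, i] u d"
    and u: "u \<in> L2_space n \<Omega>" "integrable (Leb n) u1" "integrable (Leb n) u2"
      "AE x in Leb n. indicator \<Omega> x *\<^sub>R u x = Complex (u1 x) (u2 x)"
    and d: "d \<in> L2_space n \<Omega>" "integrable (Leb n) d1" "integrable (Leb n) d2"
      "AE x in Leb n. indicator \<Omega> x *\<^sub>R d x = Complex (d1 x) (d2 x)"
  shows "mollify n e (dirs (dirs (\<lambda>_. 0) i) i) u1 x = mollify n e (\<lambda>_. 0) d1 x \<and>
    mollify n e (dirs (dirs (\<lambda>_. 0) i) i) u2 x = mollify n e (\<lambda>_. 0) d2 x"
proof -
  have bnd: "\<exists>C. \<forall>y. \<bar>pker n e k x y\<bar> \<le> C" for k using pker_bounded by blast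
  have p: "partials [i, i] (pker n e (\<lambda>_. 0) x) = pker n e (dirs (dirs (\<lambda>_. 0) i) i) x"
    using partials_pker[OF e, of "[i, i]" n x] i by simp
  obtain C where C: "\<And>y. \<bar>pker n e (dirs (dirs (\<lambda>_. 0) i) i) x y\<bar> \<le> C" using bnd by blast
  obtain C' where C': "\<And>y. \<bar>pker n e (\<lambda>_. 0) x y\<bar> \<le> C'" using bnd by blast
  have "(\<integral>y. u y * of_real (partials [i, i] (pker n e (\<lambda>_. 0) x) y) \<partial>leb_on n \<Omega>)
      = (-1) ^ length [i, i] * (\<integral>y. d y * of_real (pker n e (\<lambda>_. 0) x y) \<partial>leb_on n \<Omega>)"
    using w pker_test_function[OF e sub] unfolding has_weak_deriv_def by blast
  then have "(\<integral>y. u y * of_real (pker n e (dirs (dirs (\<lambda>_. 0) i) i) x y) \<partial>leb_on n \<Omega>)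
      = (\<integral>y. d y * of_real (pker n e (\<lambda>_. 0) x y) \<partial>leb_on n \<Omega>)"
    unfolding p by simp
  then show ?thesis
    unfolding integral_leb_on_parts[OF \<Omega> u(2,3,4,1) pker_measurable_section C]
      integral_leb_on_parts[OF \<Omega> d(2,3,4,1) pker_measurable_section C']
    by (simp add: mollify_def)
qed

lemma L2_sum:
  assumes "\<And>i. i < (n::nat) \<Longrightarrow> integrable M (\<lambda>x. (d i x)\<^sup>2)" "\<And>i. i < n \<Longrightarrow> d i \<in> borel_measurable M"
  shows "integrable M (\<lambda>x. (\<Sum>i<n. d i x :: real)\<^sup>2)"
proof (rule Bochner_Integration.integrable_bound)
  show "integrable M (\<lambda>x. real n * (\<Sum>i<n. (d i x)\<^sup>2))" using assms(1) by auto
  show "(\<lambda>x. (\<Sum>i<n. d i x)\<^sup>2) \<in> borel_measurable M" using assms(2) by auto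
  have "(\<Sum>i<n. d i x)\<^sup>2 \<le> real n * (\<Sum>i<n. (d i x)\<^sup>2)" for x
    using Cauchy_Schwarz_ineq_sum[of "\<lambda>_. 1" "\<lambda>i. d i x" "{..<n}"] by simp
  then show "AE x in M. norm ((\<Sum>i<n. d i x)\<^sup>2) \<le> norm (real n * (\<Sum>i<n. (d i x)\<^sup>2))"
    by (intro AE_I2) (simp add: sum_nonneg)
qed

theorem three_balls_Schrodinger:
  assumes dom: "bounded_lipschitz_domain n \<Omega>" and r: "r > 0" and x0: "x0 \<in> inner_part n \<Omega> (3 * r)"
    and V: "V \<in> Linf_space n \<Omega>" and u: "u \<in> L2_space n \<Omega>" and sol: "schrodinger_solution n \<Omega> V u"
  shows "L2_norm n (Rn_ball n x0 (2 * r)) u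
    \<le> sqrt (2 * (scaled_coordinates.energy_const n + 1)) * exp (4 * (1 + r\<^sup>2 * Linf_norm n \<Omega> V) * expo_out)
      * L2_norm n (Rn_ball n x0 r) u powr (expo_out / (expo_in + expo_out))
      * L2_norm n (Rn_ball n x0 (3 * r)) u powr (1 - expo_out / (expo_in + expo_out))"
proof -
  interpret scaled_coordinates n x0 r by standard (rule r)
  note \<Omega> = bounded_domain_measure[OF dom]
  define \<kappa> where "\<kappa> = Linf_norm n \<Omega> V"
  have \<kappa>0: "\<kappa> \<ge> 0" by (simp add: \<kappa>_def Linf_norm_def)
  obtain u1 u2 where U: "integrable (Leb n) u1" "integrable (Leb n) (\<lambda>x. (u1 x)\<^sup>2)"
    "integrable (Leb n) u2" "integrable (Leb n) (\<lambda>x. (u2 x)\<^sup>2)"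
    "AE x in Leb n. indicator \<Omega> x *\<^sub>R u x = Complex (u1 x) (u2 x)"
    by (rule L2_space_Borel_parts[OF \<Omega> u])
  from sol obtain D where "\<forall>i<n. D i \<in> L2_space n \<Omega> \<and> has_weak_deriv n \<Omega> [i, i] u (D i)"
    and D3: "AE x in leb_on n \<Omega>. - (\<Sum>i<n. D i x) + V x * u x = 0"
    unfolding schrodinger_solution_def by (elim exE conjE)
  then have D: "\<And>i. i < n \<Longrightarrow> D i \<in> L2_space n \<Omega>" "\<And>i. i < n \<Longrightarrow> has_weak_deriv n \<Omega> [i, i] u (D i)"
    by blast+
  define parts where "parts i g \<longleftrightarrow> integrable (Leb n) (fst g) \<and> integrable (Leb n) (\<lambda>x. (fst g x)\<^sup>2) \<and>
    integrable (Leb n) (snd g) \<and> integrable (Leb n) (\<lambda>x. (snd g x)\<^sup>2) \<and>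
    (AE x in Leb n. indicator \<Omega> x *\<^sub>R D i x = Complex (fst g x) (snd g x))" for i g
  have "\<forall>i\<in>{..<n}. \<exists>g. parts i g"
  proof
    fix i assume "i \<in> {..<n}"
    then have "D i \<in> L2_space n \<Omega>" using D(1) by simp
    from L2_space_Borel_parts[OF \<Omega> this] obtain g1 g2 where
      "integrable (Leb n) g1" "integrable (Leb n) (\<lambda>x. (g1 x)\<^sup>2)"
      "integrable (Leb n) g2" "integrable (Leb n) (\<lambda>x. (g2 x)\<^sup>2)"
      "AE x in Leb n. indicator \<Omega> x *\<^sub>R D i x = Complex (g1 x) (g2 x)" .
    then show "\<exists>g. parts i g" unfolding parts_def by (intro exI[of _ "(g1, g2)"]) simp
  qed
  from bchoice[OF this] obtain g where g: "\<And>i. i < n \<Longrightarrow> integrable (Leb n) (fst (g i))"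
    "\<And>i. i < n \<Longrightarrow> integrable (Leb n) (\<lambda>x. (fst (g i) x)\<^sup>2)"
    "\<And>i. i < n \<Longrightarrow> integrable (Leb n) (snd (g i))" "\<And>i. i < n \<Longrightarrow> integrable (Leb n) (\<lambda>x. (snd (g i) x)\<^sup>2)"
    "\<And>i. i < n \<Longrightarrow> AE x in Leb n. indicator \<Omega> x *\<^sub>R D i x = Complex (fst (g i) x) (snd (g i) x)"
    by (auto simp: Ball_def parts_def)
  \<comment> \<open>\<open>f1\<close> and \<open>f2\<close> represent the weak Laplacian itself,
    which suits the mollified equation; its equality with V u, valid almost everywhere, is used only
    in \<open>le\<close>.\<close>
  define f1 where "f1 x = (\<Sum>i<n. fst (g i) x)" for x
  define f2 where "f2 x = (\<Sum>i<n. snd (g i) x)" for x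
  have f: "integrable (Leb n) f1" "integrable (Leb n) (\<lambda>x. (f1 x)\<^sup>2)"
    "integrable (Leb n) f2" "integrable (Leb n) (\<lambda>x. (f2 x)\<^sup>2)"
    unfolding f1_def[abs_def] f2_def[abs_def] using g by (auto intro!: L2_sum)
  obtain \<delta> where \<delta>: "\<delta> > 0" "\<And>y. y \<in> Rn n \<Longrightarrow> Rn_dist n x0 y < 3 * r + \<delta> \<Longrightarrow> y \<in> \<Omega>"
    using inner_part_ball[OF x0] by blast
  have dist9: "Rn_dist n x0 x < 3 * r" if "S x < 9" for x
  proof -
    have "sqrt (S x) < sqrt (3\<^sup>2)" using that by (subst real_sqrt_less_iff) simp
    then have "sqrt (S x) < 3" by simp
    then show ?thesis using r by (simp add: Rn_dist_eq[OF r] mult.commute)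
  qed
  have box: "Pi\<^sub>E {..<n} (\<lambda>i. {x i - e..x i}) \<subseteq> \<Omega>" if "S x < 9" "e > 0" "real n * e < \<delta>" for x e
  proof
    fix y assume y: "y \<in> Pi\<^sub>E {..<n} (\<lambda>i. {x i - e..x i})"
    have "Rn_dist n x y \<le> (\<Sum>i<n. \<bar>x i - y i\<bar>)" unfolding Rn_dist_def by (rule L2_set_le_sum_abs)
    also have "\<dots> \<le> (\<Sum>i<n. e)"
    proof (rule sum_mono)
      fix i assume "i \<in> {..<n}"
      with y have "y i \<in> {x i - e..x i}" by (auto simp: PiE_iff)
      then show "\<bar>x i - y i\<bar> \<le> e" by auto
    qed
    finally have "Rn_dist n x0 y < 3 * r + \<delta>"
      using Rn_dist_triangle[of n x0 y x] dist9[OF that(1)] that(3) by simp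
    moreover have "y \<in> Rn n" using y by (auto simp: Rn_def PiE_iff)
    ultimately show "y \<in> \<Omega>" using \<delta>(2) by blast
  qed
  \<comment> \<open>The box of side \<open>eps j\<close> below a point lies within distance n
    \<open>eps j\<close> of it, so this keeps the box inside \<Omega> by the margin
    \<delta>.\<close>
  have small: "eventually (\<lambda>j. real n * eps j < \<delta>) sequentially"
  proof (rule eventually_mono[OF eventually_eps_less])
    show "0 < \<delta> / (real n + 1)" using \<delta>(1) by simp
    fix j assume "eps j < \<delta> / (real n + 1)"
    then have "eps j * (real n + 1) < \<delta>" by (simp add: pos_less_divide_eq)
    then show "real n * eps j < \<delta>" using eps_pos[of j]
      by (simp only: distrib_left mult_1_right mult.commute[of "real n"])
  qed
  have wd: "mollify n (eps j) (dirs (dirs (\<lambda>_. 0) i) i) u1 x = mollify n (eps j) (\<lambda>_. 0) (fst (g i)) x \<and>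
      mollify n (eps j) (dirs (dirs (\<lambda>_. 0) i) i) u2 x = mollify n (eps j) (\<lambda>_. 0) (snd (g i)) x"
    if "S x < 9" "real n * eps j < \<delta>" "i < n" for x j i
    using that D(1,2) g by (intro weak_deriv_mol[OF \<Omega>(1) eps_pos that(3) box _ u U(1,3,5)]) auto
  have eq: "mollified_laplace v (\<lambda>x. \<Sum>i<n. d i x)"
    if d: "\<And>i. i < n \<Longrightarrow> integrable (Leb n) (d i)"
      and v: "\<And>x j i. S x < 9 \<Longrightarrow> real n * eps j < \<delta> \<Longrightarrow> i < n \<Longrightarrow>
        mollify n (eps j) (dirs (dirs (\<lambda>_. 0) i) i) v x = mollify n (eps j) (\<lambda>_. 0) (d i) x" for v d
    unfolding mollified_laplace_def using small
  proof (rule eventually_mono, intro ballI impI)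
    fix j x assume *: "real n * eps j < \<delta>" "S x < 9"
    have "mollify n (eps j) (\<lambda>_. 0) (\<lambda>x. \<Sum>i<n. d i x) x = (\<Sum>i<n. mollify n (eps j) (\<lambda>_. 0) (d i) x)"
      unfolding mollify_def sum_distrib_right
      using d by (intro Bochner_Integration.integral_sum integrable_mult_pker) auto
    then show "(\<Sum>i<n. mollify n (eps j) (dirs (dirs (\<lambda>_. 0) i) i) v x) = mollify n (eps j) (\<lambda>_. 0) (\<lambda>x. \<Sum>i<n. d i x) x"
      using v[OF *(2,1)] by simp
  qed
  have eq1: "mollified_laplace u1 f1" and eq2: "mollified_laplace u2 f2"
    unfolding f1_def[abs_def] f2_def[abs_def] using g wd by (auto intro!: eq)
  have Vb: "AE x in leb_on n \<Omega>. cmod (V x) \<le> \<kappa>"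
  proof -
    have fin: "esssup (leb_on n \<Omega>) (\<lambda>x. ennreal (cmod (V x))) < \<infinity>" using V by (simp add: Linf_space_def)
    show ?thesis using esssup_AE[of "\<lambda>x. ennreal (cmod (V x))" "leb_on n \<Omega>"]
    proof eventually_elim
      fix x assume "ennreal (cmod (V x)) \<le> esssup (leb_on n \<Omega>) (\<lambda>x. ennreal (cmod (V x)))"
      from enn2real_mono[OF this] fin show "cmod (V x) \<le> \<kappa>" by (simp add: \<kappa>_def Linf_norm_def)
    qed
  qed
  have gAE: "AE x in Leb n. \<forall>i\<in>{..<n}. indicator \<Omega> x *\<^sub>R D i x = Complex (fst (g i) x) (snd (g i) x)"
    using g(5) by (intro AE_finite_allI) auto
  have le: "AE x in Leb n. S x < 9 \<longrightarrow> (f1 x)\<^sup>2 + (f2 x)\<^sup>2 \<le> \<kappa>\<^sup>2 * ((u1 x)\<^sup>2 + (u2 x)\<^sup>2)"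
    using gAE U(5) Vb[unfolded AE_leb_on[OF \<Omega>(1)]] D3[unfolded AE_leb_on[OF \<Omega>(1)]] AE_space
  proof eventually_elim
    case (elim x)
    show ?case
    proof
      assume "S x < 9"
      then have x: "x \<in> \<Omega>" using dist9[of x] \<delta> elim(5) by (auto simp: Rn_def space_PiM)
      have "(\<Sum>i<n. D i x) = (\<Sum>i<n. Complex (fst (g i) x) (snd (g i) x))"
        using elim(1) x by (intro sum.cong) auto
      also have "\<dots> = Complex (f1 x) (f2 x)" by (simp add: complex_eq_iff f1_def f2_def)
      finally have "Complex (f1 x) (f2 x) = V x * u x" using elim(4) x by simp
      also have "u x = Complex (u1 x) (u2 x)" using elim(2) x by simp
      finally have "(cmod (Complex (f1 x) (f2 x)))\<^sup>2 = (cmod (V x))\<^sup>2 * (cmod (Complex (u1 x) (u2 x)))\<^sup>2"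
        by (simp add: norm_mult power_mult_distrib)
      also have "\<dots> \<le> \<kappa>\<^sup>2 * (cmod (Complex (u1 x) (u2 x)))\<^sup>2"
        using elim(3) x by (intro mult_right_mono power_mono) auto
      finally show "(f1 x)\<^sup>2 + (f2 x)\<^sup>2 \<le> \<kappa>\<^sup>2 * ((u1 x)\<^sup>2 + (u2 x)\<^sup>2)" by (simp add: cmod_power2)
    qed
  qed
  define m where "m = mass u1 u2"
  note m_eq = m_def[symmetric] and m_def = m_def[THEN fun_cong, unfolded mass_def]
  note [measurable] = U(1,3)[THEN borel_measurable_integrable]
  have int: "integrable (Leb n) (\<lambda>x. indicator {..<c} (S x) * ((u1 x)\<^sup>2 + (u2 x)\<^sup>2))" for c :: real
    by (rule Bochner_Integration.integrable_bound[OF Bochner_Integration.integrable_add[OF U(2,4)]])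
       (auto simp: indicator_def)
  have m_mono: "m c \<le> m d" if "c \<le> d" for c d
    unfolding m_def using that by (intro integral_mono int) (auto simp: indicator_def)
  have norm: "L2_norm n (Rn_ball n x0 (k * r)) u = sqrt (m (k\<^sup>2))" if k: "0 < k" "k \<le> 3" for k
  proof -
    have B: "Rn_ball n x0 (k * r) = {x \<in> space (Leb n). S x < k\<^sup>2}" by (rule Rn_ball_eq[OF r k(1)])
    have meas: "Rn_ball n x0 (k * r) \<in> sets (Leb n)" unfolding B by measurable
    have "k * r \<le> 3 * r" using k r by (intro mult_right_mono) auto
    then have sub: "Rn_ball n x0 (k * r) \<subseteq> \<Omega>" using \<delta> by (force simp: Rn_ball_def)
    have "L2_norm n (Rn_ball n x0 (k * r)) u
        = sqrt (\<integral>x. indicator (Rn_ball n x0 (k * r)) x * ((u1 x)\<^sup>2 + (u2 x)\<^sup>2) \<partial>Leb n)"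
      using U u by (intro L2_norm_parts[OF \<Omega>(1) meas sub]) auto
    also have "(\<integral>x. indicator (Rn_ball n x0 (k * r)) x * ((u1 x)\<^sup>2 + (u2 x)\<^sup>2) \<partial>Leb n) = m (k\<^sup>2)"
      unfolding m_def B by (intro Bochner_Integration.integral_cong) (auto simp: indicator_def)
    finally show ?thesis .
  qed
  have n1: "L2_norm n (Rn_ball n x0 r) u = sqrt (m 1)" using norm[of 1] by simp
  have n2: "L2_norm n (Rn_ball n x0 (2 * r)) u = sqrt (m 4)" using norm[of 2] by simp
  have n3: "L2_norm n (Rn_ball n x0 (3 * r)) u = sqrt (m 9)" using norm[of 3] by simp
  have m0: "m c \<ge> 0" for c unfolding m_def by (intro Bochner_Integration.integral_nonneg) auto
  show ?thesis
    unfolding n1 n2 n3 \<kappa>_def[symmetric]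
  proof (rule three_balls_optimization)
    show "0 \<le> sqrt (m 1)" "sqrt (m 1) \<le> sqrt (m 4)" "sqrt (m 4) \<le> sqrt (m 9)"
      using m0 m_mono by auto
    show "1 \<le> energy_const + 1" using energy_const_pos by simp
    show "0 \<le> 4 * (1 + r\<^sup>2 * \<kappa>)" using \<kappa>0 by simp
    fix t assume t: "4 * (1 + r\<^sup>2 * \<kappa>) \<le> t"
    show "(sqrt (m 4))\<^sup>2 \<le> (energy_const + 1) * (exp (2 * t * expo_in) * (sqrt (m 1))\<^sup>2 + exp (- 2 * t * expo_out) * (sqrt (m 9))\<^sup>2)"
      using three_annuli[OF U(1-4) f eq1 eq2 le \<kappa>0 t] m0 by (simp add: m_eq)
  qed (rule expo_pos)+
qed

theorem theorem3p2:
  shows "\<exists>\<alpha>::real. 0 < \<alpha> \<and> \<alpha> < 1 \<and>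
    (\<forall>n::nat. n \<ge> 3 \<longrightarrow> (\<exists>c::real. c \<ge> 1 \<and>
    (\<forall>r0::real. r0 > 0 \<longrightarrow> (\<exists>c1::real. c1 > 0 \<and>
    (\<forall>\<Omega>. bounded_lipschitz_domain n \<Omega> \<and> inner_part n \<Omega> r0 \<noteq> {} \<longrightarrow>
    (\<forall>r::real. 0 < r \<and> r < r0 / 3 \<longrightarrow>
    (\<forall>x0 \<in> inner_part n \<Omega> (3 * r). \<forall>V \<in> Linf_space n \<Omega>. \<forall>u \<in> Sobolev_H 2 n \<Omega>.
       schrodinger_solution n \<Omega> V u \<longrightarrow>
       L2_norm n (Rn_ball n x0 (2 * r)) u
         \<le> c * exp (c1 * Linf_norm n \<Omega> V)
             * L2_norm n (Rn_ball n x0 r) u powr \<alpha>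
             * L2_norm n (Rn_ball n x0 (3 * r)) u powr (1 - \<alpha>))))))))"
proof (rule exI[of _ "expo_out / (expo_in + expo_out)"], intro conjI allI impI, goal_cases)
  case (3 n)
  define c where "c = sqrt (2 * (scaled_coordinates.energy_const n + 1)) * exp (4 * expo_out)"
  \<comment> \<open>\<open>energy_const\<close> depends on \<open>n\<close> alone; center 0 and
    scale 1 merely provide an instance in which its positivity can be quoted.\<close>
  interpret scaled_coordinates n "\<lambda>_. 0" 1 by standard simp
  have "1 \<le> sqrt (2 * (energy_const + 1))" using energy_const_pos by simp
  moreover have "1 \<le> exp (4 * expo_out)" using expo_pos by simp
  ultimately have c: "c \<ge> 1" unfolding c_def using mult_mono[of 1 _ 1] by fastforce
  show ?case
  proof (rule exI[of _ c], intro conjI allI impI c, goal_cases)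
    case (1 r0)
    show ?case
    \<comment> \<open>exp(4 (1 + r^2 \<kappa>) Q) splits into exp(4 Q), which goes into
      \<open>c\<close>, and exp(4 r^2 Q \<kappa>), in which r^2 is replaced by the larger
      r0^2.\<close>
    proof (rule exI[of _ "4 * r0\<^sup>2 * expo_out"], intro conjI allI impI ballI, goal_cases)
      case (2 \<Omega> r x0 V u)
      let ?\<kappa> = "Linf_norm n \<Omega> V"
      let ?A = "L2_norm n (Rn_ball n x0 r) u powr (expo_out / (expo_in + expo_out))"
      let ?Z = "L2_norm n (Rn_ball n x0 (3 * r)) u powr (1 - expo_out / (expo_in + expo_out))"
      have "L2_norm n (Rn_ball n x0 (2 * r)) u
        \<le> sqrt (2 * (energy_const + 1)) * exp (4 * (1 + r\<^sup>2 * ?\<kappa>) * expo_out) * ?A * ?Z"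
        using 2 by (intro three_balls_Schrodinger) (auto simp: Sobolev_H_def)
      also have "\<dots> = c * exp (4 * r\<^sup>2 * expo_out * ?\<kappa>) * ?A * ?Z"
        by (simp add: c_def exp_add[symmetric] algebra_simps)
      also have "\<dots> \<le> c * exp (4 * r0\<^sup>2 * expo_out * ?\<kappa>) * ?A * ?Z"
      proof -
        have "r\<^sup>2 \<le> r0\<^sup>2" using 2 by (intro power_mono) auto
        then have "4 * r\<^sup>2 * expo_out * ?\<kappa> \<le> 4 * r0\<^sup>2 * expo_out * ?\<kappa>"
          using expo_pos by (intro mult_right_mono) (auto simp: Linf_norm_def)
        then show ?thesis using c by (intro mult_right_mono mult_left_mono) auto
      qed
      finally show ?case .
    qed (use 1 expo_pos in simp)
  qed
qed (use expo_pos in auto)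

end
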